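(* Let $\mathbb{F}$ be a field with $|\mathbb{F}|>2$, let $n\ge 3$, and let $V$ be an $n$-dimensional $\mathbb{F}$-vector space, $G=GL(V)$. Any $G$-submodule of $\mathcal{M}^{\ast\ast}$ which is not contained in $\mathcal{M}^{\ast}$ contains $\mathcal{U}$. Moreover: (1) If $\operatorname{char}\mathbb{F}\nmid n-1$ (including $\operatorname{char}\mathbb{F}=0$), then $\mathcal{M}^{\ast\ast}=\mathcal{U}\oplus\mathcal{M}^{\ast}$, $\mathcal{M}^{\ast\ast}/\mathcal{U}\simeq\widehat V\oplus\widehat V$ as $G$-modules, $\mathcal{M}^{\ast\ast}/\mathcal{M}^{\ast}$ is $G$-isomorphic to $\mathcal{U}$, and $\mathcal{U}$ is irreducible. (2) If $\operatorname{char}\mathbb{F}\mid n-1$, then $\mathcal{U}\cap\mathcal{M}^{\ast}=\mathcal{M}^{\ast}_{(1,-1)}$, $\mathcal{U}+\mathcal{M}^{\ast}$ is a $G$-submodule of $\mathcal{M}^{\ast\ast}$ of codimension $n$, $\mathcal{M}^{\ast\ast}/\mathcal{U}\simeq\widehat V\oplus\widehat V$ as $G$-modules, and $(\mathcal{U}+\mathcal{M}^{\ast})/\mathcal{M}^{\ast}$ is irreducible and $G$-isomorphic to $\mathcal{U}/\mathcal{M}^{\ast}_{(1,-1)}$; in this case $\mathcal{M}^{\ast\ast}/\mathcal{M}^{\ast}$ has the same composition factors as $\mathcal{U}$ (up to $G$-isomorphism, with multiplicity), but it is not $G$-isomorphic to $\mathcal{U}$.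
   Context: $V$ is an $n$-dimensional vector space over $\mathbb{F}$ with a fixed basis $v_1,\dots,v_n$; $G=GL(V)$ acts on $V$ on the left. The dual space $\widehat V$ is a right $G$-module via $(\varphi g)(v)=\varphi(gv)$. $\boldsymbol{\Lambda}=\mathbb{F}^{n^3}$ is the space of structure vectors $\boldsymbol{\lambda}=(\lambda_{ijk})_{1\le i,j,k\le n}$; such a vector corresponds to the (not necessarily associative) algebra on $V$ whose bilinear product is $[v_i,v_j]=\sum_k\lambda_{ijk}v_k$. $G$ acts linearly on $\boldsymbol{\Lambda}$ on the right: $\boldsymbol{\lambda}g$ is the structure vector of the product $[u,v]'=g^{-1}[gu,gv]$. $G$-submodules of $\boldsymbol{\Lambda}$ are with respect to this action. Define the following $G$-submodules of $\boldsymbol{\Lambda}$ (where $[\,,\,]$ is the product with structure vector $\boldsymbol{\lambda}$): $\mathcal{K}$ = all $\boldsymbol{\lambda}$ with $[v,v]=0$ for all $v\in V$; $\mathcal{T}$ = all $\boldsymbol{\lambda}$ such that for every $u\in V$ the linear map $v\mapsto[u,v]$ has trace $0$; $\mathcal{U}=\mathcal{K}\cap\mathcal{T}$; $\mathcal{M}^{\ast}$ = all $\boldsymbol{\lambda}$ such that $[u,v]$ lies in the $\mathbb{F}$-span of $u,v$ for all $u,v\in V$; $\mathcal{M}^{\ast\ast}$ = all $\boldsymbol{\lambda}$ with $[v,v]\in\mathbb{F}v$ for all $v\in V$; $\mathcal{M}^{\ast}_{(1,-1)}$ = all structure vectors of products of the form $[u,v]=\theta(v)u-\theta(u)v$ with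 $\theta\in\widehat V$. *)

theory Defs
  imports "HOL-Analysis.Analysis"
begin

section \<open>Right modules over a group acting linearly\<close>

text \<open>
  The carrier is explicit, so that submodules and quotients (whose elements are cosets) are again
  values of this record type. The ground field is the type \<open>'f\<close>, the acting group is a set of
  elements of type \<open>'g\<close>, passed separately as \<open>G\<close>.
\<close>

record ('f, 'g, 'm) gmodule =
  gcarrier :: "'m set"
  gzero :: "'m"
  gadd :: "'m \<Rightarrow> 'm \<Rightarrow> 'm"
  gsmult :: "'f \<Rightarrow> 'm \<Rightarrow> 'm"
  gact :: "'m \<Rightarrow> 'g \<Rightarrow> 'm"

definition gsubmodule :: "'g set \<Rightarrow> ('f, 'g, 'm) gmodule \<Rightarrow> 'm set \<Rightarrow> bool" where
  "gsubmodule G M N \<longleftrightarrow>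
     N \<subseteq> gcarrier M \<and> gzero M \<in> N \<and>
     (\<forall>x\<in>N. \<forall>y\<in>N. gadd M x y \<in> N) \<and>
     (\<forall>c. \<forall>x\<in>N. gsmult M c x \<in> N) \<and>
     (\<forall>x\<in>N. \<forall>g\<in>G. gact M x g \<in> N)"

definition gsub :: "('f, 'g, 'm) gmodule \<Rightarrow> 'm set \<Rightarrow> ('f, 'g, 'm) gmodule" where
  "gsub M N = M\<lparr>gcarrier := N\<rparr>"

definition gcoset :: "('f, 'g, 'm) gmodule \<Rightarrow> 'm set \<Rightarrow> 'm \<Rightarrow> 'm set" where
  "gcoset M N x = {gadd M x y | y. y \<in> N}"

text \<open>
  The operations take the union of the cosets of the results over all representatives; for a
  submodule \<open>N\<close> all of these cosets coincide.
\<close>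

definition gquot :: "('f, 'g, 'm) gmodule \<Rightarrow> 'm set \<Rightarrow> ('f, 'g, 'm set) gmodule" where
  "gquot M N =
     \<lparr>gcarrier = gcoset M N ` gcarrier M,
      gzero = N,
      gadd = (\<lambda>A B. \<Union>a\<in>A. \<Union>b\<in>B. gcoset M N (gadd M a b)),
      gsmult = (\<lambda>c A. \<Union>a\<in>A. gcoset M N (gsmult M c a)),
      gact = (\<lambda>A g. \<Union>a\<in>A. gcoset M N (gact M a g))\<rparr>"

definition gdirect_sum ::
  "('f, 'g, 'm) gmodule \<Rightarrow> ('f, 'g, 'k) gmodule \<Rightarrow> ('f, 'g, 'm \<times> 'k) gmodule" where
  "gdirect_sum M N =
     \<lparr>gcarrier = gcarrier M \<times> gcarrier N,
      gzero = (gzero M, gzero N),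
      gadd = (\<lambda>p q. (gadd M (fst p) (fst q), gadd N (snd p) (snd q))),
      gsmult = (\<lambda>c p. (gsmult M c (fst p), gsmult N c (snd p))),
      gact = (\<lambda>p g. (gact M (fst p) g, gact N (snd p) g))\<rparr>"

definition gsum :: "('f, 'g, 'm) gmodule \<Rightarrow> 'm set \<Rightarrow> 'm set \<Rightarrow> 'm set" where
  "gsum M A B = {gadd M a b | a b. a \<in> A \<and> b \<in> B}"

definition is_internal_direct_sum ::
  "('f, 'g, 'm) gmodule \<Rightarrow> 'm set \<Rightarrow> 'm set \<Rightarrow> 'm set \<Rightarrow> bool" where
  "is_internal_direct_sum M C A B \<longleftrightarrow> C = gsum M A B \<and> A \<inter> B = {gzero M}"

definition giso ::
  "'g set \<Rightarrow> ('f, 'g, 'm) gmodule \<Rightarrow> ('f, 'g, 'k) gmodule \<Rightarrow> bool" where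
  "giso G M N \<longleftrightarrow>
     (\<exists>f. bij_betw f (gcarrier M) (gcarrier N) \<and>
        (\<forall>x\<in>gcarrier M. \<forall>y\<in>gcarrier M. f (gadd M x y) = gadd N (f x) (f y)) \<and>
        (\<forall>c. \<forall>x\<in>gcarrier M. f (gsmult M c x) = gsmult N c (f x)) \<and>
        (\<forall>x\<in>gcarrier M. \<forall>g\<in>G. f (gact M x g) = gact N (f x) g))"

definition girreducible :: "'g set \<Rightarrow> ('f, 'g, 'm) gmodule \<Rightarrow> bool" where
  "girreducible G M \<longleftrightarrow>
     gcarrier M \<noteq> {gzero M} \<and>
     (\<forall>N. gsubmodule G M N \<longrightarrow> N = {gzero M} \<or> N = gcarrier M)"

definition comp_factor :: "('f, 'g, 'm) gmodule \<Rightarrow> 'm set list \<Rightarrow> nat \<Rightarrow> ('f, 'g, 'm set) gmodule"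
  where "comp_factor M Ns i = gquot (gsub M (Ns ! Suc i)) (Ns ! i)"

definition composition_series :: "'g set \<Rightarrow> ('f, 'g, 'm) gmodule \<Rightarrow> 'm set list \<Rightarrow> bool" where
  "composition_series G M Ns \<longleftrightarrow>
     Ns \<noteq> [] \<and> hd Ns = {gzero M} \<and> last Ns = gcarrier M \<and>
     (\<forall>N\<in>set Ns. gsubmodule G M N) \<and>
     (\<forall>i < length Ns - 1. Ns ! i \<subset> Ns ! Suc i \<and> girreducible G (comp_factor M Ns i))"

text \<open>
  By the Jordan--Hoelder theorem it does not matter which composition series are compared. The
  bijection accounts for multiplicities.
\<close>

definition same_composition_factors ::
  "'g set \<Rightarrow> ('f, 'g, 'm) gmodule \<Rightarrow> ('f, 'g, 'k) gmodule \<Rightarrow> bool" where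
  "same_composition_factors G M N \<longleftrightarrow>
     (\<exists>Ms Ns \<sigma>. composition_series G M Ms \<and> composition_series G N Ns \<and>
        bij_betw \<sigma> {..<length Ms - 1} {..<length Ns - 1} \<and>
        (\<forall>i < length Ms - 1. giso G (comp_factor M Ms i) (comp_factor N Ns (\<sigma> i))))"

section \<open>The general linear group and the dual space\<close>

text \<open>
  The space \<open>V\<close> is the type \<open>'v\<close> with scalar multiplication \<open>s\<close>; its fixed basis is indexed by the
  finite type \<open>'n\<close>, so that the dimension is \<open>CARD('n)\<close>.
\<close>

definition vs_basis :: "('f::field \<Rightarrow> 'v::ab_group_add \<Rightarrow> 'v) \<Rightarrow> ('n::finite \<Rightarrow> 'v) \<Rightarrow> bool" where
  "vs_basis s v \<longleftrightarrow>
     vector_space s \<and> inj v \<and> \<not> module.dependent s (range v) \<and> module.span s (range v) = UNIV"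

definition coord ::
  "('f::field \<Rightarrow> 'v::ab_group_add \<Rightarrow> 'v) \<Rightarrow> ('n::finite \<Rightarrow> 'v) \<Rightarrow> 'v \<Rightarrow> 'n \<Rightarrow> 'f" where
  "coord s v x k = module.representation s (range v) x (v k)"

definition GL :: "('f::field \<Rightarrow> 'v::ab_group_add \<Rightarrow> 'v) \<Rightarrow> ('v \<Rightarrow> 'v) set" where
  "GL s = {g. Vector_Spaces.linear s s g \<and> bij g}"

definition dual :: "('f::field \<Rightarrow> 'v::ab_group_add \<Rightarrow> 'v) \<Rightarrow> ('v \<Rightarrow> 'f) set" where
  "dual s = {\<phi>. Vector_Spaces.linear s (*) \<phi>}"

definition dual_module ::
  "('f::field \<Rightarrow> 'v::ab_group_add \<Rightarrow> 'v) \<Rightarrow> ('f, 'v \<Rightarrow> 'v, 'v \<Rightarrow> 'f) gmodule" where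
  "dual_module s =
     \<lparr>gcarrier = dual s,
      gzero = (\<lambda>x. 0),
      gadd = (\<lambda>\<phi> \<psi> x. \<phi> x + \<psi> x),
      gsmult = (\<lambda>c \<phi> x. c * \<phi> x),
      gact = (\<lambda>\<phi> g x. \<phi> (g x))\<rparr>"

definition trace_of ::
  "('f::field \<Rightarrow> 'v::ab_group_add \<Rightarrow> 'v) \<Rightarrow> ('n::finite \<Rightarrow> 'v) \<Rightarrow> ('v \<Rightarrow> 'v) \<Rightarrow> 'f" where
  "trace_of s v L = trace (\<chi> i j. coord s v (L (v j)) i)"

section \<open>Structure vectors\<close>

text \<open>The entry \<open>l $ i $ j $ k\<close> is the coefficient of \<open>v k\<close> in the product of \<open>v i\<close> and \<open>v j\<close>.\<close>

type_synonym ('f, 'n) struct_vec = "'f ^ 'n ^ 'n ^ 'n"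

definition alg_prod ::
  "('f::field \<Rightarrow> 'v::ab_group_add \<Rightarrow> 'v) \<Rightarrow> ('n::finite \<Rightarrow> 'v) \<Rightarrow> ('f, 'n) struct_vec
    \<Rightarrow> 'v \<Rightarrow> 'v \<Rightarrow> 'v" where
  "alg_prod s v l x y =
     (\<Sum>i\<in>UNIV. \<Sum>j\<in>UNIV. s (coord s v x i * coord s v y j) (\<Sum>k\<in>UNIV. s (l $ i $ j $ k) (v k)))"

definition struct_vec_of ::
  "('f::field \<Rightarrow> 'v::ab_group_add \<Rightarrow> 'v) \<Rightarrow> ('n::finite \<Rightarrow> 'v) \<Rightarrow> ('v \<Rightarrow> 'v \<Rightarrow> 'v)
    \<Rightarrow> ('f, 'n) struct_vec" where
  "struct_vec_of s v p = (\<chi> i j k. coord s v (p (v i) (v j)) k)"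

definition lam_smult :: "'f::field \<Rightarrow> ('f, 'n::finite) struct_vec \<Rightarrow> ('f, 'n) struct_vec" where
  "lam_smult c l = (\<chi> i j k. c * l $ i $ j $ k)"

definition lam_act ::
  "('f::field \<Rightarrow> 'v::ab_group_add \<Rightarrow> 'v) \<Rightarrow> ('n::finite \<Rightarrow> 'v) \<Rightarrow> ('f, 'n) struct_vec
    \<Rightarrow> ('v \<Rightarrow> 'v) \<Rightarrow> ('f, 'n) struct_vec" where
  "lam_act s v l g = struct_vec_of s v (\<lambda>x y. inv g (alg_prod s v l (g x) (g y)))"

definition Lam ::
  "('f::field \<Rightarrow> 'v::ab_group_add \<Rightarrow> 'v) \<Rightarrow> ('n::finite \<Rightarrow> 'v)
    \<Rightarrow> ('f, 'v \<Rightarrow> 'v, ('f, 'n) struct_vec) gmodule" where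
  "Lam s v =
     \<lparr>gcarrier = UNIV, gzero = 0, gadd = (+), gsmult = lam_smult, gact = lam_act s v\<rparr>"

definition K_sub ::
  "('f::field \<Rightarrow> 'v::ab_group_add \<Rightarrow> 'v) \<Rightarrow> ('n::finite \<Rightarrow> 'v) \<Rightarrow> ('f, 'n) struct_vec set" where
  "K_sub s v = {l. \<forall>x. alg_prod s v l x x = 0}"

definition T_sub ::
  "('f::field \<Rightarrow> 'v::ab_group_add \<Rightarrow> 'v) \<Rightarrow> ('n::finite \<Rightarrow> 'v) \<Rightarrow> ('f, 'n) struct_vec set" where
  "T_sub s v = {l. \<forall>u. trace_of s v (\<lambda>x. alg_prod s v l u x) = 0}"

definition U_sub ::
  "('f::field \<Rightarrow> 'v::ab_group_add \<Rightarrow> 'v) \<Rightarrow> ('n::finite \<Rightarrow> 'v) \<Rightarrow> ('f, 'n) struct_vec set" where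
  "U_sub s v = K_sub s v \<inter> T_sub s v"

text \<open>\<open>M1_sub\<close>, \<open>M2_sub\<close> and \<open>M1m_sub\<close> are \<open>\<M>\<^sup>*\<close>, \<open>\<M>\<^sup>*\<^sup>*\<close> and \<open>\<M>\<^sup>*\<close> with index \<open>(1, -1)\<close>.\<close>

definition M1_sub ::
  "('f::field \<Rightarrow> 'v::ab_group_add \<Rightarrow> 'v) \<Rightarrow> ('n::finite \<Rightarrow> 'v) \<Rightarrow> ('f, 'n) struct_vec set" where
  "M1_sub s v = {l. \<forall>x y. alg_prod s v l x y \<in> module.span s {x, y}}"

definition M2_sub ::
  "('f::field \<Rightarrow> 'v::ab_group_add \<Rightarrow> 'v) \<Rightarrow> ('n::finite \<Rightarrow> 'v) \<Rightarrow> ('f, 'n) struct_vec set" where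
  "M2_sub s v = {l. \<forall>x. \<exists>c. alg_prod s v l x x = s c x}"

definition M1m_sub ::
  "('f::field \<Rightarrow> 'v::ab_group_add \<Rightarrow> 'v) \<Rightarrow> ('n::finite \<Rightarrow> 'v) \<Rightarrow> ('f, 'n) struct_vec set" where
  "M1m_sub s v =
     {l. \<exists>\<theta>\<in>dual s. \<forall>x y. alg_prod s v l x y = s (\<theta> y) x - s (\<theta> x) y}"

end

theory Submission
  imports Defs
begin

text \<open>
  A transvection \<open>x \<mapsto> x + t \<psi>(x) u\<close> changes \<open>\<lambda> \<in> \<M>\<^sup>*\<^sup>*\<close> by \<open>t D + t\<^sup>2 Q\<close>, where \<open>Q\<close> is the product
  \<open>[x, y] = (\<gamma>(x) \<psi>(y) - \<gamma>(y) \<psi>(x)) u\<close> with \<open>\<gamma>(y) = \<psi>([u, y])\<close>. Since \<open>\<F>\<close> has a scalar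
  \<open>t \<noteq> 0, 1\<close>, a submodule containing \<open>\<lambda>\<close> contains \<open>D\<close> and \<open>Q\<close>, and some \<open>Q\<close> lies outside
  \<open>\<M>\<^sup>*\<close> when \<open>\<lambda>\<close> does. From one such product further transvections produce
  all \<open>(\<beta> \<and> \<gamma>) \<otimes> w\<close> with \<open>\<beta>(w) = \<gamma>(w) = 0\<close>, and these span \<open>\<U>\<close>.

  On \<open>\<M>\<^sup>*\<^sup>*\<close> one has \<open>[x, x] = q(x) x\<close> with \<open>q\<close> linear (again because \<open>|\<F>| > 2\<close>), and
  \<open>\<lambda> \<mapsto> (q, tr)\<close> induces \<open>\<M>\<^sup>*\<^sup>* / \<U> \<simeq> V* \<oplus> V*\<close>. If \<open>char \<F>\<close> divides \<open>n - 1\<close>, the kernel of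
  \<open>\<lambda> \<mapsto> tr - q\<close> is \<open>\<U> + \<M>\<^sup>*\<close>. In that case \<open>\<M>\<^sup>*\<^sup>* / \<M>\<^sup>*\<close> and \<open>\<U>\<close> are not isomorphic:
  in \<open>\<U>\<close> there is a nonzero submodule on which the coefficient \<open>Q\<close> of \<open>t\<^sup>2\<close> always vanishes, and
  in \<open>\<M>\<^sup>*\<^sup>* / \<M>\<^sup>*\<close> there is none.
\<close>

section \<open>Modules over a group acting linearly\<close>

text \<open>The action of a transvection stops at \<open>t\<^sup>2\<close> because the cubic
  coefficient contains \<psi>([u, u]), and [u, u] is a multiple of u while \<psi>(u) = 0. Hence the
  values at 1 and at one further nonzero scalar separate D from Q over every admissible field,
  finite or not. A product outside \<open>M1\<close> has a Q outside \<open>M1\<close> for the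
  following reason: if [u, y] is not in the span of u and y, one takes a form \<psi> that kills u
  and y but not [u, y]. The obstacle to spanning \<open>U\<close> is that the basis terms of a
  traceless product need not be traceless: a term with value v_j on the pair (v_i, v_j) carries
  trace, and only differences of such terms lie in the submodule. The number n - 1 comes from one
  computation: the product \<theta>(y) x - \<theta>(x) y has trace form (1 - n) \<theta>. So
  \<open>M1m\<close> lies in \<open>U\<close> if n = 1 in the field and meets it in 0 otherwise. In
  the first case \<open>U\<close> has a copy of the dual space at the bottom and
  \<open>M2 / M1\<close> has one at the top.\<close>

lemma gsub_simps [simp]:
  "gcarrier (gsub M N) = N" "gzero (gsub M N) = gzero M" "gadd (gsub M N) = gadd M"
  "gsmult (gsub M N) = gsmult M" "gact (gsub M N) = gact M"
  by (simp_all add: gsub_def)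

lemma gsub_gsub [simp]: "gsub (gsub M A) B = gsub M B"
  by (simp add: gsub_def)

lemma gsub_gcarrier [simp]: "gsub M (gcarrier M) = M"
  by (simp add: gsub_def)

lemma gcoset_gsub [simp]: "gcoset (gsub M A) N = gcoset M N"
  by (simp add: gcoset_def fun_eq_iff)

text \<open>The operations of a quotient never look at the carrier, so this is an equality of
  records and not only an isomorphism; it lets a submodule of a quotient be treated as a
  quotient.\<close>

lemma gsub_gquot: "gsub (gquot (gsub M A) N) (gcoset M N ` B) = gquot (gsub M B) N"
  by (simp add: gsub_def gquot_def gcoset_def)

lemma gcarrier_gquot: "gcarrier (gquot M N) = gcoset M N ` gcarrier M"
  by (simp add: gquot_def)

lemma gzero_gquot: "gzero (gquot M N) = N"
  by (simp add: gquot_def)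

text \<open>
  Compatibility of the action with the multiplication of the group plays no role, so \<open>G\<close> is just a
  set of operators.
\<close>

locale gmod =
  fixes G :: "'g set" and M :: "('f::field, 'g, 'm) gmodule"
  assumes zero_closed [simp]: "gzero M \<in> gcarrier M"
    and add_closed [simp]: "\<lbrakk>x \<in> gcarrier M; y \<in> gcarrier M\<rbrakk> \<Longrightarrow> gadd M x y \<in> gcarrier M"
    and smult_closed [simp]: "x \<in> gcarrier M \<Longrightarrow> gsmult M c x \<in> gcarrier M"
    and act_closed [simp]: "\<lbrakk>x \<in> gcarrier M; g \<in> G\<rbrakk> \<Longrightarrow> gact M x g \<in> gcarrier M"
    and add_assoc: "\<lbrakk>x \<in> gcarrier M; y \<in> gcarrier M; z \<in> gcarrier M\<rbrakk>
      \<Longrightarrow> gadd M (gadd M x y) z = gadd M x (gadd M y z)"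
    and add_commute: "\<lbrakk>x \<in> gcarrier M; y \<in> gcarrier M\<rbrakk> \<Longrightarrow> gadd M x y = gadd M y x"
    and zero_add [simp]: "x \<in> gcarrier M \<Longrightarrow> gadd M (gzero M) x = x"
    and neg_add: "x \<in> gcarrier M \<Longrightarrow> gadd M (gsmult M (-1) x) x = gzero M"
    and smult_add: "\<lbrakk>x \<in> gcarrier M; y \<in> gcarrier M\<rbrakk>
      \<Longrightarrow> gsmult M c (gadd M x y) = gadd M (gsmult M c x) (gsmult M c y)"
    and act_add: "\<lbrakk>x \<in> gcarrier M; y \<in> gcarrier M; g \<in> G\<rbrakk>
      \<Longrightarrow> gact M (gadd M x y) g = gadd M (gact M x g) (gact M y g)"
begin

abbreviation diff where "diff x y \<equiv> gadd M x (gsmult M (-1) y)"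

lemma add_zero [simp]: "x \<in> gcarrier M \<Longrightarrow> gadd M x (gzero M) = x"
  using add_commute[of x "gzero M"] by simp

lemma add_diff_cancel:
  assumes "x \<in> gcarrier M" "y \<in> gcarrier M"
  shows "gadd M y (diff x y) = x"
proof -
  have "gadd M y (diff x y) = gadd M y (gadd M (gsmult M (-1) y) x)"
    using assms add_commute by simp
  also have "\<dots> = gadd M (gadd M y (gsmult M (-1) y)) x"
    using assms add_assoc by simp
  also have "gadd M y (gsmult M (-1) y) = gzero M"
    using assms add_commute neg_add by simp
  finally show ?thesis using assms by simp
qed

lemma add_left_cancel:
  assumes "x \<in> gcarrier M" "y \<in> gcarrier M" "z \<in> gcarrier M" "gadd M x y = gadd M x z"
  shows "y = z"
proof -
  have *: "gadd M (gsmult M (-1) x) (gadd M x w) = w" if "w \<in> gcarrier M" for w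
    using assms(1) that add_assoc[of "gsmult M (-1) x" x w] by (simp add: neg_add)
  show ?thesis
    using *[OF assms(2)] *[OF assms(3)] unfolding assms(4) by (rule trans[OF sym])
qed

lemma gsubmodule_gcarrier: "gsubmodule G M (gcarrier M)"
  by (simp add: gsubmodule_def)

lemma smult_zero [simp]: "gsmult M c (gzero M) = gzero M"
proof -
  have "gadd M (gsmult M c (gzero M)) (gsmult M c (gzero M)) = gsmult M c (gadd M (gzero M) (gzero M))"
    by (rule smult_add[symmetric]) simp_all
  also have "\<dots> = gadd M (gsmult M c (gzero M)) (gzero M)" by simp
  finally have "gadd M (gsmult M c (gzero M)) (gsmult M c (gzero M)) = gadd M (gsmult M c (gzero M)) (gzero M)" .
  then show ?thesis by (rule add_left_cancel[rotated 3]) simp_all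
qed

lemma act_zero [simp]: assumes "g \<in> G" shows "gact M (gzero M) g = gzero M"
proof -
  have "gadd M (gact M (gzero M) g) (gact M (gzero M) g) = gact M (gadd M (gzero M) (gzero M)) g"
    by (rule act_add[symmetric]) (simp_all add: assms)
  also have "\<dots> = gadd M (gact M (gzero M) g) (gzero M)" by (simp add: assms)
  finally have "gadd M (gact M (gzero M) g) (gact M (gzero M) g) = gadd M (gact M (gzero M) g) (gzero M)" .
  then show ?thesis by (rule add_left_cancel[rotated 3]) (simp_all add: assms)
qed

lemma gsubmodule_zero: "gsubmodule G M {gzero M}"
  by (simp add: gsubmodule_def)

lemma gmod_gsub:
  assumes "gsubmodule G M N"
  shows "gmod G (gsub M N)"
proof -
  have N: "x \<in> gcarrier M" if "x \<in> N" for x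
    using assms that by (auto simp: gsubmodule_def)
  show ?thesis
    using assms by unfold_locales
      (auto simp: gsubmodule_def N add_assoc neg_add smult_add act_add intro: add_commute)
qed

lemma gsubmodule_gsub:
  assumes "gsubmodule G M N"
  shows "gsubmodule G (gsub M N) B \<longleftrightarrow> gsubmodule G M B \<and> B \<subseteq> N"
  using assms by (auto simp: gsubmodule_def)

lemma gsubmodule_Int:
  "gsubmodule G M A \<Longrightarrow> gsubmodule G M B \<Longrightarrow> gsubmodule G M (A \<inter> B)"
  by (auto simp: gsubmodule_def)

lemma gsubmodule_gsum:
  assumes A: "gsubmodule G M A" and B: "gsubmodule G M B"
  shows "gsubmodule G M (gsum M A B)"
proof -
  have cA: "x \<in> gcarrier M" if "x \<in> A" for x using A that by (auto simp: gsubmodule_def)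
  have cB: "x \<in> gcarrier M" if "x \<in> B" for x using B that by (auto simp: gsubmodule_def)
  have z: "gzero M \<in> A" "gzero M \<in> B" using A B by (auto simp: gsubmodule_def)
  have "gadd M x y \<in> gsum M A B" if x: "x \<in> gsum M A B" and y: "y \<in> gsum M A B" for x y
  proof -
    obtain a b a' b' where *: "x = gadd M a b" "y = gadd M a' b'" "a \<in> A" "b \<in> B" "a' \<in> A" "b' \<in> B"
      using x y by (auto simp: gsum_def)
    have "gadd M x y = gadd M a (gadd M b (gadd M a' b'))"
      using * by (simp add: cA cB add_assoc)
    also have "gadd M b (gadd M a' b') = gadd M (gadd M b a') b'"
      using * by (simp add: cA cB add_assoc)
    also have "gadd M b a' = gadd M a' b"
      using * by (simp add: cA cB add_commute)
    finally have "gadd M x y = gadd M (gadd M a a') (gadd M b b')"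
      using * by (simp add: cA cB add_assoc)
    moreover have "gadd M a a' \<in> A" "gadd M b b' \<in> B"
      using * A B by (auto simp: gsubmodule_def)
    ultimately show ?thesis by (auto simp: gsum_def)
  qed
  moreover have "gsmult M c x \<in> gsum M A B" if x: "x \<in> gsum M A B" for c x
  proof -
    obtain a b where *: "x = gadd M a b" "a \<in> A" "b \<in> B"
      using x by (auto simp: gsum_def)
    then have "gsmult M c x = gadd M (gsmult M c a) (gsmult M c b)"
      by (simp add: cA cB smult_add)
    moreover have "gsmult M c a \<in> A" "gsmult M c b \<in> B"
      using * A B by (auto simp: gsubmodule_def)
    ultimately show ?thesis by (auto simp: gsum_def)
  qed
  moreover have "gact M x g \<in> gsum M A B" if x: "x \<in> gsum M A B" and g: "g \<in> G" for x g
  proof -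
    obtain a b where *: "x = gadd M a b" "a \<in> A" "b \<in> B"
      using x by (auto simp: gsum_def)
    then have "gact M x g = gadd M (gact M a g) (gact M b g)"
      using g by (simp add: cA cB act_add)
    moreover have "gact M a g \<in> A" "gact M b g \<in> B"
      using * A B g by (auto simp: gsubmodule_def)
    ultimately show ?thesis by (auto simp: gsum_def)
  qed
  moreover have "gzero M \<in> gsum M A B"
    using z by (force simp: gsum_def)
  moreover have "gsum M A B \<subseteq> gcarrier M"
    by (auto simp: gsum_def cA cB)
  ultimately show ?thesis by (simp add: gsubmodule_def)
qed

lemma subset_gsum1:
  assumes "gsubmodule G M A" "gsubmodule G M B" shows "A \<subseteq> gsum M A B"
proof
  fix a assume a: "a \<in> A"
  then have "a = gadd M a (gzero M)" using assms by (auto simp: gsubmodule_def subset_iff)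
  then show "a \<in> gsum M A B" using a assms by (auto simp: gsubmodule_def gsum_def)
qed

lemma subset_gsum2:
  assumes "gsubmodule G M A" "gsubmodule G M B" shows "B \<subseteq> gsum M A B"
proof
  fix a assume a: "a \<in> B"
  then have "a = gadd M (gzero M) a" using assms by (auto simp: gsubmodule_def subset_iff)
  then show "a \<in> gsum M A B" using a assms by (auto simp: gsubmodule_def gsum_def)
qed

end

section \<open>Homomorphisms, kernels and preimages\<close>

definition ghom :: "'g set \<Rightarrow> ('f, 'g, 'm) gmodule \<Rightarrow> ('f, 'g, 'k) gmodule \<Rightarrow> ('m \<Rightarrow> 'k) \<Rightarrow> bool" where
  "ghom G M K f \<longleftrightarrow>
     (\<forall>x\<in>gcarrier M. f x \<in> gcarrier K) \<and>
     (\<forall>x\<in>gcarrier M. \<forall>y\<in>gcarrier M. f (gadd M x y) = gadd K (f x) (f y)) \<and>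
     (\<forall>c. \<forall>x\<in>gcarrier M. f (gsmult M c x) = gsmult K c (f x)) \<and>
     (\<forall>x\<in>gcarrier M. \<forall>g\<in>G. f (gact M x g) = gact K (f x) g)"

lemma giso_iff_ghom:
  "giso G M K \<longleftrightarrow> (\<exists>f. ghom G M K f \<and> bij_betw f (gcarrier M) (gcarrier K))"
  unfolding giso_def ghom_def by (auto dest: bij_betwE)

lemma ghomI:
  assumes "\<And>x. x \<in> gcarrier M \<Longrightarrow> f x \<in> gcarrier K"
    and "\<And>x y. \<lbrakk>x \<in> gcarrier M; y \<in> gcarrier M\<rbrakk> \<Longrightarrow> f (gadd M x y) = gadd K (f x) (f y)"
    and "\<And>c x. x \<in> gcarrier M \<Longrightarrow> f (gsmult M c x) = gsmult K c (f x)"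
    and "\<And>x g. \<lbrakk>x \<in> gcarrier M; g \<in> G\<rbrakk> \<Longrightarrow> f (gact M x g) = gact K (f x) g"
  shows "ghom G M K f"
  using assms by (auto simp: ghom_def)

lemma ghomD:
  assumes "ghom G M K f"
  shows ghom_closed: "x \<in> gcarrier M \<Longrightarrow> f x \<in> gcarrier K"
    and ghom_add: "\<lbrakk>x \<in> gcarrier M; y \<in> gcarrier M\<rbrakk> \<Longrightarrow> f (gadd M x y) = gadd K (f x) (f y)"
    and ghom_smult: "x \<in> gcarrier M \<Longrightarrow> f (gsmult M c x) = gsmult K c (f x)"
    and ghom_act: "\<lbrakk>x \<in> gcarrier M; g \<in> G\<rbrakk> \<Longrightarrow> f (gact M x g) = gact K (f x) g"
  using assms by (auto simp: ghom_def)

lemma ghom_zero: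
  assumes "gmod G M" "gmod G K" "ghom G M K f"
  shows "f (gzero M) = gzero K"
proof -
  interpret M: gmod G M by fact
  interpret K: gmod G K by fact
  have c: "f (gzero M) \<in> gcarrier K" by (rule ghom_closed[OF assms(3)]) simp
  have "gadd K (f (gzero M)) (f (gzero M)) = f (gadd M (gzero M) (gzero M))"
    by (rule ghom_add[OF assms(3), symmetric]) simp_all
  also have "\<dots> = gadd K (f (gzero M)) (gzero K)" using c by simp
  finally have "gadd K (f (gzero M)) (f (gzero M)) = gadd K (f (gzero M)) (gzero K)" .
  then show ?thesis by (rule K.add_left_cancel[rotated 3]) (simp_all add: c)
qed

lemma ghom_gsub: "ghom G M K f \<Longrightarrow> A \<subseteq> gcarrier M \<Longrightarrow> ghom G (gsub M A) K f"
  by (auto simp: ghom_def subset_iff)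

lemma ghom_comp: "ghom G M K f \<Longrightarrow> ghom G K L h \<Longrightarrow> ghom G M L (h \<circ> f)"
  by (auto simp: ghom_def)

lemma gsubmodule_preimage:
  assumes "gmod G M" "gmod G K" "ghom G M K f" "gsubmodule G K N"
  shows "gsubmodule G M {x \<in> gcarrier M. f x \<in> N}"
proof -
  interpret M: gmod G M by fact
  show ?thesis
    using assms(4) ghom_zero[OF assms(1-3)] by (auto simp: gsubmodule_def ghomD[OF assms(3)])
qed

lemma ghom_eq_iff:
  assumes "gmod G M" "gmod G K" "ghom G M K f" "x \<in> gcarrier M" "y \<in> gcarrier M"
  shows "f x = f y \<longleftrightarrow> f (gadd M x (gsmult M (-1) y)) = gzero K"
proof -
  interpret M: gmod G M by fact
  interpret K: gmod G K by fact
  have c: "f x \<in> gcarrier K" "f y \<in> gcarrier K" using assms(4,5) by (simp_all add: ghom_closed[OF assms(3)])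
  have e: "f (M.diff x y) = K.diff (f x) (f y)"
    using assms(4,5) by (simp add: ghom_add[OF assms(3)] ghom_smult[OF assms(3)])
  show ?thesis
  proof
    assume "f x = f y"
    then show "f (M.diff x y) = gzero K"
      using e c K.neg_add K.add_commute[of "f y" "gsmult K (-1) (f y)"] by simp
  next
    assume "f (M.diff x y) = gzero K"
    then have "gadd K (f y) (gzero K) = f x"
      using K.add_diff_cancel[OF c] e by simp
    then show "f x = f y" using c by simp
  qed
qed

lemma ghom_inj_on_iff:
  assumes "gmod G M" "gmod G K" "ghom G M K f"
  shows "inj_on f (gcarrier M) \<longleftrightarrow> (\<forall>x\<in>gcarrier M. f x = gzero K \<longrightarrow> x = gzero M)"
proof -
  interpret M: gmod G M by fact
  show ?thesis
  proof
    assume "inj_on f (gcarrier M)"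
    then show "\<forall>x\<in>gcarrier M. f x = gzero K \<longrightarrow> x = gzero M"
      using ghom_zero[OF assms] by (auto simp: inj_on_def)
  next
    assume *: "\<forall>x\<in>gcarrier M. f x = gzero K \<longrightarrow> x = gzero M"
    show "inj_on f (gcarrier M)"
    proof (rule inj_onI)
      fix x y assume xy: "x \<in> gcarrier M" "y \<in> gcarrier M" "f x = f y"
      then have "M.diff x y = gzero M" using * ghom_eq_iff[OF assms, of x y] by simp
      then show "x = y" using M.add_diff_cancel[of x y] xy by simp
    qed
  qed
qed

subsection \<open>Quotients\<close>

locale gmod_sub = gmod +
  fixes N
  assumes sub: "gsubmodule G M N"
begin

lemma N_closed [simp]: "x \<in> N \<Longrightarrow> x \<in> gcarrier M"
  and N_zero [simp]: "gzero M \<in> N"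
  and N_add [simp]: "x \<in> N \<Longrightarrow> y \<in> N \<Longrightarrow> gadd M x y \<in> N"
  and N_smult [simp]: "x \<in> N \<Longrightarrow> gsmult M c x \<in> N"
  and N_act [simp]: "x \<in> N \<Longrightarrow> g \<in> G \<Longrightarrow> gact M x g \<in> N"
  using sub by (auto simp: gsubmodule_def)

lemma gcoset_self: "x \<in> gcarrier M \<Longrightarrow> x \<in> gcoset M N x"
  unfolding gcoset_def by (rule CollectI, rule exI[of _ "gzero M"]) simp

lemma gcoset_add_right_subset:
  assumes "x \<in> gcarrier M" "n \<in> N"
  shows "gcoset M N (gadd M x n) \<subseteq> gcoset M N x"
proof
  fix z assume "z \<in> gcoset M N (gadd M x n)"
  then obtain m where m: "z = gadd M (gadd M x n) m" "m \<in> N" by (auto simp: gcoset_def)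
  have "z = gadd M x (gadd M n m)"
    using m(1) add_assoc[of x n m] assms m(2) by (simp only: N_closed)
  then show "z \<in> gcoset M N x" using N_add[OF assms(2) m(2)] unfolding gcoset_def by blast
qed

lemma gcoset_add_right:
  assumes "x \<in> gcarrier M" "n \<in> N"
  shows "gcoset M N (gadd M x n) = gcoset M N x"
proof
  show "gcoset M N (gadd M x n) \<subseteq> gcoset M N x"
    by (rule gcoset_add_right_subset[OF assms])
  have c: "n \<in> gcarrier M" "gsmult M (-1) n \<in> gcarrier M" using assms by simp_all
  have "gadd M (gadd M x n) (gsmult M (-1) n) = gadd M x (gadd M n (gsmult M (-1) n))"
    by (rule add_assoc[OF assms(1) c])
  also have "gadd M n (gsmult M (-1) n) = gzero M"
    using add_commute[OF c] neg_add[OF c(1)] by simp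
  also have "gadd M x (gzero M) = x" using assms(1) by simp
  finally show "gcoset M N x \<subseteq> gcoset M N (gadd M x n)"
    using gcoset_add_right_subset[of "gadd M x n" "gsmult M (-1) n"] assms c by simp
qed

lemma gcoset_eq_iff:
  assumes "x \<in> gcarrier M" "y \<in> gcarrier M"
  shows "gcoset M N x = gcoset M N y \<longleftrightarrow> diff x y \<in> N"
proof
  assume "gcoset M N x = gcoset M N y"
  then have "x \<in> gcoset M N y" using gcoset_self[of x] assms by simp
  then obtain n where n: "x = gadd M y n" "n \<in> N" by (auto simp: gcoset_def)
  have "gadd M y (diff x y) = gadd M y n"
    using trans[OF add_diff_cancel[OF assms] n(1)] .
  then have "diff x y = n"
    by (rule add_left_cancel[rotated 3]) (simp_all add: assms n(2))
  then show "diff x y \<in> N" using n by simp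
next
  assume *: "diff x y \<in> N"
  show "gcoset M N x = gcoset M N y"
    using gcoset_add_right[OF assms(2) *] add_diff_cancel[OF assms] by simp
qed

lemma gcoset_zero: "gcoset M N (gzero M) = N"
proof -
  have "gcoset M N (gzero M) = {y. y \<in> N}"
    unfolding gcoset_def by (metis (no_types, opaque_lifting) zero_add N_closed)
  then show ?thesis by simp
qed

lemma gcoset_eq_N_iff: "x \<in> gcarrier M \<Longrightarrow> gcoset M N x = N \<longleftrightarrow> x \<in> N"
  using gcoset_add_right[of "gzero M" x] gcoset_self[of x] by (auto simp: gcoset_zero)

lemma gadd_gquot:
  assumes "x \<in> gcarrier M" "y \<in> gcarrier M"
  shows "gadd (gquot M N) (gcoset M N x) (gcoset M N y) = gcoset M N (gadd M x y)"
proof -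
  have *: "gcoset M N (gadd M a b) = gcoset M N (gadd M x y)"
    if mem: "a \<in> gcoset M N x" "b \<in> gcoset M N y" for a b
  proof -
    obtain m n where ab: "a = gadd M x m" "b = gadd M y n" "m \<in> N" "n \<in> N"
      using mem by (auto simp: gcoset_def)
    have "gadd M a b = gadd M (gadd M (gadd M x m) y) n"
      using ab assms by (simp add: add_assoc)
    also have "gadd M (gadd M x m) y = gadd M x (gadd M y m)"
      using ab assms by (simp add: add_assoc add_commute[of m y])
    finally have "gadd M a b = gadd M (gadd M x y) (gadd M m n)"
      using ab assms by (simp add: add_assoc)
    then show ?thesis using ab assms by (simp add: gcoset_add_right)
  qed
  show ?thesis
    unfolding gquot_def gmodule.simps
    by (intro UN_constant_eq[OF gcoset_self[OF assms(1)]] UN_constant_eq[OF gcoset_self[OF assms(2)]]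
        ballI *)
qed

lemma gsmult_gquot:
  assumes "x \<in> gcarrier M"
  shows "gsmult (gquot M N) c (gcoset M N x) = gcoset M N (gsmult M c x)"
proof -
  have *: "gcoset M N (gsmult M c a) = gcoset M N (gsmult M c x)" if mem: "a \<in> gcoset M N x" for a
  proof -
    obtain n where "a = gadd M x n" "n \<in> N" using mem by (auto simp: gcoset_def)
    then show ?thesis using assms by (simp add: smult_add gcoset_add_right)
  qed
  show ?thesis
    unfolding gquot_def gmodule.simps by (intro UN_constant_eq[OF gcoset_self[OF assms]] ballI *)
qed

lemma gact_gquot:
  assumes "x \<in> gcarrier M" "g \<in> G"
  shows "gact (gquot M N) (gcoset M N x) g = gcoset M N (gact M x g)"
proof -
  have *: "gcoset M N (gact M a g) = gcoset M N (gact M x g)" if mem: "a \<in> gcoset M N x" for a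
  proof -
    obtain n where "a = gadd M x n" "n \<in> N" using mem by (auto simp: gcoset_def)
    then show ?thesis using assms by (simp add: act_add gcoset_add_right)
  qed
  show ?thesis
    unfolding gquot_def gmodule.simps by (intro UN_constant_eq[OF gcoset_self[OF assms(1)]] ballI *)
qed

lemma gmod_gquot: "gmod G (gquot M N)"
proof -
  have z: "gzero (gquot M N) = gcoset M N (gzero M)" by (simp add: gzero_gquot gcoset_zero)
  have comm: "gadd (gquot M N) X Y = gadd (gquot M N) Y X"
    if "X \<in> gcoset M N ` gcarrier M" "Y \<in> gcoset M N ` gcarrier M" for X Y
    using that by (elim imageE) (simp add: gadd_gquot, metis add_commute)
  show ?thesis
    by (unfold_locales; unfold gcarrier_gquot z; (rule comm; assumption)?;
        clarsimp simp: gadd_gquot gsmult_gquot gact_gquot add_assoc neg_add smult_add act_add)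
qed

lemma ghom_gcoset: "ghom G M (gquot M N) (gcoset M N)"
  by (rule ghomI) (auto simp: gcarrier_gquot gadd_gquot gsmult_gquot gact_gquot)

lemma gsubmodule_image_gcoset:
  assumes B: "gsubmodule G M B"
  shows "gsubmodule G (gquot M N) (gcoset M N ` B)"
proof -
  have BM: "x \<in> gcarrier M" if "x \<in> B" for x using B that by (auto simp: gsubmodule_def)
  show ?thesis
    unfolding gsubmodule_def
  proof (intro conjI ballI allI)
    show "gcoset M N ` B \<subseteq> gcarrier (gquot M N)" using BM by (auto simp: gcarrier_gquot)
    have "gzero M \<in> B" using B by (simp add: gsubmodule_def)
    then have "gcoset M N (gzero M) \<in> gcoset M N ` B" by (rule imageI)
    then show "gzero (gquot M N) \<in> gcoset M N ` B" by (simp only: gzero_gquot gcoset_zero)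
  next
    fix X Y assume "X \<in> gcoset M N ` B" "Y \<in> gcoset M N ` B"
    then obtain x y where xy: "X = gcoset M N x" "Y = gcoset M N y" "x \<in> B" "y \<in> B" by blast
    then have "gadd M x y \<in> B" using B by (simp add: gsubmodule_def)
    then show "gadd (gquot M N) X Y \<in> gcoset M N ` B"
      unfolding xy gadd_gquot[OF BM[OF xy(3)] BM[OF xy(4)]] by (rule imageI)
  next
    fix c X assume "X \<in> gcoset M N ` B"
    then obtain x where x: "X = gcoset M N x" "x \<in> B" by blast
    then have "gsmult M c x \<in> B" using B by (simp add: gsubmodule_def)
    then show "gsmult (gquot M N) c X \<in> gcoset M N ` B"
      unfolding x gsmult_gquot[OF BM[OF x(2)]] by (rule imageI)
  next
    fix X g assume "X \<in> gcoset M N ` B" and g: "g \<in> G"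
    then obtain x where x: "X = gcoset M N x" "x \<in> B" by blast
    then have "gact M x g \<in> B" using B g by (simp add: gsubmodule_def)
    then show "gact (gquot M N) X g \<in> gcoset M N ` B"
      unfolding x gact_gquot[OF BM[OF x(2)] g] by (rule imageI)
  qed
qed

text \<open>Since \<open>N \<subseteq> B\<close>, the set \<open>B\<close> is a union of
  cosets.\<close>

lemma gcoset_mem_image_iff:
  assumes B: "gsubmodule G M B" "N \<subseteq> B" and x: "x \<in> gcarrier M"
  shows "gcoset M N x \<in> gcoset M N ` B \<longleftrightarrow> x \<in> B"
proof
  assume "gcoset M N x \<in> gcoset M N ` B"
  then obtain b where b: "b \<in> B" "gcoset M N x = gcoset M N b" by blast
  have bM: "b \<in> gcarrier M" using B b by (auto simp: gsubmodule_def)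
  have "diff x b \<in> N" using gcoset_eq_iff[OF x bM] b(2) by simp
  then have "gadd M b (diff x b) \<in> B" using B b(1) by (auto simp: gsubmodule_def)
  then show "x \<in> B" using add_diff_cancel[OF x bM] by simp
qed (rule imageI)

lemma factor_gquot:
  assumes K: "gmod G K" and f: "ghom G M K f" and N: "\<And>x. x \<in> N \<Longrightarrow> f x = gzero K"
  shows "\<exists>h. ghom G (gquot M N) K h \<and> (\<forall>x\<in>gcarrier M. h (gcoset M N x) = f x)"
proof -
  interpret K: gmod G K by fact
  \<comment> \<open>Any representative will do, because \<open>f\<close> is constant on cosets of
    \<open>N\<close>.\<close>
  define h where "h X = f (SOME x. x \<in> X)" for X
  have h: "h (gcoset M N x) = f x" if x: "x \<in> gcarrier M" for x
  proof -
    define a where "a = (SOME a. a \<in> gcoset M N x)"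
    have "a \<in> gcoset M N x"
      unfolding a_def using gcoset_self[OF x] by (rule someI)
    then obtain n where "a = gadd M x n" "n \<in> N"
      by (auto simp: gcoset_def)
    then show ?thesis
      using x ghom_closed[OF f x] by (simp add: h_def a_def[symmetric] ghom_add[OF f] N)
  qed
  moreover have "ghom G (gquot M N) K h"
    by (rule ghomI) (auto simp: gcarrier_gquot gadd_gquot gsmult_gquot gact_gquot h ghomD[OF f])
  ultimately show ?thesis by blast
qed

end

section \<open>Isomorphism theorems and irreducible quotients\<close>

lemma gmod_subI: "gmod G M \<Longrightarrow> gsubmodule G M N \<Longrightarrow> gmod_sub G M N"
  by (simp add: gmod_sub_def gmod_sub_axioms_def)

text \<open>\<open>N\<close> enters as a set that is the kernel of \<open>f\<close>; it is a
  submodule as the preimage of zero.\<close>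

lemma first_isomorphism:
  assumes "gmod G M" "gmod G K" and f: "ghom G M K f" and surj: "f ` gcarrier M = gcarrier K"
    and ker: "\<And>x. x \<in> gcarrier M \<Longrightarrow> f x = gzero K \<longleftrightarrow> x \<in> N" and NM: "N \<subseteq> gcarrier M"
  shows "giso G (gquot M N) K"
proof -
  interpret M: gmod G M by fact
  interpret K: gmod G K by fact
  have "gsubmodule G M {x \<in> gcarrier M. f x \<in> {gzero K}}"
    by (rule gsubmodule_preimage[OF assms(1-3) K.gsubmodule_zero])
  also have "{x \<in> gcarrier M. f x \<in> {gzero K}} = N" using ker NM by auto
  finally interpret gmod_sub G M N by (rule gmod_subI[OF assms(1)])
  have "f x = gzero K" if "x \<in> N" for x
    using ker[of x] NM that by blast
  then obtain h where h: "ghom G (gquot M N) K h" "\<And>x. x \<in> gcarrier M \<Longrightarrow> h (gcoset M N x) = f x"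
    using factor_gquot[OF assms(2) f] by auto
  have "inj_on h (gcarrier (gquot M N))"
    unfolding ghom_inj_on_iff[OF gmod_gquot assms(2) h(1)]
    by (auto simp: gcarrier_gquot h(2) ker gzero_gquot gcoset_eq_N_iff)
  moreover have "h ` gcarrier (gquot M N) = gcarrier K"
    using surj h(2) by (force simp: gcarrier_gquot image_image)
  ultimately show ?thesis
    using h(1) by (auto simp: giso_iff_ghom bij_betw_def)
qed

lemma giso_sym:
  assumes "gmod G M" "giso G M K"
  shows "giso G K M"
proof -
  interpret gmod G M by fact
  obtain f where f: "ghom G M K f" and b: "bij_betw f (gcarrier M) (gcarrier K)"
    using assms(2) by (auto simp: giso_iff_ghom)
  let ?h = "inv_into (gcarrier M) f"
  have hf: "?h (f x) = x" if "x \<in> gcarrier M" for x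
    using b that by (simp add: bij_betw_def)
  have img: "gcarrier K = f ` gcarrier M" using b by (simp add: bij_betw_def)
  have "ghom G K M ?h"
    by (rule ghomI)
      (auto simp: img hf ghom_add[OF f, symmetric] ghom_smult[OF f, symmetric] ghom_act[OF f, symmetric])
  then show ?thesis using bij_betw_inv_into[OF b] by (auto simp: giso_iff_ghom)
qed

lemma giso_trans: "giso G M K \<Longrightarrow> giso G K L \<Longrightarrow> giso G M L"
  unfolding giso_iff_ghom using ghom_comp bij_betw_trans by blast

lemma girreducible_giso:
  assumes M: "gmod G M" and K: "gmod G K" and iso: "giso G M K" and irr: "girreducible G K"
  shows "girreducible G M"
proof -
  interpret M: gmod G M by fact
  interpret K: gmod G K by fact
  obtain f where f: "ghom G M K f" and b: "bij_betw f (gcarrier M) (gcarrier K)"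
    using iso by (auto simp: giso_iff_ghom)
  have f0: "f (gzero M) = gzero K" by (rule ghom_zero[OF M K f])
  have img: "f ` gcarrier M = gcarrier K" and inj: "inj_on f (gcarrier M)"
    using b by (auto simp: bij_betw_def)
  have "gcarrier M \<noteq> {gzero M}"
    using img f0 irr by (auto simp: girreducible_def)
  moreover have "N = {gzero M} \<or> N = gcarrier M" if N: "gsubmodule G M N" for N
  proof -
    have NM: "N \<subseteq> gcarrier M" using N by (simp add: gsubmodule_def)
    have "gsubmodule G K (f ` N)"
      unfolding gsubmodule_def
    proof (intro conjI ballI allI)
      show "f ` N \<subseteq> gcarrier K" using NM img by auto
      show "gzero K \<in> f ` N" using N f0 by (force simp: gsubmodule_def)
    next
      fix x y assume "x \<in> f ` N" "y \<in> f ` N"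
      then obtain a b where "x = f a" "y = f b" "a \<in> N" "b \<in> N" by auto
      then show "gadd K x y \<in> f ` N"
        using N NM by (auto simp: gsubmodule_def ghom_add[OF f, symmetric] subset_iff)
    next
      fix c x assume "x \<in> f ` N"
      then show "gsmult K c x \<in> f ` N"
        using N NM by (auto simp: gsubmodule_def ghom_smult[OF f, symmetric] subset_iff)
    next
      fix g x assume "x \<in> f ` N" "g \<in> G"
      then show "gact K x g \<in> f ` N"
        using N NM by (auto simp: gsubmodule_def ghom_act[OF f, symmetric] subset_iff)
    qed
    then have "f ` N = f ` {gzero M} \<or> f ` N = f ` gcarrier M"
      using irr img f0 by (auto simp: girreducible_def)
    then show ?thesis
      using inj_on_image_eq_iff[OF inj NM] by (metis M.gsubmodule_zero gsubmodule_def subset_refl)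
  qed
  ultimately show ?thesis by (auto simp: girreducible_def)
qed

text \<open>The coset map of \<open>B\<close>, restricted to \<open>A\<close>, is onto since
  summands from \<open>B\<close> are absorbed, and its kernel is
  \<open>A \<inter> B\<close>.\<close>

lemma second_isomorphism:
  assumes "gmod G M" and A: "gsubmodule G M A" and B: "gsubmodule G M B"
  shows "giso G (gquot (gsub M (gsum M A B)) B) (gquot (gsub M A) (A \<inter> B))"
    and "giso G (gquot (gsub M A) (A \<inter> B)) (gquot (gsub M (gsum M A B)) B)"
proof -
  interpret gmod G M by fact
  let ?S = "gsum M A B"
  have S: "gsubmodule G M ?S" by (rule gsubmodule_gsum[OF A B])
  interpret S: gmod_sub G "gsub M ?S" B
    using gmod_gsub[OF S] gsubmodule_gsub[OF S] B subset_gsum2[OF A B] by (intro gmod_subI) simp_all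
  have gA: "gmod G (gsub M A)" by (rule gmod_gsub[OF A])
  have AS: "A \<subseteq> ?S" by (rule subset_gsum1[OF A B])
  have sub: "gmod_sub G (gsub M A) (A \<inter> B)"
    using gsubmodule_gsub[OF A] gsubmodule_Int[OF A B] by (intro gmod_subI[OF gA]) simp
  show 1: "giso G (gquot (gsub M A) (A \<inter> B)) (gquot (gsub M ?S) B)"
  proof (rule first_isomorphism[OF gA S.gmod_gquot, where f = "gcoset M B"])
    show "ghom G (gsub M A) (gquot (gsub M ?S) B) (gcoset M B)"
      using ghom_gsub[OF S.ghom_gcoset, of A] AS by simp
    have "gcoset M B (gadd M a b) = gcoset M B a" if "a \<in> A" "b \<in> B" for a b
      using S.gcoset_add_right[of a b] that AS by auto
    then show "gcoset M B ` gcarrier (gsub M A) = gcarrier (gquot (gsub M ?S) B)"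
      using AS by (force simp: gcarrier_gquot gsum_def)
    show "gcoset M B x = gzero (gquot (gsub M ?S) B) \<longleftrightarrow> x \<in> A \<inter> B" if "x \<in> gcarrier (gsub M A)" for x
      using S.gcoset_eq_N_iff[of x] that AS by (auto simp: gzero_gquot)
  qed simp
  show "giso G (gquot (gsub M ?S) B) (gquot (gsub M A) (A \<inter> B))"
    by (rule giso_sym[OF gmod_sub.gmod_gquot[OF sub] 1])
qed

lemma giso_gquot_zero:
  assumes "gmod G M"
  shows "giso G (gquot M {gzero M}) M"
proof -
  interpret gmod G M by fact
  show ?thesis
    by (rule first_isomorphism[OF assms assms, of "\<lambda>x. x"]) (simp_all add: ghom_def)
qed

text \<open>The quotient of \<open>M\<close> by \<open>B\<close> is already replaced by the image
  \<open>K\<close> of a map with kernel \<open>B\<close>, so that a quotient whose elements are sets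
  of cosets can be compared directly with a concrete module.\<close>

lemma third_isomorphism:
  assumes M: "gmod G M" and K: "gmod G K" and f: "ghom G M K f" and surj: "f ` gcarrier M = gcarrier K"
    and ker: "\<And>x. x \<in> gcarrier M \<Longrightarrow> f x = gzero K \<longleftrightarrow> x \<in> B" and BM: "B \<subseteq> gcarrier M"
    and A: "gsubmodule G M A" "A \<subseteq> B"
  shows "giso G (gquot (gquot M A) (gcoset M A ` B)) K"
proof -
  interpret gmod_sub G M A by (rule gmod_subI[OF M A(1)])
  have "f x = gzero K" if "x \<in> A" for x
    using ker[of x] A(2) BM that by blast
  then obtain h where h: "ghom G (gquot M A) K h" "\<And>x. x \<in> gcarrier M \<Longrightarrow> h (gcoset M A x) = f x"
    using factor_gquot[OF K f] by auto
  have "gcoset M A x \<in> gcoset M A ` B \<longleftrightarrow> x \<in> B" if x: "x \<in> gcarrier M" for x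
  proof
    assume "gcoset M A x \<in> gcoset M A ` B"
    then obtain b where "b \<in> B" "gcoset M A x = gcoset M A b" by auto
    then have "f x = f b" using h(2)[of x] h(2)[of b] x BM by auto
    then show "x \<in> B" using ker[of x] ker[of b] x BM \<open>b \<in> B\<close> by auto
  qed simp
  then show ?thesis
    using h(2) surj ker BM
    by (intro first_isomorphism[OF gmod_gquot K h(1)]) (auto simp: gcarrier_gquot image_image)
qed

text \<open>Submodules of the quotient correspond to submodules between \<open>N\<close> and the
  whole module, by preimage under the coset map.\<close>

lemma girreducible_gquot:
  assumes M: "gmod G M" and N: "gsubmodule G M N" and ne: "N \<noteq> gcarrier M"
    and max: "\<And>A. \<lbrakk>gsubmodule G M A; N \<subseteq> A; A \<noteq> N\<rbrakk> \<Longrightarrow> A = gcarrier M"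
  shows "girreducible G (gquot M N)"
proof -
  interpret gmod_sub G M N by (rule gmod_subI[OF M N])
  have NM: "N \<subseteq> gcarrier M" using N by (simp add: gsubmodule_def)
  have "X = {N} \<or> X = gcarrier (gquot M N)" if X: "gsubmodule G (gquot M N) X" for X
  proof -
    let ?A = "{x \<in> gcarrier M. gcoset M N x \<in> X}"
    have A: "gsubmodule G M ?A" by (rule gsubmodule_preimage[OF M gmod_gquot ghom_gcoset X])
    have NX: "N \<in> X" using X by (simp add: gsubmodule_def gzero_gquot)
    have XA: "X = gcoset M N ` ?A"
      using X by (auto simp: gsubmodule_def gcarrier_gquot)
    have "N \<subseteq> ?A"
    proof
      fix x assume "x \<in> N"
      then show "x \<in> ?A" using NX gcoset_eq_N_iff[of x] by simp
    qed
    then have "?A = N \<or> ?A = gcarrier M" using max[OF A] by auto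
    moreover have "X = {N}" if AN: "?A = N"
    proof -
      have "Y = N" if "Y \<in> X" for Y
      proof -
        obtain x where "x \<in> ?A" "Y = gcoset M N x" using XA \<open>Y \<in> X\<close> by blast
        then show ?thesis using AN gcoset_eq_N_iff NM by auto
      qed
      then show ?thesis using NX by blast
    qed
    moreover have "X = gcarrier (gquot M N)" if "?A = gcarrier M"
      using XA that by (simp add: gcarrier_gquot)
    ultimately show ?thesis by blast
  qed
  moreover have "gcarrier (gquot M N) \<noteq> {N}"
  proof -
    obtain x where "x \<in> gcarrier M" "x \<notin> N" using ne NM by auto
    then have "gcoset M N x \<in> gcarrier (gquot M N)" "gcoset M N x \<noteq> N"
      using gcoset_eq_N_iff by (auto simp: gcarrier_gquot)
    then show ?thesis by auto
  qed
  ultimately show ?thesis by (auto simp: girreducible_def gzero_gquot)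
qed

lemma gmod_gdirect_sum:
  assumes "gmod G M" "gmod G K"
  shows "gmod G (gdirect_sum M K)"
proof -
  interpret M: gmod G M by fact
  interpret K: gmod G K by fact
  show ?thesis
    by unfold_locales (auto simp: gdirect_sum_def M.add_assoc K.add_assoc M.neg_add K.neg_add
      M.smult_add K.smult_add M.act_add K.act_add intro: M.add_commute K.add_commute)
qed

subsection \<open>Composition series of length two\<close>

lemma all_less_two: "(\<forall>i<length [a, b, c] - 1. Q i) \<longleftrightarrow> Q 0 \<and> Q (Suc 0)"
  by (auto simp: less_Suc_eq)

lemma composition_series_two:
  assumes M: "gmod G M" and N: "gsubmodule G M N" and ne: "N \<noteq> {gzero M}" "N \<noteq> gcarrier M"
    and irr: "girreducible G (gsub M N)" "girreducible G (gquot M N)"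
  shows "composition_series G M [{gzero M}, N, gcarrier M]"
proof -
  interpret gmod G M by fact
  have gN: "gmod G (gsub M N)" by (rule gmod_gsub[OF N])
  interpret gN: gmod G "gsub M N" by (rule gN)
  have iso: "giso G (gquot (gsub M N) {gzero M}) (gsub M N)"
    using giso_gquot_zero[OF gN] by simp
  have "gmod_sub G (gsub M N) {gzero M}"
    using gmod_subI[OF gN gN.gsubmodule_zero] by simp
  then have "gmod G (gquot (gsub M N) {gzero M})" by (rule gmod_sub.gmod_gquot)
  then have irr0: "girreducible G (gquot (gsub M N) {gzero M})"
    using gN iso irr(1) by (rule girreducible_giso)
  have sub: "{gzero M} \<subset> N" "N \<subset> gcarrier M"
    using N ne by (auto simp: gsubmodule_def)
  show ?thesis
    unfolding composition_series_def all_less_two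
    using sub irr0 irr(2) gsubmodule_zero gsubmodule_gcarrier N
    by (simp add: comp_factor_def)
qed

text \<open>Tailored to modules with the same two factors in opposite order: the submodule of one
  matches the quotient of the other.\<close>

lemma same_composition_factors_two:
  assumes M: "gmod G M" and N: "gsubmodule G M N" "N \<noteq> {gzero M}" "N \<noteq> gcarrier M"
    and irr: "girreducible G (gsub M N)" "girreducible G (gquot M N)"
    and K: "gmod G K" and L: "gsubmodule G K L" "L \<noteq> {gzero K}" "L \<noteq> gcarrier K"
    and irr': "girreducible G (gsub K L)" "girreducible G (gquot K L)"
    and iso: "giso G (gsub M N) (gquot K L)" "giso G (gquot M N) (gsub K L)"
  shows "same_composition_factors G M K"
proof -
  let ?Ms = "[{gzero M}, N, gcarrier M]" and ?Ns = "[{gzero K}, L, gcarrier K]"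
  have gN: "gmod G (gsub M N)" by (rule gmod.gmod_gsub[OF M N(1)])
  have gL: "gmod G (gsub K L)" by (rule gmod.gmod_gsub[OF K L(1)])
  have 0: "giso G (gquot (gsub M N) {gzero M}) (gquot K L)"
    using giso_trans[OF giso_gquot_zero[OF gN] iso(1)] by simp
  have gL0: "gmod G (gquot (gsub K L) {gzero K})"
    using gmod_sub.gmod_gquot[OF gmod_subI[OF gL gmod.gsubmodule_zero[OF gL]]] by simp
  have "giso G (gsub K L) (gquot (gsub K L) {gzero K})"
    using giso_sym[OF _ giso_gquot_zero[OF gL]] gL0 by simp
  then have 1: "giso G (gquot M N) (gquot (gsub K L) {gzero K})"
    by (rule giso_trans[OF iso(2)])
  \<comment> \<open>On the indices 0 and 1 this is the swap.\<close>
  have "bij_betw (\<lambda>i. 1 - i) {..<length ?Ms - 1} {..<length ?Ns - 1}"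
    by (rule bij_betw_byWitness[where f' = "\<lambda>i. 1 - i"]) auto
  moreover have "\<forall>i<length ?Ms - 1. giso G (comp_factor M ?Ms i) (comp_factor K ?Ns (1 - i))"
    unfolding all_less_two using 0 1 by (simp add: comp_factor_def)
  ultimately show ?thesis
    unfolding same_composition_factors_def
    using composition_series_two[OF M N irr] composition_series_two[OF K L irr'] by blast
qed

section \<open>Bilinear products and structure vectors\<close>

text \<open>The injection \<open>e\<close> orders an index type that has no order of its own, so
  that each unordered pair is counted once. Collecting pairs this way avoids dividing by 2 and works
  in every characteristic.\<close>

lemma sum_ordered_pairs:
  fixes f :: "'n::finite \<Rightarrow> 'n \<Rightarrow> 'a::comm_monoid_add" and e :: "'n::finite \<Rightarrow> nat"
  assumes "inj e" "\<And>i. f i i = 0"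
  shows "(\<Sum>(i, j)\<in>{(i, j). e i < e j}. f i j + f j i) = (\<Sum>i\<in>UNIV. \<Sum>j\<in>UNIV. f i j)"
proof -
  let ?R = "{(i, j). e i < e j}" and ?S = "{(i, j). e j < e i}"
  have S: "?S = prod.swap ` ?R" by auto
  have "(\<Sum>(i, j)\<in>?R. f j i) = (\<Sum>(i, j)\<in>?S. f i j)"
    unfolding S by (subst sum.reindex) (auto intro!: sum.cong)
  then have "(\<Sum>(i, j)\<in>?R. f i j + f j i) = (\<Sum>(i, j)\<in>?R. f i j) + (\<Sum>(i, j)\<in>?S. f i j)"
    by (simp add: sum.distrib case_prod_unfold)
  also have "\<dots> = (\<Sum>(i, j)\<in>?R \<union> ?S. f i j)"
    by (rule sum.union_disjoint[symmetric]) auto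
  also have "\<dots> = (\<Sum>(i, j)\<in>UNIV. f i j)"
  proof (rule sum.mono_neutral_left)
    show "\<forall>p\<in>UNIV - (?R \<union> ?S). (case p of (i, j) \<Rightarrow> f i j) = 0"
    proof
      fix p assume "p \<in> UNIV - (?R \<union> ?S)"
      then have "e (fst p) = e (snd p)" by (auto simp: case_prod_unfold)
      then have "fst p = snd p" using assms(1) by (simp add: inj_eq)
      then show "(case p of (i, j) \<Rightarrow> f i j) = 0" by (simp add: case_prod_unfold assms(2))
    qed
  qed auto
  finally show ?thesis by (simp add: sum.cartesian_product)
qed

lemma linear_scalar_iff:
  assumes "vector_space s"
  shows "Vector_Spaces.linear s (*) \<phi> \<longleftrightarrow>
    (\<forall>x y. \<phi> (x + y) = \<phi> x + \<phi> y) \<and> (\<forall>c x. \<phi> (s c x) = c * \<phi> x)"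
proof -
  have "vector_space ((*) :: 'a \<Rightarrow> 'a \<Rightarrow> 'a)"
    by unfold_locales (simp_all add: algebra_simps)
  then show ?thesis using assms by (auto simp: Vector_Spaces.linear_iff)
qed

locale structure_space =
  fixes s :: "'f::field \<Rightarrow> 'v::ab_group_add \<Rightarrow> 'v"
    and v :: "'n::finite \<Rightarrow> 'v"
  assumes basis: "vs_basis s v"
    and field_size: "infinite (UNIV :: 'f set) \<or> CARD('f) > 2"
    and dim_ge: "CARD('n) \<ge> 3"
begin

sublocale vector_space s
  using basis by (simp add: vs_basis_def)

lemma independent_v: "\<not> dependent (range v)"
  and span_v: "span (range v) = UNIV"
  and inj_v: "inj v"
  using basis by (auto simp: vs_basis_def)

lemma ex_scalar: "\<exists>t :: 'f. t \<noteq> 0 \<and> t \<noteq> 1"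
proof (rule ccontr)
  assume "\<not> ?thesis"
  then have U: "(UNIV :: 'f set) \<subseteq> {0, 1}" by auto
  then have "finite (UNIV :: 'f set)" by (rule finite_subset) simp
  moreover have "CARD('f) \<le> card {0, 1 :: 'f}" using U by (intro card_mono) auto
  ultimately show False using field_size by simp
qed

section \<open>Coordinates in the fixed basis\<close>

abbreviation cd :: "'v \<Rightarrow> 'n \<Rightarrow> 'f" where "cd \<equiv> coord s v"

lemma cd_add [simp]: "cd (x + y) i = cd x i + cd y i"
  using independent_v span_v by (simp add: coord_def representation_add)

lemma cd_scale [simp]: "cd (s c x) i = c * cd x i"
  using independent_v span_v by (simp add: coord_def representation_scale)

lemma cd_v: "cd (v j) i = (if i = j then 1 else 0)"
  using representation_basis[OF independent_v, of "v j"] inj_v by (auto simp: coord_def inj_eq)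

lemma cd_v_same [simp]: "cd (v i) i = 1"
  and cd_v_neq [simp]: "i \<noteq> j \<Longrightarrow> cd (v j) i = 0" "i \<noteq> j \<Longrightarrow> cd (v i) j = 0"
  by (simp_all add: cd_v)

lemma sum_cd: "(\<Sum>i\<in>UNIV. s (cd x i) (v i)) = x"
proof -
  have "(\<Sum>b\<in>range v. s (representation (range v) x b) b) = x"
    using independent_v span_v by (intro sum_representation_eq) auto
  then show ?thesis by (simp add: sum.reindex inj_v coord_def)
qed

lemma cd_eqI:
  assumes "\<And>i. cd x i = cd y i" shows "x = y"
proof -
  have "(\<Sum>i\<in>UNIV. s (cd x i) (v i)) = (\<Sum>i\<in>UNIV. s (cd y i) (v i))" by (simp only: assms)
  then show ?thesis by (simp only: sum_cd)
qed

lemma cd_zero [simp]: "cd 0 i = 0"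
  using cd_scale[of 0 0 i] by simp

lemma cd_minus [simp]: "cd (- x) i = - cd x i"
  using cd_scale[of "-1" x i] by simp

lemma cd_diff [simp]: "cd (x - y) i = cd x i - cd y i"
  using cd_add[of x "- y" i] by simp

lemma cd_sum: "cd (\<Sum>a\<in>A. f a) i = (\<Sum>a\<in>A. cd (f a) i)"
  by (induction A rule: infinite_finite_induct) simp_all

lemma v_nonzero: "v i \<noteq> 0"
proof
  assume "v i = 0"
  then have "cd (v i) i = 0" by simp
  then show False by simp
qed

subsection \<open>Linear forms\<close>

lemma dual_iff:
  "\<phi> \<in> dual s \<longleftrightarrow> (\<forall>x y. \<phi> (x + y) = \<phi> x + \<phi> y) \<and> (\<forall>c x. \<phi> (s c x) = c * \<phi> x)"
  unfolding dual_def using linear_scalar_iff[OF vector_space_axioms] by simp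

lemma dual_add: "\<phi> \<in> dual s \<Longrightarrow> \<phi> (x + y) = \<phi> x + \<phi> y"
  and dual_scale: "\<phi> \<in> dual s \<Longrightarrow> \<phi> (s c x) = c * \<phi> x"
  by (simp_all add: dual_iff)

lemma dual_zero: "\<phi> \<in> dual s \<Longrightarrow> \<phi> 0 = 0"
  using dual_scale[of \<phi> 0 0] by simp

lemma dual_minus: "\<phi> \<in> dual s \<Longrightarrow> \<phi> (- x) = - \<phi> x"
  using dual_scale[of \<phi> "-1" x] by simp

lemma dual_diff: "\<phi> \<in> dual s \<Longrightarrow> \<phi> (x - y) = \<phi> x - \<phi> y"
  using dual_add[of \<phi> x "- y"] by (simp add: dual_minus)

lemma dual_sum: "\<phi> \<in> dual s \<Longrightarrow> \<phi> (\<Sum>a\<in>A. f a) = (\<Sum>a\<in>A. \<phi> (f a))"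
  by (induction A rule: infinite_finite_induct) (simp_all add: dual_zero dual_add)

lemmas dual_simps = dual_add dual_scale dual_zero dual_minus dual_diff

lemma cd_dual: "(\<lambda>x. cd x i) \<in> dual s"
  by (simp add: dual_iff)

lemma zero_in_dual: "(\<lambda>x. 0) \<in> dual s"
  and add_in_dual: "\<phi> \<in> dual s \<Longrightarrow> \<psi> \<in> dual s \<Longrightarrow> (\<lambda>x. \<phi> x + \<psi> x) \<in> dual s"
  and diff_in_dual: "\<phi> \<in> dual s \<Longrightarrow> \<psi> \<in> dual s \<Longrightarrow> (\<lambda>x. \<phi> x - \<psi> x) \<in> dual s"
  and minus_in_dual: "\<phi> \<in> dual s \<Longrightarrow> (\<lambda>x. - \<phi> x) \<in> dual s"
  and scale_in_dual: "\<phi> \<in> dual s \<Longrightarrow> (\<lambda>x. c * \<phi> x) \<in> dual s"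
  by (simp_all add: dual_iff algebra_simps)

lemmas in_dual_intros = cd_dual zero_in_dual add_in_dual diff_in_dual minus_in_dual scale_in_dual

lemma dual_expand:
  assumes "\<phi> \<in> dual s" shows "\<phi> x = (\<Sum>i\<in>UNIV. cd x i * \<phi> (v i))"
proof -
  have "\<phi> x = \<phi> (\<Sum>i\<in>UNIV. s (cd x i) (v i))" by (simp only: sum_cd)
  then show ?thesis by (simp only: dual_sum[OF assms] dual_scale[OF assms])
qed

lemma dual_eqI:
  assumes "\<phi> \<in> dual s" "\<psi> \<in> dual s" "\<And>i. \<phi> (v i) = \<psi> (v i)"
  shows "\<phi> = \<psi>"
proof
  fix x
  have "(\<Sum>i\<in>UNIV. cd x i * \<phi> (v i)) = (\<Sum>i\<in>UNIV. cd x i * \<psi> (v i))" by (simp only: assms(3))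
  then show "\<phi> x = \<psi> x" using dual_expand[OF assms(1), of x] dual_expand[OF assms(2), of x] by metis
qed

text \<open>A maximal independent subset \<open>B\<close> of \<open>S\<close> stays independent when
  \<open>w\<close> is added, so the values 1 at \<open>w\<close> and 0 on \<open>B\<close> extend to
  a linear form.\<close>

lemma separating_form:
  assumes "w \<notin> span S"
  shows "\<exists>\<phi>\<in>dual s. \<phi> w = 1 \<and> (\<forall>x\<in>S. \<phi> x = 0)"
proof -
  interpret p: vector_space_pair s "(*) :: 'f \<Rightarrow> 'f \<Rightarrow> 'f"
    by unfold_locales (simp_all add: algebra_simps)
  obtain B where B: "B \<subseteq> S" "\<not> dependent B" "S \<subseteq> span B"
    using maximal_independent_subset by blast
  have wB: "w \<notin> span B" using assms span_mono[OF B(1)] by blast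
  have "\<not> dependent (insert w B)" using B(2) wB by (simp add: independent_insert)
  then obtain \<phi> where \<phi>: "Vector_Spaces.linear s (*) \<phi>"
      "\<forall>x\<in>insert w B. \<phi> x = (if x = w then 1 else 0)"
    using p.linear_independent_extend[of "insert w B" "\<lambda>x. if x = w then 1 else 0"] by auto
  then interpret \<phi>: Vector_Spaces.linear s "(*)" \<phi> by simp
  have "w \<notin> B" using wB span_base by blast
  then have "\<phi> x = 0" if "x \<in> B" for x using \<phi>(2) that by auto
  then have "\<phi> x = 0" if "x \<in> span B" for x
    using that \<phi>.eq_0_on_span by blast
  then show ?thesis using \<phi> B(3) by (auto simp: dual_def)
qed

lemma ex_form_one: "w \<noteq> 0 \<Longrightarrow> \<exists>\<phi>\<in>dual s. \<phi> w = 1"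
  using separating_form[of w "{}"] by auto

lemma ex_notin_span:
  assumes "finite S" "card S < CARD('n)"
  shows "\<exists>z. z \<notin> span S"
proof (rule ccontr)
  assume "\<not> ?thesis"
  then have "range v \<subseteq> span S" by auto
  then have "card (range v) \<le> card S"
    using independent_span_bound[OF assms(1) independent_v] by blast
  then show False using assms(2) card_image[OF inj_v] by simp
qed

lemma ex_notin_span_pair: "\<exists>z. z \<notin> span {x, y}"
proof -
  have "card {x, y} < CARD('n)" using dim_ge by (simp add: card_insert_if)
  then show ?thesis using ex_notin_span[of "{x, y}"] by simp
qed

lemma in_span_singleton: "x \<in> span {u} \<longleftrightarrow> (\<exists>c. x = s c u)"
  by (auto simp: span_singleton)

lemma in_span_pair: "z \<in> span {x, y} \<longleftrightarrow> (\<exists>a b. z = s a x + s b y)"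
proof -
  have "z \<in> span {x, y} \<longleftrightarrow> (\<exists>a b. z - s a x = s b y)"
    by (simp add: span_insert in_span_singleton)
  then show ?thesis by (simp add: diff_eq_eq add.commute)
qed

text \<open>A form vanishing on the kernel of \<open>\<beta>\<close> is a multiple of
  \<open>\<beta>\<close>; hence the kernel contains a vector where \<open>\<gamma>\<close> is
  nonzero, and it can be rescaled.\<close>

lemma ex_dual_vector:
  assumes \<beta>: "\<beta> \<in> dual s" and \<gamma>: "\<gamma> \<in> dual s" and ind: "\<nexists>c. \<forall>x. \<gamma> x = c * \<beta> x"
  shows "\<exists>u. \<beta> u = 0 \<and> \<gamma> u = 1"
proof -
  have "\<exists>y. \<beta> y = 0 \<and> \<gamma> y \<noteq> 0"
  proof (rule ccontr)
    assume "\<not> ?thesis"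
    then have *: "\<gamma> y = 0" if "\<beta> y = 0" for y using that by blast
    show False
    proof (cases "\<exists>a. \<beta> a \<noteq> 0")
      case True
      then obtain a where a: "\<beta> a \<noteq> 0" by blast
      have "\<gamma> x = \<gamma> a / \<beta> a * \<beta> x" for x
      proof -
        have "\<beta> (x - s (\<beta> x / \<beta> a) a) = 0"
          using a by (simp add: dual_simps[OF \<beta>])
        then have "\<gamma> (x - s (\<beta> x / \<beta> a) a) = 0" by (rule *)
        then show ?thesis by (simp add: dual_simps[OF \<gamma>] field_simps)
      qed
      then show False using ind by blast
    next
      case False
      then have "\<forall>x. \<gamma> x = 0 * \<beta> x" using * by simp
      then show False using ind by blast
    qed
  qed
  then obtain y where y: "\<beta> y = 0" "\<gamma> y \<noteq> 0" by blast
  then show ?thesis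
    by (intro exI[of _ "s (1 / \<gamma> y) y"]) (simp add: dual_simps[OF \<beta>] dual_simps[OF \<gamma>])
qed

lemma ex_index_neq: "\<exists>k :: 'n. k \<noteq> i \<and> k \<noteq> j"
proof (rule ccontr)
  assume "\<not> ?thesis"
  then have U: "(UNIV :: 'n set) \<subseteq> {i, j}" by auto
  then have "CARD('n) \<le> card {i, j}" by (intro card_mono) auto
  also have "\<dots> \<le> 2" by (simp add: card_insert_if)
  finally show False using dim_ge by simp
qed

subsection \<open>Bilinear maps\<close>

definition bil :: "('v \<Rightarrow> 'v \<Rightarrow> 'v) \<Rightarrow> bool" where
  "bil p \<longleftrightarrow> (\<forall>x y z. p (x + y) z = p x z + p y z) \<and> (\<forall>x y z. p x (y + z) = p x y + p x z) \<and>
     (\<forall>c x y. p (s c x) y = s c (p x y)) \<and> (\<forall>c x y. p x (s c y) = s c (p x y))"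

lemma bilD:
  assumes "bil p"
  shows bil_add_left: "p (x + y) z = p x z + p y z" and bil_add_right: "p x (y + z) = p x y + p x z"
    and bil_scale_left: "p (s c x) y = s c (p x y)" and bil_scale_right: "p x (s c y) = s c (p x y)"
  using assms by (auto simp: bil_def)

lemma bil_zero_left: "bil p \<Longrightarrow> p 0 y = 0"
  using bil_scale_left[of p 0 0 y] by simp

lemma bil_zero_right: "bil p \<Longrightarrow> p x 0 = 0"
  using bil_scale_right[of p x 0 0] by simp

lemma bil_minus_left: "bil p \<Longrightarrow> p (- x) y = - p x y"
  using bil_scale_left[of p "-1" x y] by simp

lemma bil_minus_right: "bil p \<Longrightarrow> p x (- y) = - p x y"
  using bil_scale_right[of p x "-1" y] by simp

lemma bil_sum_left: "bil p \<Longrightarrow> p (\<Sum>a\<in>A. f a) y = (\<Sum>a\<in>A. p (f a) y)"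
  by (induction A rule: infinite_finite_induct) (simp_all add: bil_zero_left bil_add_left)

lemma bil_sum_right: "bil p \<Longrightarrow> p x (\<Sum>a\<in>A. f a) = (\<Sum>a\<in>A. p x (f a))"
  by (induction A rule: infinite_finite_induct) (simp_all add: bil_zero_right bil_add_right)

lemma bil_expand:
  assumes "bil p"
  shows "p x y = (\<Sum>i\<in>UNIV. \<Sum>j\<in>UNIV. s (cd x i * cd y j) (p (v i) (v j)))"
proof -
  have "p x y = p (\<Sum>i\<in>UNIV. s (cd x i) (v i)) (\<Sum>j\<in>UNIV. s (cd y j) (v j))"
    by (simp only: sum_cd)
  also have "\<dots> = (\<Sum>i\<in>UNIV. p (s (cd x i) (v i)) (\<Sum>j\<in>UNIV. s (cd y j) (v j)))"
    by (rule bil_sum_left[OF assms])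
  also have "\<dots> = (\<Sum>i\<in>UNIV. \<Sum>j\<in>UNIV. s (cd y j) (s (cd x i) (p (v i) (v j))))"
    by (simp only: bil_sum_right[OF assms] bil_scale_left[OF assms]
        bil_scale_right[OF assms] scale_sum_right)
  finally show ?thesis by (simp add: mult.commute)
qed

lemma bil_eqI:
  assumes "bil p" "bil q" "\<And>i j. p (v i) (v j) = q (v i) (v j)"
  shows "p = q"
proof (intro ext)
  fix x y
  show "p x y = q x y"
    unfolding bil_expand[OF assms(1), of x y] bil_expand[OF assms(2), of x y] by (simp only: assms(3))
qed

abbreviation P :: "('f, 'n) struct_vec \<Rightarrow> 'v \<Rightarrow> 'v \<Rightarrow> 'v" where "P \<equiv> alg_prod s v"

lemma bil_P: "bil (P l)"
  by (simp add: bil_def alg_prod_def algebra_simps sum.distrib scale_sum_right)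

lemmas P_simps = bilD[OF bil_P] bil_zero_left[OF bil_P] bil_zero_right[OF bil_P]
  bil_minus_left[OF bil_P] bil_minus_right[OF bil_P]

lemma cd_expansion: "cd (\<Sum>k\<in>UNIV. s (f k) (v k)) j = f j"
proof -
  have "cd (\<Sum>k\<in>UNIV. s (f k) (v k)) j = (\<Sum>k\<in>UNIV. if k = j then f k else 0)"
    unfolding cd_sum by (rule sum.cong) (auto simp: cd_v)
  then show ?thesis by simp
qed

lemma P_v: "P l (v i) (v j) = (\<Sum>k\<in>UNIV. s (l $ i $ j $ k) (v k))"
proof -
  have "P l (v i) (v j) = (\<Sum>a\<in>UNIV. if a = i then \<Sum>b\<in>UNIV. if b = j
      then \<Sum>k\<in>UNIV. s (l $ a $ b $ k) (v k) else 0 else 0)"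
    unfolding alg_prod_def by (intro sum.cong refl) (simp add: cd_v if_distrib[of "\<lambda>c. s c _"] cong: if_cong)
  then show ?thesis by simp
qed

lemma cd_P_v: "cd (P l (v i) (v j)) k = l $ i $ j $ k"
  by (simp add: P_v cd_expansion)

lemma P_inject: "P l = P m \<Longrightarrow> l = m"
  by (simp add: vec_eq_iff flip: cd_P_v)

lemma P_eqI: "(\<And>x y. P l x y = P m x y) \<Longrightarrow> l = m"
  by (rule P_inject) (intro ext)

lemma P_struct_vec_of: "bil p \<Longrightarrow> P (struct_vec_of s v p) = p"
  by (rule bil_eqI[OF bil_P]) (simp_all add: P_v struct_vec_of_def sum_cd)

lemma P_add: "P (l + m) x y = P l x y + P m x y"
proof -
  have "P (l + m) = (\<lambda>x y. P l x y + P m x y)"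
    by (rule bil_eqI) (auto simp: bil_P bil_def P_simps algebra_simps P_v sum.distrib)
  then show ?thesis by simp
qed

lemma P_smult: "P (lam_smult c l) x y = s c (P l x y)"
proof -
  have "P (lam_smult c l) = (\<lambda>x y. s c (P l x y))"
    by (rule bil_eqI) (auto simp: bil_P bil_def P_simps algebra_simps P_v lam_smult_def scale_sum_right)
  then show ?thesis by simp
qed

lemma P_zero: "P 0 x y = 0"
  by (simp add: alg_prod_def)

lemma P_sum: "P (\<Sum>a\<in>A. f a) x y = (\<Sum>a\<in>A. P (f a) x y)"
  by (induction A rule: infinite_finite_induct) (simp_all add: P_zero P_add)

subsection \<open>The general linear group\<close>

lemma GL_iff:
  "g \<in> GL s \<longleftrightarrow> (\<forall>x y. g (x + y) = g x + g y) \<and> (\<forall>c x. g (s c x) = s c (g x)) \<and> bij g"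
  using vector_space_axioms by (auto simp: GL_def Vector_Spaces.linear_iff)

lemma GL_D:
  assumes "g \<in> GL s"
  shows GL_add: "g (x + y) = g x + g y" and GL_scale: "g (s c x) = s c (g x)"
    and GL_inv_right: "g (inv g x) = x" and GL_inv_left: "inv g (g x) = x"
  using assms by (auto simp: GL_iff bij_is_surj surj_f_inv_f bij_is_inj inv_f_f)

lemma GL_eq_iff: "g \<in> GL s \<Longrightarrow> g x = g y \<longleftrightarrow> x = y"
  by (metis GL_inv_left)

lemma inv_GL: assumes g: "g \<in> GL s" shows "inv g \<in> GL s"
proof -
  have "inv g (x + y) = inv g x + inv g y" for x y
    by (subst GL_eq_iff[OF g, symmetric]) (simp add: GL_D[OF g])
  moreover have "inv g (s c x) = s c (inv g x)" for c x
    by (subst GL_eq_iff[OF g, symmetric]) (simp add: GL_D[OF g])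
  moreover have "bij (inv g)" using g by (simp add: GL_iff bij_imp_bij_inv)
  ultimately show ?thesis by (simp add: GL_iff)
qed

lemma dual_comp: "\<phi> \<in> dual s \<Longrightarrow> g \<in> GL s \<Longrightarrow> (\<lambda>x. \<phi> (g x)) \<in> dual s"
  by (auto simp: dual_iff GL_iff)

lemma P_act: "g \<in> GL s \<Longrightarrow> P (lam_act s v l g) x y = inv g (P l (g x) (g y))"
  unfolding lam_act_def
  by (subst P_struct_vec_of) (auto simp: bil_def GL_D GL_D[OF inv_GL] P_simps)

definition transv :: "'f \<Rightarrow> ('v \<Rightarrow> 'f) \<Rightarrow> 'v \<Rightarrow> 'v \<Rightarrow> 'v" where
  "transv t \<psi> u x = x + s (t * \<psi> x) u"

lemma
  assumes "\<psi> \<in> dual s" "\<psi> u = 0"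
  shows transv_GL: "transv t \<psi> u \<in> GL s" and inv_transv: "inv (transv t \<psi> u) = transv (- t) \<psi> u"
proof -
  have *: "transv t \<psi> u \<circ> transv (- t) \<psi> u = id" for t
    using assms(2) by (auto simp: transv_def fun_eq_iff dual_simps[OF assms(1)] algebra_simps)
  have "transv (- t) \<psi> u \<circ> transv t \<psi> u = id" using *[of "- t"] by simp
  then show "inv (transv t \<psi> u) = transv (- t) \<psi> u"
    using * by (intro inv_unique_comp) auto
  have "bij (transv t \<psi> u)"
    using * \<open>transv (- t) \<psi> u \<circ> transv t \<psi> u = id\<close> by (intro o_bij) auto
  then show "transv t \<psi> u \<in> GL s"
    using assms(2) by (auto simp: GL_iff transv_def dual_simps[OF assms(1)] algebra_simps)
qed

subsection \<open>Products that preserve lines\<close>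

abbreviation M2 where "M2 \<equiv> M2_sub s v"
abbreviation M1 where "M1 \<equiv> M1_sub s v"
abbreviation M1m where "M1m \<equiv> M1m_sub s v"
abbreviation U where "U \<equiv> U_sub s v"

lemma P_diff: "P (l - m) x y = P l x y - P m x y"
  using P_add[of "l - m" m x y] by (simp add: eq_diff_eq)

lemma M1_subset_M2: "M1 \<subseteq> M2"
proof
  fix l assume "l \<in> M1"
  then have "P l x x \<in> span {x, x}" for x unfolding M1_sub_def by blast
  then show "l \<in> M2" by (simp add: M2_sub_def in_span_singleton)
qed

text \<open>On \<open>\<M>\<^sup>*\<^sup>*\<close> this is the eigenvalue form: \<open>[x, x] = qf x \<cdot> x\<close>.\<close>

definition qf :: "('f, 'n) struct_vec \<Rightarrow> 'v \<Rightarrow> 'f" where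
  "qf l x = (\<Sum>i\<in>UNIV. cd x i * l $ i $ i $ i)"

lemma qf_dual: "qf l \<in> dual s"
  by (auto simp: dual_iff qf_def algebra_simps sum.distrib sum_distrib_left)

lemma qf_v: "qf l (v i) = l $ i $ i $ i"
proof -
  have "qf l (v i) = (\<Sum>j\<in>UNIV. if j = i then l $ j $ j $ j else 0)"
    unfolding qf_def by (intro sum.cong refl) (simp add: cd_v)
  then show ?thesis by simp
qed

lemma qf_add: "qf (l + m) x = qf l x + qf m x"
  and qf_smult: "qf (lam_smult c l) x = c * qf l x"
  by (simp_all add: qf_def lam_smult_def algebra_simps sum.distrib sum_distrib_left)

lemma scale_pair_eq:
  assumes y: "y \<notin> span {x}" and x: "x \<noteq> 0" and eq: "s a x + s b y = s a' x + s b' y"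
  shows "a = a' \<and> b = b'"
proof -
  have *: "s (b - b') y = s (a' - a) x" using eq by (simp add: algebra_simps)
  have b: "b = b'"
  proof (rule ccontr)
    assume "b \<noteq> b'"
    then have "y = s (1 / (b - b')) (s (b - b') y)" by simp
    also have "\<dots> = s ((a' - a) / (b - b')) x" unfolding * by simp
    finally show False using y in_span_singleton by blast
  qed
  then have "s (a' - a) x = 0" using * by simp
  then show ?thesis using b x by simp
qed

text \<open>
  For independent \<open>x\<close> and \<open>y\<close>, comparing the polarizations at \<open>(c x, y)\<close> and \<open>(x, y)\<close> gives
  \<open>(1 - c) (q (x + y) - q x - q y) = 0\<close>; this is where a scalar other than \<open>0\<close> and \<open>1\<close> is needed.
\<close>

lemma M2_ex_form:
  assumes l: "l \<in> M2"
  shows "\<exists>q\<in>dual s. \<forall>x. P l x x = s (q x) x"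
proof -
  have "\<forall>x. \<exists>c. P l x x = s c x" using l by (simp add: M2_sub_def)
  then obtain q0 where q0: "\<And>x. P l x x = s (q0 x) x" by metis
  \<comment> \<open>The square of \<open>0\<close> does not determine an eigenvalue; choosing 0
    there makes \<open>q\<close> homogeneous without exception.\<close>
  define q where "q x = (if x = 0 then 0 else q0 x)" for x
  have q: "P l x x = s (q x) x" for x
    using q0[of x] by (simp add: q_def P_simps)
  have q_zero: "q 0 = 0" by (simp add: q_def)
  have q_scale: "q (s c x) = c * q x" for c x
  proof (cases "c = 0 \<or> x = 0")
    case True
    then show ?thesis by (auto simp: q_zero)
  next
    case False
    have "s (q (s c x)) (s c x) = s c (s c (P l x x))"
      using q[of "s c x"] by (simp add: P_simps)
    then have "s (q (s c x) * c) x = s (c * c * q x) x" by (simp add: q mult_ac)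
    then show ?thesis using False by simp
  qed
  have pol: "P l x y + P l y x = s (q (x + y) - q x) x + s (q (x + y) - q y) y" for x y
  proof -
    have "P l (x + y) (x + y) = P l x x + P l y y + (P l x y + P l y x)"
      by (simp add: P_simps algebra_simps)
    then show ?thesis unfolding q by (simp add: algebra_simps)
  qed
  have q_add: "q (x + y) = q x + q y" for x y
  proof (cases "x = 0 \<or> y \<in> span {x}")
    case True
    then show ?thesis
    proof
      assume "y \<in> span {x}"
      then obtain c where y: "y = s c x" using in_span_singleton by blast
      have "q (s (1 + c) x) = (1 + c) * q x" by (rule q_scale)
      then show ?thesis by (simp add: y q_scale algebra_simps)
    qed (simp add: q_zero)
  next
    case False
    obtain c :: 'f where c: "c \<noteq> 0" "c \<noteq> 1" using ex_scalar by blast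
    have "s (q (s c x + y) - q (s c x)) (s c x) + s (q (s c x + y) - q y) y
        = s c (s (q (x + y) - q x) x + s (q (x + y) - q y) y)"
      unfolding pol[symmetric] by (simp add: P_simps scale_right_distrib)
    then have "s (c * (q (s c x + y) - c * q x)) x + s (q (s c x + y) - q y) y
        = s (c * (q (x + y) - q x)) x + s (c * (q (x + y) - q y)) y"
      by (simp add: q_scale scale_right_distrib mult.commute)
    then have "c * (q (s c x + y) - c * q x) = c * (q (x + y) - q x) \<and>
      q (s c x + y) - q y = c * (q (x + y) - q y)"
      by (rule scale_pair_eq[rotated 2]) (use False in auto)
    then have *: "q (s c x + y) - c * q x = q (x + y) - q x"
      "q (s c x + y) - q y = c * (q (x + y) - q y)"
      using c(1) by simp_all
    have "q (s c x + y) = q (x + y) - q x + c * q x" using *(1) by (simp only: diff_eq_eq)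
    moreover have "q (s c x + y) = c * (q (x + y) - q y) + q y" using *(2) by (simp only: diff_eq_eq)
    ultimately have "q (x + y) - q x + c * q x = c * (q (x + y) - q y) + q y" by simp
    then have "(1 - c) * (q (x + y) - q x - q y) = 0"
      by (simp add: algebra_simps)
    then have "q (x + y) - q x - q y = 0" using c(2) by simp
    then show ?thesis by (simp add: diff_eq_eq add.commute)
  qed
  have "q \<in> dual s" using q_add q_scale by (simp add: dual_iff)
  then show ?thesis using q by blast
qed

lemma M2_square:
  assumes "l \<in> M2" shows "P l x x = s (qf l x) x"
proof -
  obtain q where q: "q \<in> dual s" "\<And>x. P l x x = s (q x) x" using M2_ex_form[OF assms] by blast
  have "q (v i) = qf l (v i)" for i
  proof -
    have "cd (P l (v i) (v i)) i = q (v i)" unfolding q(2) by simp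
    then show ?thesis by (simp add: cd_P_v qf_v)
  qed
  then have "q = qf l" by (intro dual_eqI q(1) qf_dual)
  then show ?thesis using q(2) by simp
qed

text \<open>Polarizing [x, x] = q(x) x trades right multiplication by a vector for left
  multiplication, at the cost of multiples of the two arguments.\<close>

lemma M2_polar:
  assumes "l \<in> M2" shows "P l x y = s (qf l x) y + s (qf l y) x - P l y x"
proof -
  have "P l (x + y) (x + y) = P l x x + P l y y + (P l x y + P l y x)"
    by (simp add: P_simps algebra_simps)
  then show ?thesis
    unfolding M2_square[OF assms] by (simp add: dual_simps[OF qf_dual] algebra_simps)
qed

subsection \<open>Transvections\<close>

text \<open>This is the tensor (\<beta> \<and> \<gamma>) \<otimes> w; it is traceless when both
  forms kill \<open>w\<close>.\<close>

definition wedge :: "('v \<Rightarrow> 'f) \<Rightarrow> ('v \<Rightarrow> 'f) \<Rightarrow> 'v \<Rightarrow> ('f, 'n) struct_vec" where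
  "wedge \<beta> \<gamma> w = struct_vec_of s v (\<lambda>x y. s (\<beta> x * \<gamma> y - \<beta> y * \<gamma> x) w)"

lemma P_wedge:
  assumes "\<beta> \<in> dual s" "\<gamma> \<in> dual s"
  shows "P (wedge \<beta> \<gamma> w) x y = s (\<beta> x * \<gamma> y - \<beta> y * \<gamma> x) w"
  unfolding wedge_def
  by (subst P_struct_vec_of)
    (auto simp: bil_def dual_simps[OF assms(1)] dual_simps[OF assms(2)] algebra_simps)

text \<open>For \<open>\<psi> u = 0\<close> this is the derivative at t = 0 of the action of
  \<open>transv t \<psi> u\<close>, that is, the Lie algebra action of the endomorphism x \<mapsto>
  \<psi>(x) u.\<close>

definition transv_lin :: "('f, 'n) struct_vec \<Rightarrow> ('v \<Rightarrow> 'f) \<Rightarrow> 'v \<Rightarrow> ('f, 'n) struct_vec" where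
  "transv_lin l \<psi> u = struct_vec_of s v (\<lambda>x y. s (\<psi> y) (P l x u) + s (\<psi> x) (P l u y) - s (\<psi> (P l x y)) u)"

lemma P_transv_lin:
  assumes "\<psi> \<in> dual s"
  shows "P (transv_lin l \<psi> u) x y = s (\<psi> y) (P l x u) + s (\<psi> x) (P l u y) - s (\<psi> (P l x y)) u"
  unfolding transv_lin_def
  by (subst P_struct_vec_of) (auto simp: bil_def dual_simps[OF assms] P_simps algebra_simps)

lemma form_P_dual: "\<psi> \<in> dual s \<Longrightarrow> (\<lambda>y. \<psi> (P l u y)) \<in> dual s"
  by (simp add: dual_iff P_simps)

text \<open>The factor \<open>r = qf l u\<close> enters the quadratic coefficient twice: through
  [u, u] itself, and through \<psi>([x, u]) once polarization has turned it into \<psi>([u, x]). The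
  two contributions cancel, and what is left is alternating.\<close>

lemma act_transv:
  assumes l: "l \<in> M2" and \<psi>: "\<psi> \<in> dual s" and u: "\<psi> u = 0"
  shows "lam_act s v l (transv t \<psi> u) =
    l + lam_smult t (transv_lin l \<psi> u) + lam_smult (t^2) (wedge (\<lambda>y. \<psi> (P l u y)) \<psi> u)"
proof (rule P_eqI)
  fix x y
  define a b r where "a = \<psi> x" and "b = \<psi> y" and "r = qf l u"
  have gx: "transv t \<psi> u x = x + s (t * a) u" "transv t \<psi> u y = y + s (t * b) u"
    by (simp_all add: transv_def a_def b_def)
  have xu: "\<psi> (P l x u) = r * a - \<psi> (P l u x)"
    using M2_polar[OF l, of x u] by (simp add: dual_simps[OF \<psi>] u r_def a_def)
  define z where "z = P l (x + s (t * a) u) (y + s (t * b) u)"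
  have z: "z = P l x y + s (t * b) (P l x u) + s (t * a) (P l u y) + s (t^2 * a * b * r) u"
    by (simp add: z_def P_simps M2_square[OF l] r_def algebra_simps power2_eq_square)
  have \<psi>z: "\<psi> z = \<psi> (P l x y) + t * b * (r * a - \<psi> (P l u x)) + t * a * \<psi> (P l u y)"
    unfolding z by (simp add: dual_simps[OF \<psi>] u xu)
  have "P (lam_act s v l (transv t \<psi> u)) x y = z + s (- t * \<psi> z) u"
    unfolding P_act[OF transv_GL[OF \<psi> u]] inv_transv[OF \<psi> u] gx z_def[symmetric]
    by (simp add: transv_def)
  also have "\<dots> = P l x y + s (t * b) (P l x u) + s (t * a) (P l u y)
      + s (t^2 * a * b * r - t * \<psi> z) u"
    unfolding z[of] by (simp add: algebra_simps)
  also have "t^2 * a * b * r - t * \<psi> z = - t * \<psi> (P l x y) + t^2 * (\<psi> (P l u x) * b - \<psi> (P l u y) * a)"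
    unfolding \<psi>z by (simp add: algebra_simps power2_eq_square)
  finally show "P (lam_act s v l (transv t \<psi> u)) x y = P (l + lam_smult t (transv_lin l \<psi> u)
      + lam_smult (t^2) (wedge (\<lambda>y. \<psi> (P l u y)) \<psi> u)) x y"
    by (simp add: P_add P_smult P_transv_lin[OF \<psi>] P_wedge[OF form_P_dual[OF \<psi>] \<psi>]
        a_def b_def algebra_simps)
qed

section \<open>Identities for alternating products, and detecting products outside
  \<open>M1\<close>\<close>

lemma wedge_swap:
  assumes "\<beta> \<in> dual s" "\<gamma> \<in> dual s"
  shows "wedge \<gamma> \<beta> w = lam_smult (-1) (wedge \<beta> \<gamma> w)"
  by (rule P_eqI) (simp add: P_smult P_wedge assms flip: scale_minus_left)

lemma wedge_scale_right:
  assumes "\<beta> \<in> dual s" "\<gamma> \<in> dual s"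
  shows "wedge \<beta> (\<lambda>x. c * \<gamma> x) w = lam_smult c (wedge \<beta> \<gamma> w)"
  by (rule P_eqI) (simp add: P_smult P_wedge assms scale_in_dual algebra_simps)

lemma wedge_scale_vec:
  assumes "\<beta> \<in> dual s" "\<gamma> \<in> dual s"
  shows "wedge \<beta> \<gamma> (s c w) = lam_smult c (wedge \<beta> \<gamma> w)"
  by (rule P_eqI) (simp add: P_smult P_wedge assms mult.commute)

lemma ex_transv_witness:
  assumes "l \<notin> M1"
  obtains \<psi> u y where "\<psi> \<in> dual s" "\<psi> u = 0" "\<psi> y = 0" "\<psi> (P l u y) = 1"
proof -
  obtain u y where "P l u y \<notin> span {u, y}" using assms by (auto simp: M1_sub_def)
  from separating_form[OF this] show ?thesis using that by auto
qed

text \<open>The product of \<open>y\<close> and a suitable \<open>z\<close> is a nonzero multiple of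
  \<open>u\<close>, which both forms kill, whereas no nonzero combination of \<open>y\<close> and
  \<open>z\<close> is killed by both.\<close>

lemma wedge_notin_M1:
  assumes \<beta>: "\<beta> \<in> dual s" and \<gamma>: "\<gamma> \<in> dual s" and "\<beta> u = 0" "\<gamma> u = 0" "u \<noteq> 0"
    and y: "\<gamma> y = 1" "\<beta> y = 0" and x: "\<beta> x \<noteq> 0"
  shows "wedge \<gamma> \<beta> u \<notin> M1"
proof
  assume "wedge \<gamma> \<beta> u \<in> M1"
  \<comment> \<open>Subtracting a multiple of \<open>y\<close> makes \<open>\<gamma>\<close> vanish
    at \<open>z\<close> without changing the value of \<open>\<beta>\<close>.\<close>
  define z where "z = x - s (\<gamma> x) y"
  have z: "\<beta> z = \<beta> x" "\<gamma> z = 0"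
    by (simp_all add: z_def dual_simps[OF \<beta>] dual_simps[OF \<gamma>] y)
  have "P (wedge \<gamma> \<beta> u) y z \<in> span {y, z}"
    using \<open>wedge \<gamma> \<beta> u \<in> M1\<close> unfolding M1_sub_def by blast
  then obtain a b where ab: "s (\<beta> x) u = s a y + s b z"
    unfolding in_span_pair P_wedge[OF \<gamma> \<beta>] using y z by auto
  have "\<beta> (s (\<beta> x) u) = b * \<beta> x" "\<gamma> (s (\<beta> x) u) = a"
    unfolding ab by (simp_all add: dual_simps[OF \<beta>] dual_simps[OF \<gamma>] y z)
  then have "b = 0" "a = 0"
    using x assms by (simp_all add: dual_simps[OF \<beta>] dual_simps[OF \<gamma>])
  then show False using ab x assms by simp
qed

lemma transv_wedge_notin_M1:
  assumes l: "l \<in> M2" and \<psi>: "\<psi> \<in> dual s" "\<psi> u = 0" "\<psi> y = 0" "\<psi> (P l u y) = 1"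
  shows "wedge (\<lambda>y. \<psi> (P l u y)) \<psi> u \<notin> M1"
proof (rule wedge_notin_M1[OF \<psi>(1) form_P_dual[OF \<psi>(1)] \<psi>(2) _ _ \<psi>(4,3)])
  show "\<psi> (P l u u) = 0" by (simp add: M2_square[OF l] dual_simps[OF \<psi>(1)] \<psi>(2))
  show "u \<noteq> 0" using \<psi>(4) by (auto simp: P_simps dual_simps[OF \<psi>(1)])
  \<comment> \<open>The vector at which \<open>\<psi>\<close> must not vanish is the product
    \<open>P l u y\<close> itself.\<close>
  show "\<psi> (P l u y) \<noteq> 0" using \<psi>(4) by simp
qed

end

section \<open>Submodules not contained in \<open>\<M>\<^sup>*\<close>\<close>

locale M2_submodule = structure_space s v
  for s :: "'f::field \<Rightarrow> 'v::ab_group_add \<Rightarrow> 'v" and v :: "'n::finite \<Rightarrow> 'v" +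
  fixes N
  assumes N: "gsubmodule (GL s) (gsub (Lam s v) M2) N"
begin

lemma N_M2: "l \<in> N \<Longrightarrow> l \<in> M2"
  and N_zero: "0 \<in> N"
  and N_add: "l \<in> N \<Longrightarrow> m \<in> N \<Longrightarrow> l + m \<in> N"
  and N_smult: "l \<in> N \<Longrightarrow> lam_smult c l \<in> N"
  and N_act: "l \<in> N \<Longrightarrow> g \<in> GL s \<Longrightarrow> lam_act s v l g \<in> N"
  using N by (auto simp: gsubmodule_def Lam_def)

lemma N_sum: "(\<And>a. a \<in> A \<Longrightarrow> f a \<in> N) \<Longrightarrow> sum f A \<in> N"
  by (induction A rule: infinite_finite_induct) (simp_all add: N_zero N_add)

lemma transv_parts:
  assumes l: "l \<in> N" and \<psi>: "\<psi> \<in> dual s" "\<psi> u = 0"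
  shows transv_lin_in_N: "transv_lin l \<psi> u \<in> N"
    and transv_wedge_in_N: "wedge (\<lambda>y. \<psi> (P l u y)) \<psi> u \<in> N"
proof -
  define D Q where "D = transv_lin l \<psi> u" and "Q = wedge (\<lambda>y. \<psi> (P l u y)) \<psi> u"
  obtain t :: 'f where t: "t \<noteq> 0" "t \<noteq> 1" using ex_scalar by blast
  have *: "lam_smult c D + lam_smult (c^2) Q \<in> N" for c
  proof -
    have "lam_smult c D + lam_smult (c^2) Q = lam_act s v l (transv c \<psi> u) + lam_smult (-1) l"
      unfolding act_transv[OF N_M2[OF l] \<psi>] D_def Q_def
      by (simp add: lam_smult_def vec_eq_iff)
    then show ?thesis
      using N_add[OF N_act[OF l transv_GL[OF \<psi>]] N_smult[OF l]] by simp
  qed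
  \<comment> \<open>Eliminating \<open>D\<close> from the values at \<open>t\<close> and at 1 leaves
    \<open>(t^2 - t) Q\<close>, and the factor is invertible because \<open>t\<close> is neither 0
    nor 1.\<close>
  have "Q = lam_smult (1 / (t^2 - t)) ((lam_smult t D + lam_smult (t^2) Q)
      + lam_smult (- t) (lam_smult 1 D + lam_smult (1^2) Q))"
    using t by (simp add: lam_smult_def vec_eq_iff field_simps power2_eq_square)
  then have Q: "Q \<in> N" using N_smult N_add * by metis
  have "D = (lam_smult 1 D + lam_smult (1^2) Q) + lam_smult (-1) Q"
    by (simp add: lam_smult_def vec_eq_iff)
  then have "D \<in> N" using N_smult N_add * Q by metis
  with Q show "transv_lin l \<psi> u \<in> N" "wedge (\<lambda>y. \<psi> (P l u y)) \<psi> u \<in> N"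
    by (simp_all add: D_def Q_def)
qed

text \<open>If \<open>\<beta> u = 0\<close> and \<open>\<gamma> u = 1\<close>, the linear part of a
  transvection along \<open>u\<close> replaces \<open>\<gamma>\<close> by the form of the
  transvection: [x, u] is \<open>\<beta> x\<close> times \<open>w\<close>, and the last term
  vanishes because that form kills \<open>w\<close>.\<close>

lemma wedge_change_form:
  assumes \<beta>: "\<beta> \<in> dual s" "\<beta> w = 0" and \<gamma>: "\<gamma> \<in> dual s" "\<gamma> w = 0"
    and ind: "\<nexists>c. \<forall>x. \<gamma> x = c * \<beta> x" and W: "wedge \<beta> \<gamma> w \<in> N"
    and \<psi>: "\<psi> \<in> dual s" "\<psi> w = 0"
  shows "wedge \<beta> \<psi> w \<in> N"
proof -
  obtain u where u: "\<beta> u = 0" "\<gamma> u = 1" using ex_dual_vector[OF \<beta>(1) \<gamma>(1) ind] by blast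
  \<comment> \<open>The multiple of \<open>\<gamma>\<close> makes the form vanish at
    \<open>u\<close>, as a transvection along \<open>u\<close> requires; it is compensated at the
    end by a multiple of the given product.\<close>
  define \<psi>' where "\<psi>' x = \<psi> x + (- \<psi> u) * \<gamma> x" for x
  have \<psi>': "\<psi>' \<in> dual s" unfolding \<psi>'_def by (intro in_dual_intros \<psi> \<gamma>)
  have \<psi>'0: "\<psi>' u = 0" "\<psi>' w = 0" by (simp_all add: \<psi>'_def u \<psi> \<gamma>)
  have "transv_lin (wedge \<beta> \<gamma> w) \<psi>' u = wedge \<beta> \<psi>' w"
    by (rule P_eqI) (simp add: P_transv_lin[OF \<psi>'] P_wedge \<beta> \<gamma> \<psi>' dual_simps[OF \<psi>'] u \<psi>'0
        algebra_simps)
  then have 1: "wedge \<beta> \<psi>' w \<in> N" using transv_lin_in_N[OF W \<psi>' \<psi>'0(1)] by simp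
  have "wedge \<beta> \<psi> w = wedge \<beta> \<psi>' w + lam_smult (\<psi> u) (wedge \<beta> \<gamma> w)"
    by (rule P_eqI) (simp add: P_add P_smult P_wedge \<beta> \<gamma> \<psi> \<psi>', simp add: \<psi>'_def algebra_simps)
  then show ?thesis using 1 W N_add N_smult by simp
qed

text \<open>Two exchanges: the second form first and then, after a swap, the other one. If
  \<open>\<psi>\<close> is proportional to \<open>\<beta>\<close>, one exchange is enough.\<close>

lemma wedge_change_forms:
  assumes \<beta>: "\<beta> \<in> dual s" "\<beta> w = 0" "\<beta> z \<noteq> 0" and \<gamma>: "\<gamma> \<in> dual s" "\<gamma> w = 0"
    and ind: "\<nexists>c. \<forall>x. \<gamma> x = c * \<beta> x" and W: "wedge \<beta> \<gamma> w \<in> N"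
    and \<phi>: "\<phi> \<in> dual s" "\<phi> w = 0" and \<psi>: "\<psi> \<in> dual s" "\<psi> w = 0"
  shows "wedge \<phi> \<psi> w \<in> N"
proof (cases "\<exists>c. \<forall>x. \<psi> x = c * \<beta> x")
  case True
  then obtain c where c: "\<psi> = (\<lambda>x. c * \<beta> x)" by auto
  have "wedge \<beta> \<phi> w \<in> N" by (rule wedge_change_form[OF \<beta>(1,2) \<gamma> ind W \<phi>])
  then show ?thesis
    unfolding c wedge_scale_right[OF \<phi>(1) \<beta>(1)] wedge_swap[OF \<beta>(1) \<phi>(1)] by (intro N_smult)
next
  case False
  \<comment> \<open>After the swap, independence is required in the other direction;
    \<open>\<beta> z \<noteq> 0\<close> excludes the factor 0.\<close>
  have ind': "\<nexists>c. \<forall>x. \<beta> x = c * \<psi> x"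
  proof
    assume "\<exists>c. \<forall>x. \<beta> x = c * \<psi> x"
    then obtain c where c: "\<And>x. \<beta> x = c * \<psi> x" by blast
    then have "c \<noteq> 0" using \<beta>(3) by auto
    then have "\<forall>x. \<psi> x = 1 / c * \<beta> x" unfolding c by simp
    then show False using False by blast
  qed
  have "wedge \<beta> \<psi> w \<in> N" by (rule wedge_change_form[OF \<beta>(1,2) \<gamma> ind W \<psi>])
  then have "wedge \<psi> \<beta> w \<in> N" unfolding wedge_swap[OF \<beta>(1) \<psi>(1)] by (rule N_smult)
  from wedge_change_form[OF \<psi> \<beta>(1,2) ind' this \<phi>]
  show ?thesis unfolding wedge_swap[OF \<psi>(1) \<phi>(1)] by (rule N_smult)
qed

definition full :: "'v \<Rightarrow> bool" where
  "full w \<longleftrightarrow> (\<forall>\<phi>\<in>dual s. \<forall>\<psi>\<in>dual s. \<phi> w = 0 \<longrightarrow> \<psi> w = 0 \<longrightarrow> wedge \<phi> \<psi> w \<in> N)"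

lemma full_scale: "full w \<Longrightarrow> full (s c w)"
proof (cases "c = 0")
  case True
  have "wedge \<phi> \<psi> (s c w) = 0" if "\<phi> \<in> dual s" "\<psi> \<in> dual s" for \<phi> \<psi>
    by (rule P_eqI) (simp add: P_wedge P_zero that True)
  then show ?thesis by (simp add: full_def N_zero)
next
  case False
  assume "full w"
  show ?thesis unfolding full_def
  proof (intro ballI impI)
    fix \<phi> \<psi> assume *: "\<phi> \<in> dual s" "\<psi> \<in> dual s" "\<phi> (s c w) = 0" "\<psi> (s c w) = 0"
    then have "\<phi> w = 0" "\<psi> w = 0"
      using False by (simp_all add: dual_scale[OF *(1)] dual_scale[OF *(2)])
    then show "wedge \<phi> \<psi> (s c w) \<in> N"
      using * \<open>full w\<close> by (simp add: full_def wedge_scale_vec N_smult)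
  qed
qed

text \<open>The vector is moved by the quadratic part: if \<open>\<beta> u = 1\<close>,
  \<open>\<gamma> u = 0\<close>, \<open>\<psi> u = 0\<close> and \<open>\<psi> w = 1\<close>, the
  transvection along \<open>u\<close> turns (\<beta> \<and> \<gamma>) \<otimes> w into (\<gamma>
  \<and> \<psi>) \<otimes> u. The forms are then exchanged with \<open>u\<close> kept.\<close>

lemma full_all:
  assumes "full w" "w \<noteq> 0" shows "full u"
proof (cases "u \<in> span {w}")
  case True
  then show ?thesis using full_scale[OF assms(1)] by (auto simp: in_span_singleton)
next
  case False
  have "w \<notin> span {u}"
  proof
    assume "w \<in> span {u}"
    then obtain c where c: "w = s c u" using in_span_singleton by blast
    then have "u = s (1 / c) w" using assms(2) by auto
    then show False using False in_span_singleton by blast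
  qed
  then obtain \<psi> where \<psi>: "\<psi> \<in> dual s" "\<psi> w = 1" "\<psi> u = 0" using separating_form by blast
  obtain \<beta> where \<beta>: "\<beta> \<in> dual s" "\<beta> u = 1" "\<beta> w = 0" using separating_form[OF False] by blast
  \<comment> \<open>Dimension at least 3 leaves room for a nonzero form that kills both
    \<open>u\<close> and \<open>w\<close>.\<close>
  obtain z where "z \<notin> span {u, w}" using ex_notin_span_pair by blast
  from separating_form[OF this] obtain \<gamma> where
    \<gamma>: "\<gamma> \<in> dual s" "\<gamma> z = 1" "\<gamma> u = 0" "\<gamma> w = 0" by auto
  have W: "wedge \<beta> \<gamma> w \<in> N" using assms(1) \<beta> \<gamma> by (simp add: full_def)
  have "(\<lambda>y. \<psi> (P (wedge \<beta> \<gamma> w) u y)) = \<gamma>"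
    by (rule ext) (simp add: P_wedge \<beta> \<gamma> \<psi> dual_simps[OF \<psi>(1)])
  then have W': "wedge \<gamma> \<psi> u \<in> N" using transv_wedge_in_N[OF W \<psi>(1,3)] by simp
  have ind: "\<nexists>c. \<forall>x. \<psi> x = c * \<gamma> x"
    using \<psi>(2) \<gamma>(4) by (metis mult_zero_right zero_neq_one)
  have "\<gamma> z \<noteq> 0" using \<gamma>(2) by simp
  then show ?thesis unfolding full_def
    using wedge_change_forms[OF \<gamma>(1,3) _ \<psi>(1,3) ind W'] by blast
qed

lemma wedge_in_N:
  assumes "\<not> N \<subseteq> M1" "\<phi> \<in> dual s" "\<psi> \<in> dual s" "\<phi> w = 0" "\<psi> w = 0"
  shows "wedge \<phi> \<psi> w \<in> N"
proof -
  obtain l where l: "l \<in> N" "l \<notin> M1" using assms(1) by blast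
  obtain \<psi>' u y where \<psi>': "\<psi>' \<in> dual s" "\<psi>' u = 0" "\<psi>' y = 0" "\<psi>' (P l u y) = 1"
    using ex_transv_witness[OF l(2)] by blast
  define \<gamma> where "\<gamma> = (\<lambda>y. \<psi>' (P l u y))"
  have W: "wedge \<gamma> \<psi>' u \<in> N"
    using transv_wedge_in_N[OF l(1) \<psi>'(1,2)] by (simp add: \<gamma>_def)
  have \<gamma>: "\<gamma> \<in> dual s" "\<gamma> u = 0" "\<gamma> y \<noteq> 0"
    using form_P_dual[OF \<psi>'(1)] \<psi>'
    by (simp_all add: \<gamma>_def M2_square[OF N_M2[OF l(1)]] dual_scale[OF \<psi>'(1)])
  have ind: "\<nexists>c. \<forall>x. \<psi>' x = c * \<gamma> x"
  proof
    assume "\<exists>c. \<forall>x. \<psi>' x = c * \<gamma> x"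
    then obtain c where c: "\<And>x. \<psi>' x = c * \<gamma> x" by blast
    then have "c = 0" using \<psi>'(3) \<gamma>(3) by simp
    then show False using \<psi>'(4) c by simp
  qed
  have "full u" unfolding full_def
    using wedge_change_forms[OF \<gamma> \<psi>'(1,2) ind W] by blast
  moreover have "u \<noteq> 0" using \<psi>'(4) by (auto simp: P_simps dual_simps[OF \<psi>'(1)])
  ultimately have "full w" by (rule full_all)
  then show ?thesis using assms by (simp add: full_def)
qed

end

context structure_space
begin

section \<open>Traces and the submodules of \<open>\<M>\<^sup>*\<^sup>*\<close>\<close>

abbreviation K where "K \<equiv> K_sub s v"

definition tr :: "('f, 'n) struct_vec \<Rightarrow> 'v \<Rightarrow> 'f" where
  "tr l u = (\<Sum>j\<in>UNIV. cd (P l u (v j)) j)"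

lemma trace_of_P: "trace_of s v (\<lambda>x. P l u x) = tr l u"
  by (simp add: trace_of_def trace_def tr_def)

lemma tr_dual: "tr l \<in> dual s"
  by (simp add: dual_iff tr_def P_simps sum.distrib sum_distrib_left)

lemma tr_add: "tr (l + m) u = tr l u + tr m u"
  and tr_smult: "tr (lam_smult c l) u = c * tr l u"
  by (simp_all add: tr_def P_add P_smult sum.distrib sum_distrib_left)

lemma trace_commute:
  assumes A: "\<And>i. (\<lambda>x. cd (A x) i) \<in> dual s" and B: "\<And>i. (\<lambda>x. cd (B x) i) \<in> dual s"
  shows "(\<Sum>i\<in>UNIV. cd (A (B (v i))) i) = (\<Sum>i\<in>UNIV. cd (B (A (v i))) i)"
proof -
  have "(\<Sum>i\<in>UNIV. cd (A (B (v i))) i) = (\<Sum>i\<in>UNIV. \<Sum>j\<in>UNIV. cd (B (v i)) j * cd (A (v j)) i)"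
    by (intro sum.cong refl dual_expand[OF A])
  also have "\<dots> = (\<Sum>j\<in>UNIV. \<Sum>i\<in>UNIV. cd (B (v i)) j * cd (A (v j)) i)"
    by (rule sum.swap)
  also have "\<dots> = (\<Sum>j\<in>UNIV. \<Sum>i\<in>UNIV. cd (A (v j)) i * cd (B (v i)) j)"
    by (simp only: mult.commute)
  also have "\<dots> = (\<Sum>j\<in>UNIV. cd (B (A (v j))) j)"
    by (intro sum.cong refl dual_expand[OF B, symmetric])
  finally show ?thesis .
qed

lemma tr_act:
  assumes g: "g \<in> GL s"
  shows "tr (lam_act s v l g) u = tr l (g u)"
proof -
  have "tr (lam_act s v l g) u = (\<Sum>i\<in>UNIV. cd (inv g (P l (g u) (g (v i)))) i)"
    by (simp add: tr_def P_act[OF g])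
  also have "\<dots> = (\<Sum>i\<in>UNIV. cd (g (inv g (P l (g u) (v i)))) i)"
    by (rule trace_commute[where A = "\<lambda>x. inv g (P l (g u) x)" and B = g])
      (simp_all add: dual_iff GL_D[OF g] GL_D[OF inv_GL[OF g]] P_simps)
  finally show ?thesis by (simp add: GL_D[OF g] tr_def)
qed

lemma M2_I: "(\<And>x. P l x x = s (c x) x) \<Longrightarrow> l \<in> M2"
  by (auto simp: M2_sub_def)

lemma qf_eqI:
  assumes "q \<in> dual s" "\<And>x. P l x x = s (q x) x"
  shows "qf l = q"
proof (rule dual_eqI[OF qf_dual assms(1)])
  fix i
  have "cd (P l (v i) (v i)) i = q (v i)" unfolding assms(2) by simp
  then show "qf l (v i) = q (v i)" by (simp add: cd_P_v qf_v)
qed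

lemma act_square:
  assumes l: "l \<in> M2" and g: "g \<in> GL s"
  shows "P (lam_act s v l g) x x = s (qf l (g x)) x"
  by (simp add: P_act[OF g] M2_square[OF l] GL_D[OF g] GL_D[OF inv_GL[OF g]])

lemma qf_act:
  assumes l: "l \<in> M2" and g: "g \<in> GL s"
  shows "qf (lam_act s v l g) x = qf l (g x)"
  using qf_eqI[OF dual_comp[OF qf_dual g] act_square[OF l g]] by (rule fun_cong)

lemma M2_zero: "0 \<in> M2"
  and M2_add: "l \<in> M2 \<Longrightarrow> m \<in> M2 \<Longrightarrow> l + m \<in> M2"
  and M2_smult: "l \<in> M2 \<Longrightarrow> lam_smult c l \<in> M2"
  and M2_act: "l \<in> M2 \<Longrightarrow> g \<in> GL s \<Longrightarrow> lam_act s v l g \<in> M2"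
proof -
  show "0 \<in> M2" by (rule M2_I[of _ "\<lambda>x. 0"]) (simp add: P_zero)
  show "l + m \<in> M2" if "l \<in> M2" "m \<in> M2"
    using that by (intro M2_I[of _ "\<lambda>x. qf l x + qf m x"]) (simp add: P_add M2_square scale_left_distrib)
  show "lam_smult c l \<in> M2" if "l \<in> M2"
    using that by (intro M2_I[of _ "\<lambda>x. c * qf l x"]) (simp add: P_smult M2_square)
  show "lam_act s v l g \<in> M2" if "l \<in> M2" "g \<in> GL s"
    using that by (intro M2_I[of _ "\<lambda>x. qf l (g x)"]) (simp add: act_square)
qed

lemma K_iff: "l \<in> K \<longleftrightarrow> l \<in> M2 \<and> (\<forall>x. qf l x = 0)"
proof
  assume l: "l \<in> K"
  then have 0: "P l x x = 0" for x by (simp add: K_sub_def)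
  then have "P l x x = s 0 x" for x by simp
  then have "qf l = (\<lambda>x. 0)" by (intro qf_eqI zero_in_dual) simp
  moreover have "l \<in> M2" by (rule M2_I[of _ "\<lambda>x. 0"]) (simp add: 0)
  ultimately show "l \<in> M2 \<and> (\<forall>x. qf l x = 0)" by simp
next
  assume "l \<in> M2 \<and> (\<forall>x. qf l x = 0)"
  then show "l \<in> K" by (simp add: K_sub_def M2_square)
qed

lemma K_alternating:
  assumes "l \<in> K" shows "P l x y = - P l y x"
  using M2_polar[of l x y] assms by (simp add: K_iff)

lemma U_iff: "l \<in> U \<longleftrightarrow> l \<in> M2 \<and> (\<forall>x. qf l x = 0) \<and> (\<forall>x. tr l x = 0)"
  by (auto simp: U_sub_def T_sub_def trace_of_P K_iff)

lemma tr_wedge: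
  assumes \<beta>: "\<beta> \<in> dual s" and \<gamma>: "\<gamma> \<in> dual s"
  shows "tr (wedge \<beta> \<gamma> w) u = \<beta> u * \<gamma> w - \<gamma> u * \<beta> w"
proof -
  have "tr (wedge \<beta> \<gamma> w) u = (\<Sum>j\<in>UNIV. \<beta> u * (cd w j * \<gamma> (v j)) - \<gamma> u * (cd w j * \<beta> (v j)))"
    unfolding tr_def by (intro sum.cong refl) (simp add: P_wedge[OF \<beta> \<gamma>] algebra_simps)
  also have "\<dots> = \<beta> u * (\<Sum>j\<in>UNIV. cd w j * \<gamma> (v j)) - \<gamma> u * (\<Sum>j\<in>UNIV. cd w j * \<beta> (v j))"
    by (simp add: sum_subtractf sum_distrib_left)
  finally show ?thesis by (simp only: dual_expand[OF \<beta>, of w, symmetric] dual_expand[OF \<gamma>, of w, symmetric])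
qed

lemma wedge_in_K:
  assumes "\<beta> \<in> dual s" "\<gamma> \<in> dual s"
  shows "wedge \<beta> \<gamma> w \<in> K"
  by (simp add: K_sub_def P_wedge[OF assms])

section \<open>The products that make up \<open>M1\<close>\<close>

definition leftmul :: "('v \<Rightarrow> 'f) \<Rightarrow> ('f, 'n) struct_vec" where
  "leftmul q = struct_vec_of s v (\<lambda>x y. s (q y) x)"

definition skewmul :: "('v \<Rightarrow> 'f) \<Rightarrow> ('f, 'n) struct_vec" where
  "skewmul q = struct_vec_of s v (\<lambda>x y. s (q y) x - s (q x) y)"

lemma P_leftmul:
  assumes "q \<in> dual s" shows "P (leftmul q) x y = s (q y) x"
  unfolding leftmul_def
  by (subst P_struct_vec_of) (auto simp: bil_def dual_simps[OF assms] algebra_simps)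

lemma P_skewmul:
  assumes "q \<in> dual s" shows "P (skewmul q) x y = s (q y) x - s (q x) y"
  unfolding skewmul_def
  by (subst P_struct_vec_of) (auto simp: bil_def dual_simps[OF assms] algebra_simps)

lemma leftmul_M1: "q \<in> dual s \<Longrightarrow> leftmul q \<in> M1"
  by (auto simp: M1_sub_def P_leftmul intro: span_scale span_base)

lemma M1m_iff: "l \<in> M1m \<longleftrightarrow> (\<exists>q\<in>dual s. l = skewmul q)"
proof
  assume "l \<in> M1m"
  then obtain q where "q \<in> dual s" "\<And>x y. P l x y = s (q y) x - s (q x) y" by (auto simp: M1m_sub_def)
  then show "\<exists>q\<in>dual s. l = skewmul q" by (intro bexI[of _ q] P_eqI) (simp_all add: P_skewmul)
qed (auto simp: M1m_sub_def P_skewmul)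

text \<open>So \<open>leftmul\<close> is a section of \<open>qf\<close> inside \<open>M1\<close>;
  its trace form is \<open>q\<close> as well, hence \<open>tr\<close> and \<open>qf\<close> agree on
  it.\<close>

lemma qf_leftmul: "q \<in> dual s \<Longrightarrow> qf (leftmul q) = q"
  by (rule qf_eqI) (simp_all add: P_leftmul)

lemma tr_leftmul:
  assumes q: "q \<in> dual s" shows "tr (leftmul q) u = q u"
proof -
  have "tr (leftmul q) u = (\<Sum>j\<in>UNIV. cd u j * q (v j))"
    unfolding tr_def by (simp add: P_leftmul[OF q] mult.commute)
  then show ?thesis by (simp only: dual_expand[OF q, of u, symmetric])
qed

lemma skewmul_K: "q \<in> dual s \<Longrightarrow> skewmul q \<in> K"
  by (simp add: K_sub_def P_skewmul)

text \<open>Left multiplication by \<open>u\<close> is a rank-one map of trace \<open>q u\<close>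
  minus \<open>q u\<close> times the identity; this is where \<open>n - 1\<close> comes
  from.\<close>

lemma tr_skewmul:
  assumes q: "q \<in> dual s" shows "tr (skewmul q) u = (1 - of_nat CARD('n)) * q u"
proof -
  have "tr (skewmul q) u = (\<Sum>j\<in>UNIV. cd u j * q (v j)) - (\<Sum>j\<in>(UNIV :: 'n set). q u)"
    unfolding tr_def by (simp add: P_skewmul[OF q] mult.commute sum_subtractf)
  also have "(\<Sum>j\<in>UNIV. cd u j * q (v j)) = q u" by (simp only: dual_expand[OF q, of u, symmetric])
  finally show ?thesis by (simp add: algebra_simps)
qed

lemma M1m_subset: "M1m \<subseteq> K \<inter> M1"
proof
  fix l assume "l \<in> M1m"
  then obtain q where q: "q \<in> dual s" "l = skewmul q" using M1m_iff by blast
  have "P l x y = s (q y) x + s (- q x) y" for x y by (simp add: q P_skewmul)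
  then have "l \<in> M1" unfolding M1_sub_def in_span_pair by blast
  then show "l \<in> K \<inter> M1" using q skewmul_K by blast
qed

text \<open>
  For \<open>l \<in> \<K> \<inter> \<M>\<^sup>*\<close> the product of \<open>v i\<close> and \<open>v j\<close> involves only \<open>v i\<close> and \<open>v j\<close>; applying this to
  \<open>v i\<close> and \<open>v j + v k\<close> shows that the coefficient of \<open>v j\<close> in \<open>[v i, v j]\<close> does not depend on \<open>j\<close>.
\<close>

lemma K_Int_M1: "K \<inter> M1 = M1m"
proof (rule antisym[OF subsetI M1m_subset])
  fix l assume l: "l \<in> K \<inter> M1"
  have alt: "P l x y = - P l y x" for x y using K_alternating l by blast
  have sp: "\<exists>a b. P l x y = s a x + s b y" for x y
    using l unfolding in_span_pair[symmetric] M1_sub_def by blast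
  have c0: "cd (P l (v i) (v j)) k = 0" if "k \<noteq> i" "k \<noteq> j" for i j k
    using sp[of "v i" "v j"] that by auto
  have c1: "cd (P l (v i) (v j)) j = cd (P l (v i) (v k)) k" if "i \<noteq> j" "i \<noteq> k" for i j k
  proof (cases "j = k")
    case False
    obtain a b where ab: "P l (v i) (v j + v k) = s a (v i) + s b (v j + v k)" using sp by blast
    have "cd (P l (v i) (v j + v k)) j = cd (P l (v i) (v j + v k)) k"
      unfolding ab using that False by simp
    then show ?thesis using c0[of k i j] c0[of j i k] that False by (simp add: P_simps)
  qed simp
  \<comment> \<open>An arbitrary index other than \<open>i\<close>; the coefficient read off there
    does not depend on the choice.\<close>
  define \<kappa> where "\<kappa> i = (SOME j. j \<noteq> i)" for i :: 'n
  have \<kappa>: "\<kappa> i \<noteq> i" for i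
    unfolding \<kappa>_def by (rule someI_ex) (use ex_index_neq[of i i] in blast)
  define b where "b i = cd (P l (v i) (v (\<kappa> i))) (\<kappa> i)" for i
  \<comment> \<open>The sign is dictated by \<open>skewmul q\<close>, in which the coefficient of
    \<open>v j\<close> in the product of \<open>v i\<close> and \<open>v j\<close> is
    \<open>- q (v i)\<close>.\<close>
  define q where "q x = - (\<Sum>i\<in>UNIV. cd x i * b i)" for x
  have q: "q \<in> dual s"
    by (simp add: q_def dual_iff algebra_simps sum.distrib sum_distrib_left)
  have qv: "q (v i) = - b i" for i
  proof -
    have "(\<Sum>j\<in>UNIV. cd (v i) j * b j) = (\<Sum>j\<in>UNIV. if j = i then b j else 0)"
      by (intro sum.cong refl) (simp add: cd_v)
    then show ?thesis by (simp add: q_def)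
  qed
  have "P l (v i) (v j) = P (skewmul q) (v i) (v j)" for i j
  proof (cases "i = j")
    case True
    then show ?thesis using l by (simp add: K_sub_def P_skewmul q)
  next
    case False
    show ?thesis
    proof (rule cd_eqI)
      fix k
      have "cd (P l (v i) (v j)) j = b i"
        unfolding b_def using c1[of i j "\<kappa> i"] \<kappa>[of i] False by simp
      moreover have "cd (P l (v j) (v i)) i = b j"
        unfolding b_def using c1[of j i "\<kappa> j"] \<kappa>[of j] False by simp
      then have "cd (P l (v i) (v j)) i = - b j" using alt[of "v i" "v j"] by simp
      ultimately show "cd (P l (v i) (v j)) k = cd (P (skewmul q) (v i) (v j)) k"
        using c0[of k i j] False
        by (cases "k = i"; cases "k = j") (simp_all add: P_skewmul[OF q] qv)
    qed
  qed
  then have "l = skewmul q" by (intro P_inject bil_eqI bil_P)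
  then show "l \<in> M1m" using q M1m_iff by blast
qed

lemma minus_leftmul_qf:
  assumes "l \<in> M2" shows "l - leftmul (qf l) \<in> K"
  by (simp add: K_sub_def P_diff P_leftmul[OF qf_dual] M2_square[OF assms])

lemma tr_diff: "tr (l - m) u = tr l u - tr m u"
  using tr_add[of "l - m" m u] by (simp add: eq_diff_eq)

lemma M1_add: "l \<in> M1 \<Longrightarrow> m \<in> M1 \<Longrightarrow> l + m \<in> M1"
  by (simp add: M1_sub_def P_add span_add)

lemma M1_smult: "l \<in> M1 \<Longrightarrow> lam_smult c l \<in> M1"
  by (simp add: M1_sub_def P_smult span_scale)

lemma M1_zero: "0 \<in> M1"
  by (simp add: M1_sub_def P_zero span_zero)

lemma M1_act:
  assumes "l \<in> M1" and g: "g \<in> GL s" shows "lam_act s v l g \<in> M1"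
  unfolding M1_sub_def
proof (intro CollectI allI)
  fix x y
  have "P l (g x) (g y) \<in> span {g x, g y}" using assms(1) unfolding M1_sub_def by blast
  then obtain a b where "P l (g x) (g y) = s a (g x) + s b (g y)" unfolding in_span_pair by blast
  then have "P (lam_act s v l g) x y = s a x + s b y"
    by (simp add: P_act[OF g] GL_D[OF g] GL_D[OF inv_GL[OF g]])
  then show "P (lam_act s v l g) x y \<in> span {x, y}" unfolding in_span_pair by blast
qed

lemma M1_diff: "l \<in> M1 \<Longrightarrow> m \<in> M1 \<Longrightarrow> l - m \<in> M1"
  by (simp add: M1_sub_def P_diff span_diff)

text \<open>Removing \<open>leftmul (qf l)\<close> kills all squares without leaving
  \<open>M1\<close>, and the rest lies in \<open>K \<inter> M1\<close>.\<close>

lemma M1_decompose: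
  assumes "l \<in> M1"
  obtains \<theta> where "\<theta> \<in> dual s" "l = leftmul (qf l) + skewmul \<theta>"
proof -
  have "l - leftmul (qf l) \<in> K \<inter> M1"
    using minus_leftmul_qf M1_subset_M2 assms M1_diff leftmul_M1 qf_dual by blast
  then obtain \<theta> where "\<theta> \<in> dual s" "l - leftmul (qf l) = skewmul \<theta>" unfolding K_Int_M1 M1m_iff by blast
  then show ?thesis using that by (simp add: diff_eq_eq add.commute)
qed

text \<open>\<open>leftmul q\<close> has the right squares but trace form \<open>q\<close>. The
  defect \<open>\<tau> - q\<close> is the trace form of an alternating product, namely
  \<open>wedge \<delta> \<gamma> w\<close> with \<open>\<delta> w = 0\<close> and
  \<open>\<gamma> w = 1\<close>; unlike a correction by \<open>skewmul\<close>, this works in every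
  characteristic.\<close>

lemma ex_qf_tr:
  assumes q: "q \<in> dual s" and \<tau>: "\<tau> \<in> dual s"
  shows "\<exists>l\<in>M2. qf l = q \<and> tr l = \<tau>"
proof -
  define \<delta> where "\<delta> x = \<tau> x - q x" for x
  have \<delta>: "\<delta> \<in> dual s" unfolding \<delta>_def by (intro in_dual_intros q \<tau>)
  obtain w where w: "w \<noteq> 0" "\<delta> w = 0"
  proof -
    obtain i j :: 'n where ij: "i \<noteq> j" using ex_index_neq by metis
    show ?thesis
    proof (cases "\<delta> (v i) = 0")
      case True
      then show ?thesis using that v_nonzero by blast
    next
      case False
      \<comment> \<open>The two multiples are chosen so that \<open>\<delta>\<close> cancels; the
        coefficient at \<open>j\<close> shows that the vector is nonzero.\<close>
      have "cd (s (\<delta> (v i)) (v j) - s (\<delta> (v j)) (v i)) j \<noteq> 0"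
        using False ij by simp
      then have "s (\<delta> (v i)) (v j) - s (\<delta> (v j)) (v i) \<noteq> 0"
        using cd_zero[of j] by metis
      then show ?thesis by (rule that) (simp add: dual_simps[OF \<delta>])
    qed
  qed
  obtain \<gamma> where \<gamma>: "\<gamma> \<in> dual s" "\<gamma> w = 1" using ex_form_one[OF w(1)] by blast
  let ?l = "leftmul q + wedge \<delta> \<gamma> w"
  have W: "wedge \<delta> \<gamma> w \<in> M2" "qf (wedge \<delta> \<gamma> w) x = 0" for x
    using wedge_in_K[OF \<delta> \<gamma>(1)] unfolding K_iff by auto
  have "?l \<in> M2" using M2_add W(1) leftmul_M1[OF q] M1_subset_M2 by blast
  moreover have "qf ?l = q" by (simp add: fun_eq_iff qf_add W(2) qf_leftmul[OF q])
  moreover have "tr ?l = \<tau>"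
    by (simp add: fun_eq_iff tr_add tr_leftmul[OF q] tr_wedge[OF \<delta> \<gamma>(1)] \<gamma>(2) w(2)) (simp add: \<delta>_def)
  ultimately show ?thesis by blast
qed

text \<open>Characteristic 0 falls on the non-dividing side: 0 divides only 0, and
  \<open>n - 1\<close> is at least 2.\<close>

lemma of_nat_card_eq_one_iff: "of_nat CARD('n) = (1 :: 'f) \<longleftrightarrow> CHAR('f) dvd CARD('n) - 1"
proof -
  have "of_nat (CARD('n) - 1) = (of_nat CARD('n) - 1 :: 'f)" using dim_ge by (simp add: of_nat_diff)
  then show ?thesis by (metis of_nat_eq_0_iff_char_dvd eq_iff_diff_eq_0)
qed

end

context M2_submodule
begin

text \<open>
  Modulo \<open>N\<close>, which contains every \<open>wedge \<beta> \<gamma> w\<close> with \<open>\<beta> w = \<gamma> w = 0\<close>, for fixed \<open>i\<close> the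
  products \<open>wedge (v i)* (v j)* (v j)\<close> with \<open>j \<noteq> i\<close> all coincide; so a member of \<open>\<U>\<close> is congruent to
  a combination of these whose coefficients are its traces.
\<close>

lemma U_subset_of_not_subset_M1:
  assumes "\<not> N \<subseteq> M1"
  shows "U \<subseteq> N"
proof
  fix l assume lU: "l \<in> U"
  have alt: "P l x y = - P l y x" for x y
    using lU by (intro K_alternating) (simp add: U_sub_def)
  have l_alt: "l $ i $ j $ k = - l $ j $ i $ k" for i j k
    unfolding cd_P_v[symmetric] alt[of "v i" "v j"] by simp
  have P0: "P l x x = 0" for x using lU by (simp add: U_sub_def K_sub_def)
  have l0: "l $ i $ i $ k = 0" for i k
    unfolding cd_P_v[symmetric] P0 by simp
  define W where "W i j w = wedge (\<lambda>x. cd x i) (\<lambda>x. cd x j) w" for i j w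
  have P_W: "P (W i j w) x y = s (cd x i * cd y j - cd y i * cd x j) w" for i j w x y
    by (simp add: W_def P_wedge cd_dual)
  have W: "W i j w \<in> N" if "cd w i = 0" "cd w j = 0" for i j w
    unfolding W_def using that assms by (intro wedge_in_N cd_dual)
  define \<kappa> where "\<kappa> i = (SOME j. j \<noteq> i)" for i :: 'n
  have \<kappa>: "\<kappa> i \<noteq> i" for i
    unfolding \<kappa>_def by (rule someI_ex) (use ex_index_neq[of i i] in blast)
  define V where "V i = W i (\<kappa> i) (v (\<kappa> i))" for i
  have diff: "W i j (v j) - V i \<in> N" if "j \<noteq> i" for i j
  proof (cases "j = \<kappa> i")
    case True
    then show ?thesis by (simp add: V_def N_zero)
  next
    case False
    let ?k = "\<kappa> i"
    have d: "(\<lambda>x. cd x j + cd x ?k) \<in> dual s" by (intro in_dual_intros)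
    \<comment> \<open>The sum of the two coordinate forms kills \<open>v j - v ?k\<close>, so this
      product is in \<open>N\<close>; it is the wanted difference up to two mixed terms that are in
      \<open>N\<close> as well.\<close>
    have 1: "wedge (\<lambda>x. cd x i) (\<lambda>x. cd x j + cd x ?k) (v j - v ?k) \<in> N"
      using that \<kappa>[of i] False by (intro wedge_in_N assms cd_dual d) auto
    have 2: "W i j (v ?k) \<in> N" "W i ?k (v j) \<in> N"
      using that \<kappa>[of i] False by (auto intro!: W)
    have 3: "W i j (v j) - V i = wedge (\<lambda>x. cd x i) (\<lambda>x. cd x j + cd x ?k) (v j - v ?k)
        + W i j (v ?k) + lam_smult (-1) (W i ?k (v j))"
      by (rule P_eqI) (simp add: P_add P_diff P_smult V_def P_W P_wedge[OF cd_dual d] algebra_simps)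
    show ?thesis unfolding 3 by (intro N_add N_smult 1 2)
  qed
  define S where "S i j = lam_smult (l $ i $ j $ j) (V i)" for i j
  define Z where "Z i j = (\<Sum>k\<in>UNIV. lam_smult (l $ i $ j $ k) (W i j (v k)))" for i j
  have Z: "Z i j - (S i j + S j i) \<in> N" if ij: "i \<noteq> j" for i j
  proof -
    define X where "X = (\<Sum>k\<in>UNIV - {i, j}. lam_smult (l $ i $ j $ k) (W i j (v k)))"
    have X: "X \<in> N" unfolding X_def by (intro N_sum N_smult W) auto
    have Zs: "Z i j = X + (lam_smult (l $ i $ j $ i) (W i j (v i)) + lam_smult (l $ i $ j $ j) (W i j (v j)))"
      unfolding Z_def X_def using ij by (subst sum.subset_diff[of "{i, j}"]) auto
    \<comment> \<open>Swapping \<open>i\<close> and \<open>j\<close> changes the sign of both the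
      coefficient and the product, so this term is one of the second kind for the pair
      \<open>(j, i)\<close>.\<close>
    have "lam_smult (l $ i $ j $ i) (W i j (v i)) = lam_smult (l $ j $ i $ i) (W j i (v i))"
      by (rule P_eqI) (simp add: P_smult P_W l_alt[of i j] algebra_simps)
    then have Z': "Z i j - (S i j + S j i) = X + (lam_smult (l $ j $ i $ i) (W j i (v i) - V j)
        + lam_smult (l $ i $ j $ j) (W i j (v j) - V i))"
      unfolding Zs S_def by (intro P_eqI) (simp add: P_add P_diff P_smult algebra_simps)
    show ?thesis unfolding Z' by (intro N_add N_smult X diff) (use ij in auto)
  qed
  obtain e :: "'n \<Rightarrow> nat" where e: "inj e" using finite_imp_inj_to_nat_seg[of "UNIV :: 'n set"] by auto
  let ?R = "{(i, j). e i < e j}"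
  have "l = (\<Sum>(i, j)\<in>?R. Z i j)"
  proof (rule P_eqI)
    fix x y
    have PZ: "P (Z i j) x y = s (cd x i * cd y j) (P l (v i) (v j)) + s (cd x j * cd y i) (P l (v j) (v i))" for i j
    proof -
      have "P (Z i j) x y = (\<Sum>k\<in>UNIV. s (cd x i * cd y j - cd y i * cd x j) (s (l $ i $ j $ k) (v k)))"
        unfolding Z_def P_sum by (simp add: P_smult P_W mult.commute)
      also have "\<dots> = s (cd x i * cd y j - cd y i * cd x j) (P l (v i) (v j))"
        by (simp only: P_v scale_sum_right)
      finally show ?thesis unfolding alt[of "v j" "v i"] by (simp add: algebra_simps)
    qed
    have "P l x y = (\<Sum>(i, j)\<in>?R. s (cd x i * cd y j) (P l (v i) (v j)) + s (cd x j * cd y i) (P l (v j) (v i)))"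
      unfolding bil_expand[OF bil_P, of l x y] by (rule sum_ordered_pairs[OF e, symmetric]) (simp add: P0)
    then show "P l x y = P (\<Sum>(i, j)\<in>?R. Z i j) x y"
      unfolding P_sum case_prod_unfold PZ .
  qed
  \<comment> \<open>For each \<open>i\<close> the coefficients of \<open>V i\<close> add up to
    \<open>tr l (v i)\<close>, which is zero for \<open>l\<close> in \<open>U\<close>.\<close>
  moreover have "(\<Sum>(i, j)\<in>?R. S i j + S j i) = 0"
  proof -
    have "(\<Sum>(i, j)\<in>?R. S i j + S j i) = (\<Sum>i\<in>UNIV. \<Sum>j\<in>UNIV. S i j)"
      by (rule sum_ordered_pairs[OF e]) (simp add: S_def l0 lam_smult_def vec_eq_iff)
    also have "\<dots> = (\<Sum>i\<in>UNIV. lam_smult (tr l (v i)) (V i))"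
      unfolding S_def tr_def
      by (intro sum.cong refl) (simp add: vec_eq_iff lam_smult_def cd_P_v sum_distrib_right)
    also have "\<dots> = 0" using lU by (simp add: U_iff lam_smult_def vec_eq_iff)
    finally show ?thesis .
  qed
  ultimately have "l = (\<Sum>(i, j)\<in>?R. Z i j - (S i j + S j i))"
    by (simp add: sum_subtractf case_prod_unfold)
  also have "\<dots> \<in> N" by (rule N_sum) (auto intro!: Z)
  finally show "l \<in> N" .
qed

end

context structure_space
begin

section \<open>Structure vectors and linear forms as modules\<close>

abbreviation L where "L \<equiv> Lam s v"
abbreviation G where "G \<equiv> GL s"

lemma L_simps [simp]:
  "gcarrier L = UNIV" "gzero L = 0" "gadd L = (+)" "gsmult L = lam_smult" "gact L = lam_act s v"
  by (simp_all add: Lam_def)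

lemma dual_module_simps [simp]:
  "gcarrier (dual_module s) = dual s" "gzero (dual_module s) = (\<lambda>x. 0)"
  "gadd (dual_module s) \<phi> \<psi> = (\<lambda>x. \<phi> x + \<psi> x)" "gsmult (dual_module s) c \<phi> = (\<lambda>x. c * \<phi> x)"
  "gact (dual_module s) \<phi> g = (\<lambda>x. \<phi> (g x))"
  by (simp_all add: dual_module_def)

lemma act_add:
  assumes "g \<in> GL s" shows "lam_act s v (l + m) g = lam_act s v l g + lam_act s v m g"
  by (rule P_eqI) (simp add: P_act[OF assms] P_add GL_D[OF inv_GL[OF assms]])

lemma smult_add: "lam_smult c (l + m) = lam_smult c l + lam_smult c m"
  by (simp add: lam_smult_def vec_eq_iff distrib_left)

lemma gmod_L: "gmod G L"
  by unfold_locales (simp_all add: add_ac act_add smult_add, simp add: lam_smult_def vec_eq_iff)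

lemma gmod_dual: "gmod G (dual_module s)"
  by unfold_locales
    (auto simp: algebra_simps intro: in_dual_intros dual_comp)

lemma gsub_M2: "gsubmodule G L M2"
  by (simp add: gsubmodule_def M2_zero M2_add M2_smult M2_act)

lemma gsub_M1: "gsubmodule G L M1"
  by (simp add: gsubmodule_def M1_zero M1_add M1_smult M1_act)

lemma qf_zero: "qf 0 x = 0" and tr_zero: "tr 0 x = 0"
  by (simp_all add: qf_def tr_def P_zero)

lemma gsub_U: "gsubmodule G L U"
  by (simp add: gsubmodule_def U_iff M2_zero M2_add M2_smult M2_act qf_zero tr_zero qf_add tr_add
      qf_smult tr_smult qf_act tr_act)

lemma gsub_K: "gsubmodule G L K"
  by (simp add: gsubmodule_def K_iff M2_zero M2_add M2_smult M2_act qf_zero qf_add qf_smult qf_act)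

lemma gsub_M1m: "gsubmodule G L M1m"
  unfolding K_Int_M1[symmetric] by (rule gmod.gsubmodule_Int[OF gmod_L gsub_K gsub_M1])

lemma U_subset_M2: "U \<subseteq> M2"
  by (auto simp: U_iff)

lemma gsubmodule_of_M2: "gsubmodule G (gsub L M2) A \<longleftrightarrow> gsubmodule G L A \<and> A \<subseteq> M2"
  by (rule gmod.gsubmodule_gsub[OF gmod_L gsub_M2])

lemma gsubmodule_of_U: "gsubmodule G (gsub L U) A \<longleftrightarrow> gsubmodule G L A \<and> A \<subseteq> U"
  by (rule gmod.gsubmodule_gsub[OF gmod_L gsub_U])

lemma gmod_M2: "gmod G (gsub L M2)"
  by (rule gmod.gmod_gsub[OF gmod_L gsub_M2])

lemma gmod_U: "gmod G (gsub L U)"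
  by (rule gmod.gmod_gsub[OF gmod_L gsub_U])

text \<open>The irreducibility claims about \<open>U\<close> and its quotient rest on this
  dichotomy: a proper submodule of \<open>U\<close> is confined to
  \<open>U \<inter> M1\<close>.\<close>

lemma U_subset_or_subset_M1:
  assumes "gsubmodule G L N" "N \<subseteq> M2" shows "U \<subseteq> N \<or> N \<subseteq> M1"
proof -
  have "gsubmodule G (gsub L M2) N" using assms gsubmodule_of_M2 by blast
  then interpret M2_submodule s v N by unfold_locales
  show ?thesis using U_subset_of_not_subset_M1 by blast
qed

lemma U_not_subset_M1: "\<not> U \<subseteq> M1"
proof -
  fix i :: 'n
  obtain j where j: "j \<noteq> i" using ex_index_neq by metis
  obtain k where k: "k \<noteq> i" "k \<noteq> j" using ex_index_neq by metis
  \<comment> \<open>With three distinct indices both forms kill \<open>v k\<close>, so the product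
    is traceless.\<close>
  let ?W = "wedge (\<lambda>x. cd x i) (\<lambda>x. cd x j) (v k)"
  have "?W \<notin> M1"
    using j k by (intro wedge_notin_M1[OF cd_dual cd_dual, where y = "v i" and x = "v j"])
      (simp_all add: v_nonzero)
  moreover have "?W \<in> U"
    using wedge_in_K[OF cd_dual cd_dual, of i j "v k"] k
    by (simp add: U_iff K_iff tr_wedge[OF cd_dual cd_dual])
  ultimately show ?thesis by blast
qed

text \<open>If \<open>\<phi> u = 1\<close>, composing \<open>\<phi>\<close> with a transvection
  along \<open>u\<close> and subtracting \<open>\<phi>\<close> gives any prescribed form killing
  \<open>u\<close>; multiples of \<open>\<phi>\<close> supply the rest.\<close>

lemma girreducible_dual: "girreducible G (dual_module s)"
  unfolding girreducible_def
proof (intro conjI allI impI)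
  fix i :: 'n
  have "(\<lambda>x. cd x i) \<noteq> (\<lambda>x. 0)" by (metis cd_v_same zero_neq_one)
  then show "gcarrier (dual_module s) \<noteq> {gzero (dual_module s)}" using cd_dual[of i] by auto
next
  fix N assume "gsubmodule G (dual_module s) N"
  then have N: "N \<subseteq> dual s" "(\<lambda>x. 0) \<in> N"
    and N_add: "\<And>\<phi> \<psi>. \<phi> \<in> N \<Longrightarrow> \<psi> \<in> N \<Longrightarrow> (\<lambda>x. \<phi> x + \<psi> x) \<in> N"
    and N_smult: "\<And>c \<phi>. \<phi> \<in> N \<Longrightarrow> (\<lambda>x. c * \<phi> x) \<in> N"
    and N_act: "\<And>\<phi> g. \<phi> \<in> N \<Longrightarrow> g \<in> G \<Longrightarrow> (\<lambda>x. \<phi> (g x)) \<in> N"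
    by (simp_all add: gsubmodule_def)
  show "N = {gzero (dual_module s)} \<or> N = gcarrier (dual_module s)"
  proof (cases "N = {\<lambda>x. 0}")
    case False
    then obtain \<phi> where \<phi>: "\<phi> \<in> N" "\<phi> \<noteq> (\<lambda>x. 0)" using N by blast
    then have \<phi>d: "\<phi> \<in> dual s" using N by blast
    obtain a where a: "\<phi> a \<noteq> 0" using \<phi>(2) by auto
    define u where "u = s (1 / \<phi> a) a"
    have u: "\<phi> u = 1" using a by (simp add: u_def dual_scale[OF \<phi>d])
    have "\<psi> \<in> N" if \<psi>: "\<psi> \<in> dual s" for \<psi>
    proof -
      define \<psi>' where "\<psi>' x = \<psi> x - \<psi> u * \<phi> x" for x
      have \<psi>': "\<psi>' \<in> dual s" "\<psi>' u = 0"
        unfolding \<psi>'_def by (intro in_dual_intros \<psi> \<phi>d) (simp add: u)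
      have "\<psi>' = (\<lambda>x. \<phi> (transv 1 \<psi>' u x) + (-1) * \<phi> x)"
        by (simp add: fun_eq_iff transv_def dual_simps[OF \<phi>d] u)
      moreover have "(\<lambda>x. \<phi> (transv 1 \<psi>' u x) + (-1) * \<phi> x) \<in> N"
        by (rule N_add[OF N_act[OF \<phi>(1) transv_GL[OF \<psi>']] N_smult[OF \<phi>(1)]])
      ultimately have "\<psi>' \<in> N" by simp
      then have "(\<lambda>x. \<psi>' x + \<psi> u * \<phi> x) \<in> N" by (rule N_add[OF _ N_smult[OF \<phi>(1)]])
      then show ?thesis by (simp add: \<psi>'_def)
    qed
    then show ?thesis using N by auto
  qed simp
qed

lemma quotient_M2_U_iso:
  "giso G (gquot (gsub L M2) U) (gdirect_sum (dual_module s) (dual_module s))"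
proof (rule first_isomorphism[OF gmod_M2 gmod_gdirect_sum[OF gmod_dual gmod_dual],
      where f = "\<lambda>l. (qf l, tr l)"])
  show "ghom G (gsub L M2) (gdirect_sum (dual_module s) (dual_module s)) (\<lambda>l. (qf l, tr l))"
    by (rule ghomI)
      (simp_all add: gdirect_sum_def qf_dual tr_dual fun_eq_iff qf_add tr_add qf_smult tr_smult qf_act tr_act)
  show "(\<lambda>l. (qf l, tr l)) ` gcarrier (gsub L M2) = gcarrier (gdirect_sum (dual_module s) (dual_module s))"
  proof
    show "gcarrier (gdirect_sum (dual_module s) (dual_module s)) \<subseteq> (\<lambda>l. (qf l, tr l)) ` gcarrier (gsub L M2)"
    proof
      fix p assume "p \<in> gcarrier (gdirect_sum (dual_module s) (dual_module s))"
      then have "fst p \<in> dual s" "snd p \<in> dual s" by (auto simp: gdirect_sum_def)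
      then obtain l where "l \<in> M2" "qf l = fst p" "tr l = snd p" using ex_qf_tr by blast
      then show "p \<in> (\<lambda>l. (qf l, tr l)) ` gcarrier (gsub L M2)"
        by (intro image_eqI[of _ _ l]) simp_all
    qed
  qed (auto simp: gdirect_sum_def qf_dual tr_dual)
  show "(qf l, tr l) = gzero (gdirect_sum (dual_module s) (dual_module s)) \<longleftrightarrow> l \<in> U"
    if "l \<in> gcarrier (gsub L M2)" for l
    using that by (simp add: gdirect_sum_def U_iff fun_eq_iff)
qed (simp add: U_subset_M2)

text \<open>This form vanishes on every \<open>leftmul q\<close> and equals \<open>(1 - n) q\<close>
  on \<open>skewmul q\<close>. If n \<noteq> 1 in the field it recovers the \<open>skewmul\<close>
  component modulo \<open>U\<close>; if n = 1 it depends only on the coset modulo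
  \<open>M1\<close>.\<close>

definition rho :: "('f, 'n) struct_vec \<Rightarrow> 'v \<Rightarrow> 'f" where
  "rho l x = tr l x - qf l x"

lemma rho_dual: "rho l \<in> dual s"
  unfolding rho_def by (intro in_dual_intros tr_dual qf_dual)

lemma rho_add: "rho (l + m) x = rho l x + rho m x"
  and rho_smult: "rho (lam_smult c l) x = c * rho l x"
  by (simp_all add: rho_def tr_add qf_add tr_smult qf_smult algebra_simps)

lemma rho_act: "l \<in> M2 \<Longrightarrow> g \<in> G \<Longrightarrow> rho (lam_act s v l g) x = rho l (g x)"
  by (simp add: rho_def tr_act qf_act)

lemma ghom_rho: "ghom G (gsub L M2) (dual_module s) rho"
  by (rule ghomI) (simp_all add: rho_dual fun_eq_iff rho_add rho_smult rho_act)

lemma rho_surj: "\<phi> \<in> dual s \<Longrightarrow> \<exists>l\<in>M2. rho l = \<phi>"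
proof -
  assume "\<phi> \<in> dual s"
  then obtain l where "l \<in> M2" "qf l = (\<lambda>x. 0)" "tr l = \<phi>" using ex_qf_tr[OF zero_in_dual] by blast
  then show ?thesis by (intro bexI[of _ l]) (simp_all add: rho_def fun_eq_iff)
qed

lemma gsum_L: "gsum L A B = {a + b | a b. a \<in> A \<and> b \<in> B}"
  by (simp add: gsum_def)

lemma gsum_I: "l - m \<in> A \<Longrightarrow> m \<in> B \<Longrightarrow> l \<in> gsum L A B"
  unfolding gsum_L by (rule CollectI, rule exI[of _ "l - m"], rule exI[of _ m]) simp

lemma gsub_gsum: "gsubmodule G L (gsum L U M1)"
  by (rule gmod.gsubmodule_gsum[OF gmod_L gsub_U gsub_M1])

lemma gsum_subset_M2: "gsum L U M1 \<subseteq> M2"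
  using U_subset_M2 M1_subset_M2 M2_add by (auto simp: gsum_L)

lemma skewmul_eq_0:
  assumes q: "q \<in> dual s" and "skewmul q = 0" shows "q x = 0"
proof (rule ccontr)
  assume x: "q x \<noteq> 0"
  obtain y where y: "y \<notin> span {x, x}" using ex_notin_span_pair by blast
  have "s (q x) y = s (q y) x"
    using P_skewmul[OF q, of x y] assms(2) by (simp add: P_zero)
  then have "y = s (q y / q x) x"
    using x by (metis divide_inverse_commute left_inverse scale_one scale_scale)
  then show False using y in_span_singleton[of y x] by auto
qed

lemma GL_diff: assumes "g \<in> GL s" shows "g (x - y) = g x - g y"
  using GL_add[OF assms, of "x - y" y] by (simp add: eq_diff_eq)

lemma skewmul_act:
  assumes "q \<in> dual s" "g \<in> GL s"
  shows "lam_act s v (skewmul q) g = skewmul (\<lambda>x. q (g x))"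
  by (rule P_eqI) (simp add: P_act[OF assms(2)] P_skewmul assms dual_comp GL_D[OF assms(2)]
      GL_D[OF inv_GL[OF assms(2)]] GL_diff[OF inv_GL[OF assms(2)]])

lemma M1m_iso_dual: "giso G (gsub L M1m) (dual_module s)"
proof (rule giso_sym[OF gmod_dual])
  have "ghom G (dual_module s) (gsub L M1m) skewmul"
  proof (rule ghomI)
    show "skewmul q \<in> gcarrier (gsub L M1m)" if "q \<in> gcarrier (dual_module s)" for q
      using that M1m_iff by auto
    show "skewmul (gadd (dual_module s) p q) = gadd (gsub L M1m) (skewmul p) (skewmul q)"
      if "p \<in> gcarrier (dual_module s)" "q \<in> gcarrier (dual_module s)" for p q
      using that by (intro P_eqI) (simp add: P_add P_skewmul add_in_dual algebra_simps)
    show "skewmul (gsmult (dual_module s) c q) = gsmult (gsub L M1m) c (skewmul q)"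
      if "q \<in> gcarrier (dual_module s)" for c q
      using that by (intro P_eqI) (simp add: P_smult P_skewmul scale_in_dual algebra_simps)
  qed (simp add: skewmul_act)
  moreover have "inj_on skewmul (gcarrier (dual_module s))"
    unfolding ghom_inj_on_iff[OF gmod_dual gmod.gmod_gsub[OF gmod_L gsub_M1m] calculation]
    using skewmul_eq_0 by auto
  moreover have "skewmul ` gcarrier (dual_module s) = gcarrier (gsub L M1m)"
    using M1m_iff by auto
  ultimately show "giso G (dual_module s) (gsub L M1m)"
    by (auto simp: giso_iff_ghom bij_betw_def)
qed

subsection \<open>The non-modular case\<close>

lemma U_Int_M1_zero:
  assumes "of_nat CARD('n) \<noteq> (1 :: 'f)" shows "U \<inter> M1 = {0}"
proof -
  have "l = 0" if "l \<in> U" "l \<in> M1" for l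
  proof -
    have "l \<in> M1m" using that K_Int_M1 by (auto simp: U_sub_def)
    then obtain q where q: "q \<in> dual s" "l = skewmul q" using M1m_iff by blast
    have "(1 - of_nat CARD('n)) * q x = 0" for x
      using that(1) tr_skewmul[OF q(1), of x] q(2) by (simp add: U_iff)
    then have "q x = 0" for x using assms by simp
    then show ?thesis by (intro P_eqI) (simp add: q(2) P_skewmul[OF q(1)] P_zero)
  qed
  moreover have "0 \<in> U" "0 \<in> M1" using gsub_U gsub_M1 by (auto simp: gsubmodule_def)
  ultimately show ?thesis by blast
qed

lemma gsum_U_M1_eq_M2:
  assumes "of_nat CARD('n) \<noteq> (1 :: 'f)" shows "gsum L U M1 = M2"
proof (rule antisym[OF gsum_subset_M2 subsetI])
  fix l assume l: "l \<in> M2"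
  \<comment> \<open>The solution of \<open>rho l = (1 - n) \<theta>\<close>, so that removing
    \<open>skewmul \<theta>\<close> makes the trace vanish.\<close>
  define \<theta> where "\<theta> x = 1 / (1 - of_nat CARD('n)) * rho l x" for x
  have \<theta>: "\<theta> \<in> dual s" unfolding \<theta>_def by (intro in_dual_intros rho_dual)
  define m where "m = leftmul (qf l) + skewmul \<theta>"
  have "skewmul \<theta> \<in> M1" using M1m_subset M1m_iff \<theta> by blast
  then have m: "m \<in> M1" unfolding m_def by (intro M1_add leftmul_M1 qf_dual)
  have "l - leftmul (qf l) - skewmul \<theta> \<in> K"
    using minus_leftmul_qf[OF l] skewmul_K[OF \<theta>] by (simp add: K_sub_def P_diff)
  then have K: "l - m \<in> K" by (simp add: m_def diff_diff_eq)
  have "tr (l - m) x = rho l x - (1 - of_nat CARD('n)) * \<theta> x" for x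
    by (simp add: tr_diff m_def tr_add tr_leftmul[OF qf_dual] tr_skewmul[OF \<theta>] rho_def)
  then have "tr (l - m) x = 0" for x
    using assms unfolding \<theta>_def by simp
  then have "l - m \<in> U" using K unfolding U_iff K_iff by blast
  then show "l \<in> gsum L U M1" using m by (rule gsum_I)
qed

lemma girreducible_U:
  assumes "of_nat CARD('n) \<noteq> (1 :: 'f)" shows "girreducible G (gsub L U)"
  unfolding girreducible_def
proof (intro conjI allI impI)
  show "gcarrier (gsub L U) \<noteq> {gzero (gsub L U)}"
  proof
    assume "gcarrier (gsub L U) = {gzero (gsub L U)}"
    then have "U \<subseteq> M1" using M1_zero by simp
    then show False using U_not_subset_M1 by simp
  qed
  fix N assume "gsubmodule G (gsub L U) N"
  then have N: "gsubmodule G L N" "N \<subseteq> U" using gsubmodule_of_U by auto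
  have "0 \<in> N" using N by (simp add: gsubmodule_def)
  have "U \<subseteq> N \<or> N \<subseteq> M1" using U_subset_or_subset_M1 N U_subset_M2 by blast
  then show "N = {gzero (gsub L U)} \<or> N = gcarrier (gsub L U)"
    using N(2) U_Int_M1_zero[OF assms] \<open>0 \<in> N\<close> by auto
qed

lemma quotient_M2_M1_iso_U:
  assumes "of_nat CARD('n) \<noteq> (1 :: 'f)"
  shows "giso G (gquot (gsub L M2) M1) (gsub L U)"
proof -
  have "giso G (gquot (gsub L M2) M1) (gquot (gsub L U) {0})"
    using second_isomorphism(1)[OF gmod_L gsub_U gsub_M1]
    unfolding gsum_U_M1_eq_M2[OF assms] U_Int_M1_zero[OF assms] .
  moreover have "giso G (gquot (gsub L U) {0}) (gsub L U)"
    using giso_gquot_zero[OF gmod_U] by simp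
  ultimately show ?thesis by (rule giso_trans)
qed

subsection \<open>The modular case\<close>

lemma U_Int_M1:
  assumes "of_nat CARD('n) = (1 :: 'f)" shows "U \<inter> M1 = M1m"
proof -
  have "l \<in> U" if l: "l \<in> M1m" for l
  proof -
    obtain q where q: "q \<in> dual s" "l = skewmul q" using l M1m_iff by blast
    then show ?thesis using skewmul_K[OF q(1)] by (simp add: U_iff K_iff tr_skewmul assms)
  qed
  then show ?thesis using K_Int_M1 by (auto simp: U_sub_def)
qed

text \<open>When n = 1 in the field, \<open>skewmul\<close> is traceless, so \<open>tr\<close> and
  \<open>qf\<close> agree on \<open>M1\<close>. Conversely, after \<open>leftmul (qf l)\<close> has
  removed the squares, \<open>rho l = 0\<close> says that the rest is traceless.\<close>

lemma gsum_U_M1_iff: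
  assumes "of_nat CARD('n) = (1 :: 'f)"
  shows "l \<in> gsum L U M1 \<longleftrightarrow> l \<in> M2 \<and> rho l = (\<lambda>x. 0)"
proof
  assume "l \<in> gsum L U M1"
  then obtain a b where ab: "l = a + b" "a \<in> U" "b \<in> M1" by (auto simp: gsum_L)
  obtain \<theta> where \<theta>: "\<theta> \<in> dual s" "b = leftmul (qf b) + skewmul \<theta>" using M1_decompose[OF ab(3)] by blast
  have "tr b x = qf b x" for x
    by (subst \<theta>(2)) (simp add: tr_add tr_leftmul[OF qf_dual] tr_skewmul[OF \<theta>(1)] assms)
  then have "rho l x = 0" for x
    using ab(2) by (simp add: ab(1) rho_add) (simp add: rho_def U_iff)
  moreover have "l \<in> M2" using \<open>l \<in> gsum L U M1\<close> gsum_subset_M2 by blast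
  ultimately show "l \<in> M2 \<and> rho l = (\<lambda>x. 0)" by auto
next
  assume l: "l \<in> M2 \<and> rho l = (\<lambda>x. 0)"
  have "rho l x = 0" for x using l by simp
  then have "tr (l - leftmul (qf l)) x = 0" for x
    by (simp add: tr_diff tr_leftmul[OF qf_dual] rho_def)
  then have "l - leftmul (qf l) \<in> U"
    using minus_leftmul_qf l by (simp add: U_iff K_iff)
  then show "l \<in> gsum L U M1" using leftmul_M1[OF qf_dual] by (rule gsum_I)
qed

lemma girreducible_U_quotient:
  assumes "of_nat CARD('n) = (1 :: 'f)" shows "girreducible G (gquot (gsub L U) M1m)"
proof (rule girreducible_gquot[OF gmod_U])
  show "gsubmodule G (gsub L U) M1m"
    using gsubmodule_of_U gsub_M1m U_Int_M1[OF assms] by auto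
  show "M1m \<noteq> gcarrier (gsub L U)" using U_not_subset_M1 M1m_subset by auto
  fix A assume A: "gsubmodule G (gsub L U) A" "M1m \<subseteq> A" "A \<noteq> M1m"
  then have "gsubmodule G L A" "A \<subseteq> U" using gsubmodule_of_U by auto
  then show "A = gcarrier (gsub L U)"
    using U_subset_or_subset_M1[of A] U_subset_M2 A(2,3) U_Int_M1[OF assms]
    by (simp, blast)
qed

lemma quotient_gsum_iso:
  assumes "of_nat CARD('n) = (1 :: 'f)"
  shows "giso G (gquot (gsub L (gsum L U M1)) M1) (gquot (gsub L U) M1m)"
  using second_isomorphism(1)[OF gmod_L gsub_U gsub_M1] unfolding U_Int_M1[OF assms] .

lemma gmod_gsum: "gmod G (gsub L (gsum L U M1))"
  by (rule gmod.gmod_gsub[OF gmod_L gsub_gsum])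

lemma M1_subset_gsum: "M1 \<subseteq> gsum L U M1" and U_subset_gsum: "U \<subseteq> gsum L U M1"
  by (rule gmod.subset_gsum2[OF gmod_L gsub_U gsub_M1] gmod.subset_gsum1[OF gmod_L gsub_U gsub_M1])+

lemma gmod_sub_gsum: "gmod_sub G (gsub L (gsum L U M1)) M1"
  using gmod.gsubmodule_gsub[OF gmod_L gsub_gsum] gsub_M1 M1_subset_gsum
  by (intro gmod_subI gmod_gsum) simp

lemma gmod_sub_M2: "gmod_sub G (gsub L M2) M1"
  using gsubmodule_of_M2 gsub_M1 M1_subset_M2 by (intro gmod_subI gmod_M2) simp

lemma gmod_sub_U:
  assumes "of_nat CARD('n) = (1 :: 'f)" shows "gmod_sub G (gsub L U) M1m"
  using gsubmodule_of_U gsub_M1m U_Int_M1[OF assms] by (intro gmod_subI gmod_U) auto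

lemma girreducible_gsum_quotient:
  assumes "of_nat CARD('n) = (1 :: 'f)"
  shows "girreducible G (gquot (gsub L (gsum L U M1)) M1)"
  by (rule girreducible_giso[OF gmod_sub.gmod_gquot[OF gmod_sub_gsum]
        gmod_sub.gmod_gquot[OF gmod_sub_U[OF assms]] quotient_gsum_iso[OF assms]
        girreducible_U_quotient[OF assms]])

lemma gsum_neq_M2:
  assumes "of_nat CARD('n) = (1 :: 'f)" shows "gsum L U M1 \<noteq> M2"
proof -
  fix i :: 'n
  obtain l where l: "l \<in> M2" "rho l = (\<lambda>x. cd x i)" using rho_surj[OF cd_dual] by blast
  have "rho l \<noteq> (\<lambda>x. 0)" unfolding l(2) by (metis cd_v_same zero_neq_one)
  then show ?thesis using gsum_U_M1_iff[OF assms, of l] l(1) by auto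
qed

text \<open>\<open>rho\<close> identifies the top factor of the quotient with the dual space, and
  \<open>skewmul\<close> does so for the bottom factor of \<open>U\<close>; the other two factors
  agree by the second isomorphism theorem.\<close>

lemma same_factors_M2_M1_U:
  assumes "of_nat CARD('n) = (1 :: 'f)"
  shows "same_composition_factors G (gquot (gsub L M2) M1) (gsub L U)"
proof -
  interpret Q: gmod_sub G "gsub L M2" M1 by (rule gmod_sub_M2)
  let ?S = "gsum L U M1" and ?Q = "gquot (gsub L M2) M1"
  let ?X = "gcoset (gsub L M2) M1 ` ?S"
  have S: "gsubmodule G (gsub L M2) ?S" using gsubmodule_of_M2 gsub_gsum gsum_subset_M2 by blast
  have X: "gsub ?Q ?X = gquot (gsub L ?S) M1"
    using gsub_gquot[of L M2 M1 ?S] by simp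
  have rho_img: "rho ` gcarrier (gsub L M2) = gcarrier (dual_module s)"
    using rho_surj rho_dual by (auto simp: image_iff)
  have isoX: "giso G (gquot ?Q ?X) (dual_module s)"
  proof (rule third_isomorphism[OF gmod_M2 gmod_dual ghom_rho rho_img])
    show "rho l = gzero (dual_module s) \<longleftrightarrow> l \<in> ?S" if "l \<in> gcarrier (gsub L M2)" for l
      using that gsum_U_M1_iff[OF assms, of l] by simp
    show "?S \<subseteq> gcarrier (gsub L M2)" using gsum_subset_M2 by simp
    show "gsubmodule G (gsub L M2) M1" by (rule Q.sub)
    show "M1 \<subseteq> ?S" by (rule M1_subset_gsum)
  qed
  have gX: "gsubmodule G ?Q ?X" by (rule Q.gsubmodule_image_gcoset[OF S])
  have gQX: "gmod G (gquot ?Q ?X)"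
    by (rule gmod_sub.gmod_gquot[OF gmod_subI[OF Q.gmod_gquot gX]])
  have memX: "gcoset (gsub L M2) M1 l \<in> ?X \<longleftrightarrow> l \<in> ?S" if "l \<in> M2" for l
    using Q.gcoset_mem_image_iff[OF S M1_subset_gsum, of l] that by simp
  have X1: "?X \<noteq> {gzero ?Q}"
  proof
    assume X: "?X = {gzero ?Q}"
    obtain l where l: "l \<in> U" "l \<notin> M1" using U_not_subset_M1 by blast
    then have "gcoset (gsub L M2) M1 l \<in> ?X" using U_subset_gsum by blast
    then have "gcoset (gsub L M2) M1 l = M1" using X by (simp add: gzero_gquot)
    then show False using Q.gcoset_eq_N_iff[of l] l U_subset_M2 by auto
  qed
  have X2: "?X \<noteq> gcarrier ?Q"
  proof
    assume X: "?X = gcarrier ?Q"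
    obtain l where l: "l \<in> M2" "l \<notin> ?S" using gsum_neq_M2[OF assms] gsum_subset_M2 by blast
    then have "gcoset (gsub L M2) M1 l \<in> ?X" unfolding X gcarrier_gquot by simp
    then show False using memX l by blast
  qed
  have M1mU: "gsubmodule G (gsub L U) M1m"
    using gsubmodule_of_U gsub_M1m U_Int_M1[OF assms] by auto
  fix i :: 'n
  have "skewmul (\<lambda>x. cd x i) \<noteq> 0"
    using skewmul_eq_0[OF cd_dual, of i "v i"] by auto
  then have M0: "M1m \<noteq> {0}" using M1m_iff cd_dual[of i] by blast
  have MU: "M1m \<noteq> U" using U_not_subset_M1 M1m_subset by auto
  have gM: "gmod G (gsub L M1m)" by (rule gmod.gmod_gsub[OF gmod_L gsub_M1m])
  show ?thesis
  proof (rule same_composition_factors_two[OF Q.gmod_gquot gX X1 X2 _ _ gmod_U M1mU])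
    show "girreducible G (gsub ?Q ?X)"
      unfolding X by (rule girreducible_gsum_quotient[OF assms])
    show "girreducible G (gquot ?Q ?X)"
      by (rule girreducible_giso[OF gQX gmod_dual isoX girreducible_dual])
    show "M1m \<noteq> {gzero (gsub L U)}" using M0 by simp
    show "M1m \<noteq> gcarrier (gsub L U)" using MU by simp
    show "girreducible G (gsub (gsub L U) M1m)"
      using girreducible_giso[OF gM gmod_dual M1m_iso_dual girreducible_dual] by simp
    show "girreducible G (gquot (gsub L U) M1m)" by (rule girreducible_U_quotient[OF assms])
    show "giso G (gsub ?Q ?X) (gquot (gsub L U) M1m)"
      unfolding X by (rule quotient_gsum_iso[OF assms])
    show "giso G (gquot ?Q ?X) (gsub (gsub L U) M1m)"
      using giso_trans[OF isoX giso_sym[OF gM M1m_iso_dual]] by simp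
  qed
qed

text \<open>For \<open>skewmul \<theta>\<close> the form \<psi>([u, y]) is
  \<open>- \<theta> u\<close> times \<open>\<psi>\<close>, so the quadratic part is a wedge of
  proportional forms.\<close>

lemma act_transv_skewmul:
  assumes \<theta>: "\<theta> \<in> dual s" and \<psi>: "\<psi> \<in> dual s" and u: "\<psi> u = 0"
  shows "lam_act s v (skewmul \<theta>) (transv t \<psi> u)
    = skewmul \<theta> + lam_smult t (transv_lin (skewmul \<theta>) \<psi> u)"
proof -
  have M2: "skewmul \<theta> \<in> M2" using skewmul_K[OF \<theta>] K_iff by blast
  have "(\<lambda>y. \<psi> (P (skewmul \<theta>) u y)) = (\<lambda>y. (- \<theta> u) * \<psi> y)"
    by (rule ext) (simp add: P_skewmul[OF \<theta>] dual_simps[OF \<psi>] u)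
  moreover have "wedge (\<lambda>y. (- \<theta> u) * \<psi> y) \<psi> u = 0"
    by (rule P_eqI) (simp only: P_wedge[OF scale_in_dual[OF \<psi>] \<psi>] P_zero, simp)
  ultimately have "wedge (\<lambda>y. \<psi> (P (skewmul \<theta>) u y)) \<psi> u = 0" by simp
  then show ?thesis
    unfolding act_transv[OF M2 \<psi> u] by (simp add: lam_smult_def vec_eq_iff)
qed

lemma not_iso_M2_M1_U:
  assumes "of_nat CARD('n) = (1 :: 'f)"
  shows "\<not> giso G (gquot (gsub L M2) M1) (gsub L U)"
proof
  interpret Q: gmod_sub G "gsub L M2" M1 by (rule gmod_sub_M2)
  let ?Q = "gquot (gsub L M2) M1"
  assume "giso G ?Q (gsub L U)"
  then obtain f where f: "ghom G ?Q (gsub L U) f" and bij: "bij_betw f (gcarrier ?Q) U"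
    by (auto simp: giso_iff_ghom)
  \<comment> \<open>Pulled back to \<open>M2\<close>, so that structure vectors replace cosets; the
    kernel is \<open>M1\<close>.\<close>
  define h where "h = (\<lambda>l. f (gcoset L M1 l))"
  have "ghom G (gsub L M2) (gsub L U) (f \<circ> gcoset (gsub L M2) M1)"
    by (rule ghom_comp[OF Q.ghom_gcoset f])
  then have h: "ghom G (gsub L M2) (gsub L U) h" by (simp add: h_def comp_def)
  have h_add: "h (l + m) = h l + h m" if "l \<in> M2" "m \<in> M2" for l m
    using ghom_add[OF h] that by simp
  have h_smult: "h (lam_smult c l) = lam_smult c (h l)" if "l \<in> M2" for c l
    using ghom_smult[OF h] that by simp
  have h_act: "h (lam_act s v l g) = lam_act s v (h l) g" if "l \<in> M2" "g \<in> G" for l g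
    using ghom_act[OF h] that by simp
  have f0: "f M1 = 0"
    using ghom_zero[OF Q.gmod_gquot gmod_U f] by (simp add: gzero_gquot)
  have h0: "h l = 0 \<longleftrightarrow> l \<in> M1" if l: "l \<in> M2" for l
  proof -
    have 1: "gcoset L M1 l \<in> gcarrier ?Q" using l by (simp add: gcarrier_gquot)
    have "M1 \<in> gcarrier ?Q" using gmod.zero_closed[OF Q.gmod_gquot] by (simp add: gzero_gquot)
    then have "h l = 0 \<longleftrightarrow> gcoset L M1 l = M1"
      using 1 f0 bij unfolding h_def bij_betw_def by (metis inj_on_eq_iff)
    then show ?thesis using Q.gcoset_eq_N_iff[of l] l by simp
  qed
  have h_surj: "\<exists>l\<in>M2. h l = m" if m: "m \<in> U" for m
  proof -
    have "m \<in> f ` gcarrier ?Q" using bij m by (simp add: bij_betw_def)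
    then show ?thesis by (auto simp: gcarrier_gquot h_def)
  qed
  \<comment> \<open>The preimage of \<open>M1m\<close> is a submodule that will contain the chosen
    \<open>l\<close>; this puts \<open>D\<close> and \<open>Q\<close> into \<open>M2\<close>, where
    \<open>h\<close> is linear.\<close>
  let ?N = "{l \<in> gcarrier (gsub L M2). h l \<in> M1m}"
  have M1mU: "gsubmodule G (gsub L U) M1m"
    using gsubmodule_of_U gsub_M1m U_Int_M1[OF assms] by auto
  have "gsubmodule G (gsub L M2) ?N"
    by (rule gsubmodule_preimage[OF gmod_M2 gmod_U h M1mU])
  then interpret N: M2_submodule s v ?N by unfold_locales
  fix i :: 'n
  have skew: "skewmul (\<lambda>x. cd x i) \<noteq> 0" "skewmul (\<lambda>x. cd x i) \<in> M1m"
    using skewmul_eq_0[OF cd_dual, of i "v i"] M1m_iff cd_dual[of i] by auto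
  then obtain l where l: "l \<in> M2" "h l = skewmul (\<lambda>x. cd x i)"
    using h_surj U_Int_M1[OF assms] by blast
  then have lN: "l \<in> ?N" using skew by simp
  have lM1: "l \<notin> M1" using h0[OF l(1)] l(2) skew by simp
  obtain \<psi> u y where \<psi>: "\<psi> \<in> dual s" "\<psi> u = 0" "\<psi> y = 0" "\<psi> (P l u y) = 1"
    using ex_transv_witness[OF lM1] by blast
  define D Q where "D = transv_lin l \<psi> u" and "Q = wedge (\<lambda>y. \<psi> (P l u y)) \<psi> u"
  have DQ: "D \<in> M2" "Q \<in> M2"
    using N.transv_parts[OF lN \<psi>(1,2)] by (simp_all add: D_def Q_def)
  define m E where "m = skewmul (\<lambda>x. cd x i)" and "E = transv_lin m \<psi> u"
  have eq: "lam_smult t (h D) + lam_smult (t^2) (h Q) = lam_smult t E" for t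
  proof -
    have "h (lam_act s v l (transv t \<psi> u)) = h (l + (lam_smult t D + lam_smult (t^2) Q))"
      unfolding act_transv[OF l(1) \<psi>(1,2)] D_def Q_def by (simp add: add.assoc)
    also have "\<dots> = m + (lam_smult t (h D) + lam_smult (t^2) (h Q))"
      using l DQ by (simp add: h_add h_smult M2_add M2_smult m_def)
    also have "h (lam_act s v l (transv t \<psi> u)) = m + lam_smult t E"
      unfolding h_act[OF l(1) transv_GL[OF \<psi>(1,2)]] l(2) E_def m_def
      by (rule act_transv_skewmul[OF cd_dual \<psi>(1,2)])
    finally show ?thesis by simp
  qed
  \<comment> \<open>Subtracting \<open>t\<close> times the identity at 1 from the identity at
    \<open>t\<close> isolates \<open>(t^2 - t) h Q\<close>.\<close>
  obtain t :: 'f where t: "t \<noteq> 0" "t \<noteq> 1" using ex_scalar by blast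
  have "(t^2 - t) * h Q $ a $ b $ c = 0" for a b c
  proof -
    have "t * h D $ a $ b $ c + t^2 * h Q $ a $ b $ c = t * E $ a $ b $ c"
      using eq[of t] by (simp add: lam_smult_def vec_eq_iff)
    moreover have "h D $ a $ b $ c + h Q $ a $ b $ c = E $ a $ b $ c"
      using eq[of 1] by (simp add: lam_smult_def vec_eq_iff)
    ultimately have "t * h D $ a $ b $ c + t^2 * h Q $ a $ b $ c
        = t * (h D $ a $ b $ c + h Q $ a $ b $ c)" by simp
    then show ?thesis by (simp add: algebra_simps)
  qed
  then have "h Q $ a $ b $ c = 0" for a b c using t by (simp add: power2_eq_square)
  then have "h Q = 0" by (simp add: vec_eq_iff)
  then have "Q \<in> M1" using h0 DQ by blast
  then show False
    unfolding Q_def using transv_wedge_notin_M1[OF l(1) \<psi>] by blast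
qed

subsection \<open>Codimension\<close>

sublocale lam: vector_space "lam_smult :: 'f \<Rightarrow> ('f, 'n) struct_vec \<Rightarrow> _"
  by unfold_locales (simp_all add: lam_smult_def vec_eq_iff algebra_simps)

lemma M2_sum: "(\<And>a. a \<in> A \<Longrightarrow> f a \<in> M2) \<Longrightarrow> sum f A \<in> M2"
  by (induction A rule: infinite_finite_induct) (simp_all add: M2_zero M2_add)

text \<open>The unit structure vectors form a finite spanning set; finiteness of independent sets is
  what allows dimensions to be computed by counting basis elements.\<close>

lemma finite_lam_independent:
  fixes B :: "('f, 'n) struct_vec set"
  assumes "\<not> lam.dependent B" shows "finite B"
proof -
  define T where "T = range (\<lambda>(i, j, k). axis i (axis j (axis k (1 :: 'f))) :: ('f, 'n) struct_vec)"
  have ax: "axis i (axis j (axis k (1 :: 'f))) $ a $ b $ c = (if i = a \<and> j = b \<and> k = c then 1 else 0)"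
    for i j k a b c :: 'n
    by (cases "i = a"; cases "j = b") (simp_all add: axis_def)
  have "l \<in> lam.span T" for l :: "('f, 'n) struct_vec"
  proof -
    have "l = (\<Sum>p\<in>UNIV. lam_smult (l $ fst p $ fst (snd p) $ snd (snd p))
        (case p of (i, j, k) \<Rightarrow> axis i (axis j (axis k 1))))"
    proof -
      have "(\<Sum>p\<in>UNIV. lam_smult (l $ fst p $ fst (snd p) $ snd (snd p))
          (case p of (i, j, k) \<Rightarrow> axis i (axis j (axis k 1)))) $ a $ b $ c
        = (\<Sum>p\<in>UNIV. if p = (a, b, c) then l $ a $ b $ c else 0)" for a b c
        unfolding sum_component
        by (rule sum.cong) (auto simp: lam_smult_def ax split: if_splits)
      then show ?thesis by (simp add: vec_eq_iff)
    qed
    also have "\<dots> \<in> lam.span T"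
      by (intro lam.span_sum lam.span_scale lam.span_base) (auto simp: T_def)
    finally show ?thesis .
  qed
  then show ?thesis
    using lam.independent_span_bound[of T B] assms by (auto simp: T_def)
qed

text \<open>Rank and nullity for \<open>rho\<close>: lifts of the coordinate forms extend a basis of
  the kernel \<open>gsum L U M1\<close> to a basis of \<open>M2\<close>, and there are as many of
  them as basis vectors of the space.\<close>

lemma dim_M2:
  assumes "of_nat CARD('n) = (1 :: 'f)"
  shows "lam.dim M2 = lam.dim (gsum L U M1) + CARD('n)"
proof -
  let ?S = "gsum L U M1"
  obtain B where B: "B \<subseteq> ?S" "\<not> lam.dependent B" "?S \<subseteq> lam.span B"
    using lam.maximal_independent_subset by blast
  have fB: "finite B" by (rule finite_lam_independent[OF B(2)])
  have "\<forall>i. \<exists>l\<in>M2. rho l = (\<lambda>x. cd x i)" using rho_surj[OF cd_dual] by blast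
  then obtain c where c: "\<And>i. c i \<in> M2" "\<And>i. rho (c i) = (\<lambda>x. cd x i)" by metis
  have inj_c: "inj c"
  proof (rule injI)
    fix i j assume "c i = c j"
    then have "rho (c i) (v i) = rho (c j) (v i)" by simp
    then show "i = j" unfolding c(2) by (metis cd_v zero_neq_one)
  qed
  have rho_zero: "rho 0 x = 0" for x by (simp add: rho_def qf_zero tr_zero)
  have rho_sum: "rho (sum f A) x = (\<Sum>a\<in>A. rho (f a) x)" for f :: "'b \<Rightarrow> _" and A x
    by (induction A rule: infinite_finite_induct) (simp_all add: rho_zero rho_add)
  have rhoS: "rho b x = 0" if "b \<in> ?S" for b x using that gsum_U_M1_iff[OF assms, of b] by simp
  have disj: "B \<inter> range c = {}"
  proof -
    have "c i \<notin> ?S" for i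
    proof
      assume "c i \<in> ?S"
      then have "rho (c i) (v i) = 0" by (rule rhoS)
      then show False by (simp add: c(2))
    qed
    then show ?thesis using B(1) by blast
  qed
  have rho_combination: "rho (\<Sum>i\<in>UNIV. lam_smult (w i) (c i)) (v j) = w j" for w j
  proof -
    have "rho (\<Sum>i\<in>UNIV. lam_smult (w i) (c i)) (v j) = (\<Sum>i\<in>UNIV. if i = j then w i else 0)"
      unfolding rho_sum by (intro sum.cong refl) (simp add: rho_smult c(2) cd_v)
    then show ?thesis by simp
  qed
  have ind: "\<not> lam.dependent (B \<union> range c)"
  proof
    assume "lam.dependent (B \<union> range c)"
    then obtain w where w: "\<exists>b\<in>B \<union> range c. w b \<noteq> 0" "(\<Sum>b\<in>B \<union> range c. lam_smult (w b) b) = 0"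
      using lam.dependent_finite[of "B \<union> range c"] fB by auto
    have split: "(\<Sum>b\<in>B. lam_smult (w b) b) + (\<Sum>i\<in>UNIV. lam_smult (w (c i)) (c i)) = 0"
      using w(2) fB disj by (simp add: sum.union_disjoint sum.reindex[OF inj_c])
    have wc: "w (c j) = 0" for j
    proof -
      have "rho (\<Sum>b\<in>B. lam_smult (w b) b) (v j) = 0"
        unfolding rho_sum by (rule sum.neutral) (use B(1) in \<open>auto simp: rho_smult rhoS\<close>)
      moreover have "rho ((\<Sum>b\<in>B. lam_smult (w b) b) + (\<Sum>i\<in>UNIV. lam_smult (w (c i)) (c i))) (v j) = 0"
        unfolding split by (rule rho_zero)
      ultimately show ?thesis by (simp add: rho_add rho_combination[of "\<lambda>i. w (c i)"])
    qed
    then have "(\<Sum>b\<in>B. lam_smult (w b) b) = 0" using split by simp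
    then have "\<forall>b\<in>B. w b = 0" using B(2) lam.dependent_finite[OF fB] by blast
    then show False using w(1) wc by auto
  qed
  have "lam.span (B \<union> range c) = lam.span M2"
  proof
    have "B \<union> range c \<subseteq> M2" using B(1) gsum_subset_M2 c(1) by auto
    then show "lam.span (B \<union> range c) \<subseteq> lam.span M2" by (rule lam.span_mono)
    show "lam.span M2 \<subseteq> lam.span (B \<union> range c)"
    proof (rule lam.span_minimal[OF subsetI lam.subspace_span])
      fix l assume l: "l \<in> M2"
      \<comment> \<open>The combination of lifts with the same image as \<open>l\<close> under
        \<open>rho\<close>; the difference then lies in the kernel.\<close>
      define m where "m = (\<Sum>i\<in>UNIV. lam_smult (rho l (v i)) (c i))"
      have "m \<in> M2"
        unfolding m_def by (intro M2_sum M2_smult c(1))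
      then have lm: "l + lam_smult (-1) m \<in> M2" using l by (intro M2_add M2_smult)
      have "rho m (v j) = rho l (v j)" for j unfolding m_def by (rule rho_combination)
      then have "rho (l + lam_smult (-1) m) = (\<lambda>x. 0)"
        by (intro dual_eqI[OF rho_dual zero_in_dual]) (simp only: rho_add rho_smult, simp)
      then have "l + lam_smult (-1) m \<in> lam.span B"
        using lm gsum_U_M1_iff[OF assms] B(3) by blast
      then have 1: "l + lam_smult (-1) m \<in> lam.span (B \<union> range c)"
        using lam.span_mono[of B "B \<union> range c"] by blast
      have 2: "m \<in> lam.span (B \<union> range c)"
        unfolding m_def by (intro lam.span_sum lam.span_scale lam.span_base) auto
      have "l = (l + lam_smult (-1) m) + m" by (simp add: lam_smult_def vec_eq_iff)
      then show "l \<in> lam.span (B \<union> range c)" using lam.span_add[OF 1 2] by simp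
    qed
  qed
  then have "lam.dim M2 = card (B \<union> range c)" using ind by (rule lam.dim_eq_card)
  also have "\<dots> = card B + CARD('n)"
    using card_Un_disjoint[OF fB _ disj] card_image[OF inj_c] by simp
  finally have 1: "lam.dim M2 = card B + CARD('n)" .
  have "lam.span B = lam.span ?S"
  proof
    show "lam.span B \<subseteq> lam.span ?S" using B(1) by (rule lam.span_mono)
    show "lam.span ?S \<subseteq> lam.span B" by (rule lam.span_minimal[OF B(3) lam.subspace_span])
  qed
  then have "card B = lam.dim ?S" using lam.dim_eq_card[OF _ B(2), of ?S] by simp
  then show ?thesis using 1 by simp
qed

end

theorem mainTheorem4:
  fixes s :: "'f::field \<Rightarrow> 'v::ab_group_add \<Rightarrow> 'v"
    and v :: "'n::finite \<Rightarrow> 'v"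
  assumes basis: "vs_basis s v"
    and field_size: "infinite (UNIV :: 'f set) \<or> CARD('f) > 2"
    and dim_ge: "CARD('n) \<ge> 3"
  shows
    "(\<forall>N. gsubmodule (GL s) (gsub (Lam s v) (M2_sub s v)) N \<and> \<not> N \<subseteq> M1_sub s v
        \<longrightarrow> U_sub s v \<subseteq> N)
   \<and> (\<not> CHAR('f) dvd CARD('n) - 1 \<longrightarrow>
        is_internal_direct_sum (Lam s v) (M2_sub s v) (U_sub s v) (M1_sub s v)
      \<and> giso (GL s) (gquot (gsub (Lam s v) (M2_sub s v)) (U_sub s v))
          (gdirect_sum (dual_module s) (dual_module s))
      \<and> giso (GL s) (gquot (gsub (Lam s v) (M2_sub s v)) (M1_sub s v))
          (gsub (Lam s v) (U_sub s v))
      \<and> girreducible (GL s) (gsub (Lam s v) (U_sub s v)))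
   \<and> (CHAR('f) dvd CARD('n) - 1 \<longrightarrow>
        U_sub s v \<inter> M1_sub s v = M1m_sub s v
      \<and> gsubmodule (GL s) (gsub (Lam s v) (M2_sub s v))
          (gsum (Lam s v) (U_sub s v) (M1_sub s v))
      \<and> vector_space.dim lam_smult (M2_sub s v)
          = vector_space.dim lam_smult (gsum (Lam s v) (U_sub s v) (M1_sub s v)) + CARD('n)
      \<and> giso (GL s) (gquot (gsub (Lam s v) (M2_sub s v)) (U_sub s v))
          (gdirect_sum (dual_module s) (dual_module s))
      \<and> girreducible (GL s)
          (gquot (gsub (Lam s v) (gsum (Lam s v) (U_sub s v) (M1_sub s v))) (M1_sub s v))
      \<and> giso (GL s)
          (gquot (gsub (Lam s v) (gsum (Lam s v) (U_sub s v) (M1_sub s v))) (M1_sub s v))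
          (gquot (gsub (Lam s v) (U_sub s v)) (M1m_sub s v))
      \<and> same_composition_factors (GL s)
          (gquot (gsub (Lam s v) (M2_sub s v)) (M1_sub s v))
          (gsub (Lam s v) (U_sub s v))
      \<and> \<not> giso (GL s)
          (gquot (gsub (Lam s v) (M2_sub s v)) (M1_sub s v))
          (gsub (Lam s v) (U_sub s v)))"
proof -
  interpret structure_space s v
    using assms by unfold_locales
  have M2: "U \<subseteq> N" if "gsubmodule G (gsub L M2) N" "\<not> N \<subseteq> M1" for N
    using U_subset_or_subset_M1 gsubmodule_of_M2 that by blast
  have S: "gsubmodule G (gsub L M2) (gsum L U M1)"
    using gsubmodule_of_M2 gsub_gsum gsum_subset_M2 by blast
  show ?thesis
  proof (intro conjI impI allI)
    assume "\<not> CHAR('f) dvd CARD('n) - 1"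
    then have n: "of_nat CARD('n) \<noteq> (1 :: 'f)" by (simp add: of_nat_card_eq_one_iff)
    show "is_internal_direct_sum L M2 U M1"
      by (simp add: is_internal_direct_sum_def gsum_U_M1_eq_M2[OF n] U_Int_M1_zero[OF n])
    show "giso G (gquot (gsub L M2) M1) (gsub L U)" by (rule quotient_M2_M1_iso_U[OF n])
    show "girreducible G (gsub L U)" by (rule girreducible_U[OF n])
  next
    assume "CHAR('f) dvd CARD('n) - 1"
    then have n: "of_nat CARD('n) = (1 :: 'f)" by (simp add: of_nat_card_eq_one_iff)
    show "U \<inter> M1 = M1m" by (rule U_Int_M1[OF n])
    show "vector_space.dim lam_smult M2 = vector_space.dim lam_smult (gsum L U M1) + CARD('n)"
      by (rule dim_M2[OF n])
    show "girreducible G (gquot (gsub L (gsum L U M1)) M1)" by (rule girreducible_gsum_quotient[OF n])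
    show "giso G (gquot (gsub L (gsum L U M1)) M1) (gquot (gsub L U) M1m)"
      by (rule quotient_gsum_iso[OF n])
    show "same_composition_factors G (gquot (gsub L M2) M1) (gsub L U)"
      by (rule same_factors_M2_M1_U[OF n])
    show "\<not> giso G (gquot (gsub L M2) M1) (gsub L U)" by (rule not_iso_M2_M1_U[OF n])
  qed (use M2 S quotient_M2_U_iso in auto)
qed

end
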